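(* Let $K$ be an infinite abelian extension of $\mathbb{Q}$ (an infinite algebraic Galois extension with abelian Galois group). Then the following are equivalent: (a) $K$ has uniformly bounded local degrees, i.e. there is a positive integer $B$ such that $[K_{v_p}:\mathbb{Q}_p]<B$ for every prime $p$ and every valuation $v_p$ of $K$ extending the $p$-adic valuation; (b) there is a positive integer $d$ such that $K\subseteq\mathbb{Q}^{(d)}$; (c) there is a constant $D$ such that every finite subextension of $K/\mathbb{Q}$ can be generated over $\mathbb{Q}$ by elements of degree at most $D$ over $\mathbb{Q}$.
   Context: $\mathbb{Q}^{(d)}$ denotes the compositum, inside a fixed algebraic closure of $\mathbb{Q}$, of all number fields of degree at most $d$ over $\mathbb{Q}$. $K_{v_p}$ is the completion of $K$ with respect to $v_p$. *)

theory Defs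
  imports
    Complex_Main
    "HOL-Library.Extended_Real"
    "HOL-Algebra.Bij"
    "HOL-Algebra.QuotRing"
    "HOL-Algebra.Generated_Fields"
    "HOL-Algebra.Embedded_Algebras"
    "HOL-Algebra.Algebraic_Closure_Type"
begin

section \<open>Subfields of the algebraic numbers\<close>

text \<open>
  The fixed algebraic closure of the rationals is the field of algebraic numbers inside the
  complex numbers. All fields of algebraic numbers are subfields of the ambient field below.
\<close>

abbreviation complex_field :: "complex ring" where
  "complex_field \<equiv> ring_of_type_algebra"

definition finite_degree :: "complex set \<Rightarrow> bool" where
  "finite_degree F \<longleftrightarrow> ring.finite_dimension complex_field \<rat> F"

definition field_degree :: "complex set \<Rightarrow> nat" where
  "field_degree F = ring.dim complex_field \<rat> F"

definition number_field :: "complex set \<Rightarrow> bool" where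
  "number_field F \<longleftrightarrow> subfield F complex_field \<and> finite_degree F"

definition adjoin :: "complex set \<Rightarrow> complex set" where
  "adjoin S = generate_field complex_field (\<rat> \<union> S)"

definition compositum_degree_le :: "nat \<Rightarrow> complex set" where
  "compositum_degree_le d =
     generate_field complex_field (\<Union>{F. number_field F \<and> field_degree F \<le> d})"

text \<open>
  The degree of an algebraic number is the degree of the simple extension it generates. The value
  of \<^const>\<open>field_degree\<close> is only meaningful for fields of finite degree, hence the first conjunct.
\<close>

definition element_degree_le :: "nat \<Rightarrow> complex \<Rightarrow> bool" where
  "element_degree_le d x \<longleftrightarrow> finite_degree (adjoin {x}) \<and> field_degree (adjoin {x}) \<le> d"


section \<open>Abelian extensions\<close>

definition gal_group :: "complex set \<Rightarrow> (complex \<Rightarrow> complex) monoid" where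
  "gal_group K = BijGroup K
     \<lparr>carrier := {\<sigma> \<in> Bij K.
        \<sigma> \<in> ring_hom (complex_field\<lparr>carrier := K\<rparr>) (complex_field\<lparr>carrier := K\<rparr>) \<and>
        (\<forall>x\<in>\<rat>. \<sigma> x = x)}\<rparr>"

definition galois_extension :: "complex set \<Rightarrow> bool" where
  "galois_extension K \<longleftrightarrow>
     subfield K complex_field \<and> (\<forall>x\<in>K. algebraic x) \<and>
     {x \<in> K. \<forall>\<sigma>\<in>carrier (gal_group K). \<sigma> x = x} = \<rat>"

definition abelian_extension :: "complex set \<Rightarrow> bool" where
  "abelian_extension K \<longleftrightarrow> galois_extension K \<and> comm_group (gal_group K)"


section \<open>Valuations and completions\<close>

text \<open>
  Valuations are written additively. A valuation of an algebraic extension of the rationals that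
  extends the \<open>p\<close>-adic one has a value group in which every element has a multiple in the integers,
  so it is no restriction to take real values.
\<close>

definition padic_valuation :: "nat \<Rightarrow> rat \<Rightarrow> ereal" where
  "padic_valuation p q =
     (if q = 0 then \<infinity>
      else ereal (real (multiplicity (int p) (fst (quotient_of q)))
                - real (multiplicity (int p) (snd (quotient_of q)))))"

definition valuation_on :: "complex set \<Rightarrow> (complex \<Rightarrow> ereal) \<Rightarrow> bool" where
  "valuation_on K v \<longleftrightarrow>
     (\<forall>x\<in>K. v x \<noteq> -\<infinity>) \<and>
     (\<forall>x\<in>K. v x = \<infinity> \<longleftrightarrow> x = 0) \<and>
     (\<forall>x\<in>K. \<forall>y\<in>K. v (x * y) = v x + v y) \<and>
     (\<forall>x\<in>K. \<forall>y\<in>K. v (x + y) \<ge> min (v x) (v y))"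

definition extends_padic :: "nat \<Rightarrow> complex set \<Rightarrow> (complex \<Rightarrow> ereal) \<Rightarrow> bool" where
  "extends_padic p K v \<longleftrightarrow>
     valuation_on K v \<and> (\<forall>q. v (of_rat q) = padic_valuation p q)"

text \<open>
  The completion is the ring of Cauchy sequences modulo the ideal of null sequences.
\<close>

definition cauchy_ring :: "complex set \<Rightarrow> (complex \<Rightarrow> ereal) \<Rightarrow> (nat \<Rightarrow> complex) ring" where
  "cauchy_ring K v =
     \<lparr>carrier = {s. range s \<subseteq> K \<and> (\<forall>c::real. \<exists>N. \<forall>m\<ge>N. \<forall>n\<ge>N. v (s m - s n) > ereal c)},
      monoid.mult = (\<lambda>s t n. s n * t n),
      one = (\<lambda>_. 1),
      ring.zero = (\<lambda>_. 0),
      add = (\<lambda>s t n. s n + t n)\<rparr>"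

definition null_sequences :: "complex set \<Rightarrow> (complex \<Rightarrow> ereal) \<Rightarrow> (nat \<Rightarrow> complex) set" where
  "null_sequences K v = {s. range s \<subseteq> K \<and> (\<lambda>n. v (s n)) \<longlonglongrightarrow> \<infinity>}"

definition completion :: "complex set \<Rightarrow> (complex \<Rightarrow> ereal) \<Rightarrow> (nat \<Rightarrow> complex) set ring" where
  "completion K v = cauchy_ring K v Quot null_sequences K v"

text \<open>
  If \<open>v\<close> extends the \<open>p\<close>-adic valuation, then the completion of the rationals embeds into the
  completion of \<open>K\<close>. The image of this embedding, the copy of the \<open>p\<close>-adic numbers over which the
  local degree is taken, consists of the classes of Cauchy sequences of rationals.
\<close>

definition completion_rat :: "complex set \<Rightarrow> (complex \<Rightarrow> ereal) \<Rightarrow> (nat \<Rightarrow> complex) set set" where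
  "completion_rat K v =
     (\<lambda>s. null_sequences K v +>\<^bsub>cauchy_ring K v\<^esub> s) ` carrier (cauchy_ring \<rat> v)"

definition local_degree_less :: "complex set \<Rightarrow> (complex \<Rightarrow> ereal) \<Rightarrow> nat \<Rightarrow> bool" where
  "local_degree_less K v B \<longleftrightarrow>
     ring.finite_dimension (completion K v) (completion_rat K v) (carrier (completion K v)) \<and>
     ring.dim (completion K v) (completion_rat K v) (carrier (completion K v)) < B"

definition uniformly_bounded_local_degrees :: "complex set \<Rightarrow> bool" where
  "uniformly_bounded_local_degrees K \<longleftrightarrow>
     (\<exists>B>0. \<forall>p v. prime p \<longrightarrow> extends_padic p K v \<longrightarrow> local_degree_less K v B)"

end

theory Submission
  imports Defs "HOL-Computational_Algebra.Fundamental_Theorem_Algebra"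
begin

text \<open>
  All three conditions say that \<open>Gal(K/\<rat>)\<close> has finite exponent.

  If it has exponent \<open>N\<close>, averaging over the powers of finitely many automorphisms, with values
  twisted by \<open>N\<close>-th roots of unity, splits every element of \<open>K\<close> into elements with at most \<open>N\<close>
  conjugates, which generate the same fields. It also places \<open>K\<close> in the field generated by elements
  \<open>y\<close> with \<open>y\<^sup>N \<in> \<rat>(\<zeta>)\<close>; locally at \<open>p\<close> there are boundedly many \<open>N\<close>-th power classes, uniformly
  in \<open>p\<close>, and by Newton iteration nearby elements lie in the same class, so the local degrees are
  bounded. Conversely, an automorphism permutes the at most \<open>d\<close> conjugates of an element of degree at
  most \<open>d\<close>, so an abelian \<open>K \<subseteq> \<rat>\<^sup>(\<^sup>d\<^sup>)\<close> has exponent dividing \<open>d!\<close>.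

  If all local degrees are less than \<open>B\<close>, every element of a decomposition group has order dividing
  \<open>B!\<close>. The decomposition groups generate \<open>Gal(K/\<rat>)\<close> topologically; in place of Chebotarev's
  theorem this uses that an algebraic number \<open>\<alpha>\<close> which all of them fix is, by weak approximation, a
  limit of rational numbers at every absolute value. Hence the rational numbers
  \<open>\<Prod>\<^sub>\<beta> (\<beta> choose k)\<close>, with \<open>\<beta>\<close> ranging over the conjugates of \<open>\<alpha>\<close>, made algebraic
  integers of nonnegative real part, are integral at every \<open>p\<close>; they tend to \<open>0\<close> as \<open>k\<close> grows, so
  one of them vanishes and \<open>\<alpha>\<close> is rational.
\<close>

section \<open>Fields of algebraic numbers and polynomials over them\<close>

text \<open>The roots of unity need not lie in \<open>K\<close>, and automorphisms of
  \<open>K\<close> do not act on them. So the twisted averages are formed in K \<otimes>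
  \<rat>[Z/N]: an element is a function Z/N \<rightarrow> K, multiplication by \<zeta> is a shift of
  its argument, and only at the end is \<zeta>^m replaced by l (\<zeta>^m) for an additive map l. If
  l has rational values and l 1 = 1, then x becomes a rational combination of coefficients with few
  conjugates, which gives (c). If l is the identity, x becomes a sum of Kummer radicals y, which
  gives (a). Since x is a sum of the y, the dimensions of their local spans add up, and no
  compositum of local fields has to be formed.

  As \<open>K\<close> has infinite degree, its Galois group is handled without a topology: each
  argument works at one x at a time, inside \<rat>(x), which all automorphisms preserve because they
  commute. Local statements are phrased by rational approximation inside fields of algebraic
  numbers; completions enter only to translate the definition of the local degree.\<close>

definition polys_over :: "complex set \<Rightarrow> complex poly set" where
  "polys_over k = {p. \<forall>i. coeff p i \<in> k}"

lemma coeff_polys_over: "p \<in> polys_over k \<Longrightarrow> coeff p i \<in> k"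
  by (simp add: polys_over_def)

lemma polys_over_pConsD:
  assumes "pCons a p \<in> polys_over k"
  shows "a \<in> k" "p \<in> polys_over k"
proof -
  have c: "coeff (pCons a p) i \<in> k" for i using assms by (simp add: polys_over_def)
  show "a \<in> k" using c[of 0] by simp
  have "coeff p i \<in> k" for i using c[of "Suc i"] by simp
  then show "p \<in> polys_over k" by (simp add: polys_over_def)
qed

lemma polys_over_mono: "k \<subseteq> l \<Longrightarrow> polys_over k \<subseteq> polys_over l"
  by (auto simp: polys_over_def)

text \<open>Closure under inverses is derived in \<open>inverse_closed\<close>: the inverse of a
  nonzero algebraic number is a rational polynomial in it, so a ring of algebraic numbers containing
  \<rat> is a field.\<close>

locale number_subfield =
  fixes k :: "complex set"
  assumes Rats_subset: "\<rat> \<subseteq> k"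
    and add_closed [intro]: "x \<in> k \<Longrightarrow> y \<in> k \<Longrightarrow> x + y \<in> k"
    and mult_closed [intro]: "x \<in> k \<Longrightarrow> y \<in> k \<Longrightarrow> x * y \<in> k"
    and algebraic_elems: "x \<in> k \<Longrightarrow> algebraic x"
begin

lemma Rats_in [simp, intro]: "x \<in> \<rat> \<Longrightarrow> x \<in> k"
  using Rats_subset by auto

lemma zero_closed [simp, intro]: "0 \<in> k" and one_closed [simp, intro]: "1 \<in> k"
  by auto

lemma uminus_closed [intro]: "x \<in> k \<Longrightarrow> - x \<in> k"
  using mult_closed[of "-1" x] by auto

lemma diff_closed [intro]: "x \<in> k \<Longrightarrow> y \<in> k \<Longrightarrow> x - y \<in> k"
  using add_closed[of x "-y"] by auto

lemma power_closed [intro]: "x \<in> k \<Longrightarrow> x ^ n \<in> k"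
  by (induction n) auto

lemma sum_closed [intro]: "(\<And>i. i \<in> I \<Longrightarrow> f i \<in> k) \<Longrightarrow> sum f I \<in> k"
  by (induction I rule: infinite_finite_induct) auto

lemma prod_closed [intro]: "(\<And>i. i \<in> I \<Longrightarrow> f i \<in> k) \<Longrightarrow> prod f I \<in> k"
  by (induction I rule: infinite_finite_induct) auto

lemma poly_closed: "p \<in> polys_over k \<Longrightarrow> x \<in> k \<Longrightarrow> poly p x \<in> k"
  by (auto simp: poly_altdef intro!: sum_closed mult_closed power_closed coeff_polys_over)

lemma polys_over_const [intro]: "c \<in> k \<Longrightarrow> [:c:] \<in> polys_over k"
  by (auto simp: polys_over_def coeff_pCons split: nat.splits)

lemma polys_over_0 [simp, intro]: "0 \<in> polys_over k"
  and polys_over_1 [simp, intro]: "1 \<in> polys_over k"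
  by (auto simp: polys_over_def coeff_pCons split: nat.splits)

lemma polys_over_pCons [intro]: "c \<in> k \<Longrightarrow> p \<in> polys_over k \<Longrightarrow> pCons c p \<in> polys_over k"
  by (auto simp: polys_over_def coeff_pCons split: nat.splits)

lemma polys_over_add [intro]:
  "p \<in> polys_over k \<Longrightarrow> q \<in> polys_over k \<Longrightarrow> p + q \<in> polys_over k"
  by (auto simp: polys_over_def)

lemma polys_over_diff [intro]:
  "p \<in> polys_over k \<Longrightarrow> q \<in> polys_over k \<Longrightarrow> p - q \<in> polys_over k"
  by (auto simp: polys_over_def)

lemma polys_over_mult [intro]:
  "p \<in> polys_over k \<Longrightarrow> q \<in> polys_over k \<Longrightarrow> p * q \<in> polys_over k"
  by (auto simp: polys_over_def coeff_mult)

lemma polys_over_smult [intro]: "c \<in> k \<Longrightarrow> p \<in> polys_over k \<Longrightarrow> smult c p \<in> polys_over k"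
  by (auto simp: polys_over_def)

lemma polys_over_monom [intro]: "c \<in> k \<Longrightarrow> monom c n \<in> polys_over k"
  by (auto simp: polys_over_def)

lemma polys_over_sum [intro]:
  "(\<And>i. i \<in> I \<Longrightarrow> f i \<in> polys_over k) \<Longrightarrow> sum f I \<in> polys_over k"
  by (induction I rule: infinite_finite_induct) auto

lemma polys_over_prod [intro]:
  "(\<And>i. i \<in> I \<Longrightarrow> f i \<in> polys_over k) \<Longrightarrow> prod f I \<in> polys_over k"
  by (induction I rule: infinite_finite_induct) auto

lemma Rats_polys_over: "p \<in> polys_over \<rat> \<Longrightarrow> p \<in> polys_over k"
  using polys_over_mono[OF Rats_subset] by auto

end

lemma number_subfield_Rats: "number_subfield \<rat>"
  by unfold_locales (auto simp: rat_imp_algebraic)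

text \<open>An annihilating polynomial of least degree has constant term a \<noteq> 0, since
  otherwise the variable could be cancelled. Solving a + z * q(z) = 0 for the inverse of z gives the
  polynomial.\<close>

lemma inverse_eq_poly:
  assumes "algebraic z" "z \<noteq> 0"
  shows "\<exists>p\<in>polys_over \<rat>. inverse z = poly p z"
proof -
  interpret Q: number_subfield \<rat> by (rule number_subfield_Rats)
  define P where "P = (\<lambda>p::complex poly. p \<in> polys_over \<rat> \<and> p \<noteq> 0 \<and> poly p z = 0)"
  have "\<exists>p. P p" using assms(1) unfolding P_def algebraic_altdef polys_over_def by auto
  then obtain p where p: "P p" and min: "\<And>q. P q \<Longrightarrow> degree p \<le> degree q"
    using ex_has_least_nat[of P _ degree] by auto
  obtain a q where pq: "p = pCons a q" by (cases p)
  have q: "q \<in> polys_over \<rat>" and a: "a \<in> \<rat>"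
    using p polys_over_pConsD[of a q] unfolding P_def pq by auto
  have e: "a + z * poly q z = 0" using p pq by (auto simp: P_def)
  have "a \<noteq> 0"
  proof
    assume "a = 0"
    with p pq have q0: "q \<noteq> 0" by (auto simp: P_def)
    have "P q" using e \<open>a = 0\<close> assms(2) q q0 by (auto simp: P_def)
    from min[OF this] pq q0 show False by simp
  qed
  have "z * (- poly q z / a) = 1" 
  proof -
    have "z * poly q z = - a" using e by (simp add: eq_neg_iff_add_eq_0 add.commute)
    then show ?thesis using \<open>a \<noteq> 0\<close> by simp
  qed
  then have "inverse z = poly (smult (- inverse a) q) z"
    using assms(2) \<open>a \<noteq> 0\<close> by (simp add: field_simps)
  moreover have "smult (- inverse a) q \<in> polys_over \<rat>" using a q by (intro Q.polys_over_smult) auto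
  ultimately show ?thesis by blast
qed

context number_subfield begin

lemma inverse_closed [intro]: "x \<in> k \<Longrightarrow> inverse x \<in> k"
  using inverse_eq_poly[OF algebraic_elems, of x] poly_closed[OF Rats_polys_over, of _ x]
  by (cases "x = 0") auto

lemma divide_closed [intro]: "x \<in> k \<Longrightarrow> y \<in> k \<Longrightarrow> x / y \<in> k"
  using mult_closed[of x "inverse y"] by (auto simp: divide_inverse)

lemma polys_over_division:
  assumes "g \<in> polys_over k" "g \<noteq> 0" "p \<in> polys_over k"
  shows "\<exists>q\<in>polys_over k. \<exists>r\<in>polys_over k. p = q * g + r \<and> (r = 0 \<or> degree r < degree g)"
  using assms(3)
proof (induction "degree p" arbitrary: p rule: less_induct)
  case less
  show ?case
  proof (cases "degree p < degree g \<or> p = 0")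
    case True
    then show ?thesis using less.prems by (intro bexI[of _ 0] bexI[of _ p]) auto
  next
    case False
    then have d: "degree g \<le> degree p" and p0: "p \<noteq> 0" by auto
    define c where "c = lead_coeff p / lead_coeff g"
    have c: "c \<in> k" "c \<noteq> 0" unfolding c_def using assms(1,2) less.prems p0
      by (auto simp: coeff_polys_over)
    define m where "m = monom c (degree p - degree g)"
    have m: "m \<in> polys_over k" unfolding m_def using c by auto
    define p' where "p' = p - m * g"
    have p': "p' \<in> polys_over k" unfolding p'_def using m assms(1) less.prems by auto
    have dm: "degree (m * g) = degree p"
      using d c assms(2) by (simp add: m_def degree_mult_eq degree_monom_eq)
    have lm: "coeff (m * g) (degree p) = lead_coeff p"
    proof -
      have "coeff (m * g) (degree p) = lead_coeff (m * g)" by (simp add: dm)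
      also have "\<dots> = c * lead_coeff g" by (simp only: lead_coeff_mult) (simp add: m_def degree_monom_eq c)
      finally show ?thesis using assms(2) by (simp add: c_def)
    qed
    have "p' = 0 \<or> degree p' < degree p"
    proof (cases "degree p = 0")
      case True
      then have "p' = 0" unfolding p'_def using dm lm
        by (metis degree_0_id degree_eq_zeroE degree_pCons_0 diff_self coeff_pCons_0)
      then show ?thesis ..
    next
      case False
      have "coeff p' (degree p) = 0" unfolding p'_def using lm by simp
      moreover have "degree p' \<le> degree p" unfolding p'_def using dm
        by (metis degree_diff_le order_refl)
      ultimately show ?thesis
        by (metis False degree_0 le_neq_implies_less leading_coeff_0_iff)
    qed
    then obtain q r where qr: "q \<in> polys_over k" "r \<in> polys_over k" "p' = q * g + r"
      "r = 0 \<or> degree r < degree g"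
      using less.hyps[OF _ p'] by (cases "p' = 0") (force simp: algebra_simps)+
    have "p = (q + m) * g + r" using qr(3) by (simp add: p'_def algebra_simps)
    then show ?thesis using qr m by (intro bexI[of _ "q + m"] bexI[of _ r]) auto
  qed
qed

end

lemma number_subfield_polys_at:
  assumes "number_subfield k" "algebraic y" "\<And>p. p \<in> polys_over k \<Longrightarrow> algebraic (poly p y)"
  shows "number_subfield ((\<lambda>p. poly p y) ` polys_over k)"
proof -
  interpret number_subfield k by fact
  show ?thesis
  proof
    show "\<rat> \<subseteq> (\<lambda>p. poly p y) ` polys_over k"
    proof
      fix q :: complex assume "q \<in> \<rat>"
      then show "q \<in> (\<lambda>p. poly p y) ` polys_over k"
        by (intro image_eqI[of _ _ "[:q:]"]) auto
    qed
    fix u v assume "u \<in> (\<lambda>p. poly p y) ` polys_over k" "v \<in> (\<lambda>p. poly p y) ` polys_over k"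
    then obtain p q where pq: "p \<in> polys_over k" "q \<in> polys_over k" "u = poly p y" "v = poly q y" by auto
    show "u + v \<in> (\<lambda>p. poly p y) ` polys_over k" using pq by (auto intro!: image_eqI[of _ _ "p + q"])
    show "u * v \<in> (\<lambda>p. poly p y) ` polys_over k" using pq by (auto intro!: image_eqI[of _ _ "p * q"])
    show "algebraic u" using pq assms(3) by auto
  qed
qed

subsection \<open>Homomorphisms\<close>

text \<open>An embedding of k into the complex numbers. It may move k to another field, and its
  values outside k are arbitrary.\<close>

locale number_field_hom = number_subfield k for k +
  fixes f :: "complex \<Rightarrow> complex"
  assumes hom_one: "f 1 = 1"
    and hom_add: "x \<in> k \<Longrightarrow> y \<in> k \<Longrightarrow> f (x + y) = f x + f y"
    and hom_mult: "x \<in> k \<Longrightarrow> y \<in> k \<Longrightarrow> f (x * y) = f x * f y"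
begin

lemma hom_zero [simp]: "f 0 = 0"
  using hom_add[of 0 0] by simp

lemma hom_uminus: "x \<in> k \<Longrightarrow> f (- x) = - f x"
  using hom_add[of x "-x"] by (auto simp: eq_neg_iff_add_eq_0 add.commute)

lemma hom_diff: "x \<in> k \<Longrightarrow> y \<in> k \<Longrightarrow> f (x - y) = f x - f y"
  using hom_add[of x "-y"] hom_uminus[of y] by auto

lemma hom_sum: "(\<And>i. i \<in> I \<Longrightarrow> u i \<in> k) \<Longrightarrow> f (sum u I) = (\<Sum>i\<in>I. f (u i))"
  by (induction I rule: infinite_finite_induct) (auto simp: hom_add sum_closed)

lemma hom_prod: "(\<And>i. i \<in> I \<Longrightarrow> u i \<in> k) \<Longrightarrow> f (prod u I) = (\<Prod>i\<in>I. f (u i))"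
  by (induction I rule: infinite_finite_induct) (auto simp: hom_mult hom_one prod_closed)

lemma hom_of_nat: "f (of_nat n) = of_nat n"
  by (induction n) (auto simp: hom_add hom_one)

lemma hom_nonzero: "x \<in> k \<Longrightarrow> x \<noteq> 0 \<Longrightarrow> f x \<noteq> 0"
  using hom_mult[of x "inverse x"] inverse_closed[of x] by (auto simp: hom_one)

lemma hom_inverse: "x \<in> k \<Longrightarrow> f (inverse x) = inverse (f x)"
  using hom_mult[of x "inverse x"] inverse_closed[of x]
  by (cases "x = 0") (auto simp: hom_one inverse_unique[symmetric])

lemma hom_divide: "x \<in> k \<Longrightarrow> y \<in> k \<Longrightarrow> f (x / y) = f x / f y"
  by (auto simp: divide_inverse hom_mult hom_inverse inverse_closed)

lemma hom_of_int: "f (of_int n) = of_int n"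
proof (cases n)
  case (nonneg m)
  then show ?thesis by (simp add: hom_of_nat)
next
  case (neg m)
  have "f (- of_nat (Suc m)) = - of_nat (Suc m)"
    by (subst hom_uminus) (auto simp: hom_of_nat[of "Suc m", unfolded of_nat_Suc])
  then show ?thesis using neg by simp
qed

lemma hom_Rats: "x \<in> \<rat> \<Longrightarrow> f x = x"
proof (erule Rats_cases')
  fix a b :: int
  assume x: "x = of_int a / of_int b"
  show "f x = x" unfolding x by (subst hom_divide) (auto simp: hom_of_int)
qed

lemma hom_inj: "inj_on f k"
proof (rule inj_onI)
  fix x y assume xy: "x \<in> k" "y \<in> k" "f x = f y"
  then have "f (x - y) = 0" by (simp add: hom_diff)
  then show "x = y" using hom_nonzero[of "x - y"] xy by auto
qed

lemma coeff_map_hom [simp]: "coeff (map_poly f p) i = f (coeff p i)"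
  by (simp add: coeff_map_poly)

lemma hom_poly:
  assumes "p \<in> polys_over k" "x \<in> k"
  shows "f (poly p x) = poly (map_poly f p) (f x)"
  using assms(1)
proof (induction p)
  case 0
  then show ?case by simp
next
  case (pCons a p)
  from pCons.prems have a: "a \<in> k" and p: "p \<in> polys_over k"
    by (auto dest: polys_over_pConsD)
  show ?case using pCons.IH[OF p] a p assms(2)
    by (auto simp: map_poly_pCons hom_add hom_mult poly_closed mult_closed)
qed

lemma map_hom_add:
  "p \<in> polys_over k \<Longrightarrow> q \<in> polys_over k \<Longrightarrow> map_poly f (p + q) = map_poly f p + map_poly f q"
  by (auto simp: poly_eq_iff hom_add coeff_polys_over)

lemma map_hom_mult:
  "p \<in> polys_over k \<Longrightarrow> q \<in> polys_over k \<Longrightarrow> map_poly f (p * q) = map_poly f p * map_poly f q"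
  by (auto simp: poly_eq_iff coeff_mult hom_sum hom_mult coeff_polys_over mult_closed)

lemma map_hom_prod:
  "(\<And>i. i \<in> I \<Longrightarrow> u i \<in> polys_over k) \<Longrightarrow> map_poly f (prod u I) = (\<Prod>i\<in>I. map_poly f (u i))"
  by (induction I rule: infinite_finite_induct)
     (auto simp: map_hom_mult hom_one map_poly_1' polys_over_prod)

lemma map_hom_sum:
  "(\<And>i. i \<in> I \<Longrightarrow> u i \<in> polys_over k) \<Longrightarrow> map_poly f (sum u I) = (\<Sum>i\<in>I. map_poly f (u i))"
  by (induction I rule: infinite_finite_induct) (auto simp: map_hom_add polys_over_sum)

lemma map_hom_Rats: "p \<in> polys_over \<rat> \<Longrightarrow> map_poly f p = p"
  by (auto simp: poly_eq_iff hom_Rats coeff_polys_over)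

lemma hom_poly_Rats: "p \<in> polys_over \<rat> \<Longrightarrow> x \<in> k \<Longrightarrow> f (poly p x) = poly p (f x)"
  by (simp add: hom_poly Rats_polys_over map_hom_Rats)

end

subsection \<open>Rational linear algebra\<close>

interpretation rat_space: vector_space "\<lambda>(q::rat) (x::complex). of_rat q * x"
  by unfold_locales (auto simp: algebra_simps of_rat_add of_rat_mult)

lemma rat_space_scale_Rats:
  "c \<in> \<rat> \<Longrightarrow> x \<in> rat_space.span B \<Longrightarrow> c * x \<in> rat_space.span B"
  by (metis Rats_cases rat_space.span_scale)

text \<open>An indexed family may repeat a vector. Then the difference of the two equal entries is
  the relation; the dimension bound is for the injective case.\<close>

lemma rat_space_relation:
  fixes f :: "'i \<Rightarrow> complex"
  assumes "finite B" "finite I" "card B < card I" "f ` I \<subseteq> rat_space.span B"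
  shows "\<exists>u. (\<forall>i. u i \<in> \<rat>) \<and> (\<exists>i\<in>I. u i \<noteq> 0) \<and> (\<Sum>i\<in>I. u i * f i) = 0"
proof (cases "inj_on f I")
  case True
  have "card (f ` I) > card B" using assms True by (simp add: card_image)
  then have "rat_space.dependent (f ` I)"
    using rat_space.independent_span_bound[OF assms(1) _ assms(4)] by auto
  then obtain u v where uv: "v \<in> f ` I" "u v \<noteq> 0" "(\<Sum>v\<in>f ` I. of_rat (u v) * v) = 0"
    using rat_space.dependent_finite[of "f ` I"] assms(2) by auto
  have "(\<Sum>i\<in>I. of_rat (u (f i)) * f i) = 0" using uv(3) by (simp add: sum.reindex[OF True])
  with uv show ?thesis by (intro exI[of _ "\<lambda>i. of_rat (u (f i))"]) auto
next
  case False
  then obtain i j where ij: "i \<in> I" "j \<in> I" "i \<noteq> j" "f i = f j" by (auto simp: inj_on_def)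
  define u where "u = (\<lambda>l. if l = i then 1 else if l = j then -1 else (0::complex))"
  have "(\<Sum>l\<in>I. u l * f l) = (\<Sum>l\<in>{i,j}. u l * f l)"
    by (rule sum.mono_neutral_right) (use assms ij in \<open>auto simp: u_def\<close>)
  also have "\<dots> = 0" using ij by (simp add: u_def)
  finally show ?thesis using ij by (intro exI[of _ u]) (auto simp: u_def)
qed

lemma rat_poly_of_powers:
  assumes "finite B" "\<And>i. i \<le> card B \<Longrightarrow> z ^ i \<in> rat_space.span B"
  shows "\<exists>p\<in>polys_over \<rat>. p \<noteq> 0 \<and> degree p \<le> card B \<and> poly p z = 0"
proof -
  interpret Q: number_subfield \<rat> by (rule number_subfield_Rats)
  obtain u where u: "\<And>i. u i \<in> \<rat>" "\<exists>i\<in>{..card B}. u i \<noteq> 0" "(\<Sum>i\<le>card B. u i * z ^ i) = 0"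
    using rat_space_relation[OF assms(1), of "{..card B}" "\<lambda>i. z ^ i"] assms(2) by auto
  define p where "p = (\<Sum>i\<le>card B. monom (u i) i)"
  have c: "coeff p i = (if i \<le> card B then u i else 0)" for i
    by (simp add: p_def coeff_sum coeff_monom if_distrib cong: if_cong)
  show ?thesis
  proof (intro bexI[of _ p] conjI)
    show "p \<in> polys_over \<rat>" unfolding p_def using u(1) by auto
    show "p \<noteq> 0" using u(2) c by (metis atMost_iff coeff_0)
    show "degree p \<le> card B" by (rule degree_le) (simp add: c)
    show "poly p z = 0" using u(3) by (simp add: p_def poly_sum poly_monom)
  qed
qed

lemma span_polys_at:
  assumes "p \<in> polys_over \<rat>" "p \<noteq> 0" "poly p x = 0"
  shows "x ^ n \<in> rat_space.span ((\<lambda>i. x ^ i) ` {..<degree p})"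
proof (induction n rule: less_induct)
  case (less n)
  show ?case
  proof (cases "n < degree p")
    case True
    then show ?thesis by (intro rat_space.span_base) auto
  next
    case False
    define d where "d = degree p"
    define a where "a = lead_coeff p"
    have a: "a \<noteq> 0" using assms by (simp add: a_def)
    have "0 = (\<Sum>i\<le>d. coeff p i * x ^ i)" using assms(3) by (simp add: poly_altdef d_def)
    also have "\<dots> = (\<Sum>i<d. coeff p i * x ^ i) + a * x ^ d"
      by (simp add: d_def a_def lessThan_Suc_atMost[symmetric])
    finally have e: "x ^ d = (\<Sum>i<d. (- coeff p i / a) * x ^ i)"
      using a by (simp add: field_simps sum_divide_distrib[symmetric] sum_negf eq_neg_iff_add_eq_0 add.commute)
    have "x ^ n = x ^ (n - d) * x ^ d" using False by (simp add: d_def power_add[symmetric])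
    also have "\<dots> = (\<Sum>i<d. (- coeff p i / a) * x ^ (n - d + i))"
      by (simp add: e sum_distrib_left power_add ac_simps)
    also have "\<dots> \<in> rat_space.span ((\<lambda>i. x ^ i) ` {..<degree p})"
    proof (intro rat_space.span_sum rat_space_scale_Rats)
      fix i assume "i \<in> {..<d}"
      then have "n - d + i < n" using False by (auto simp: d_def)
      then show "x ^ (n - d + i) \<in> rat_space.span ((\<lambda>i. x ^ i) ` {..<degree p})" by (rule less)
      show "- coeff p i / a \<in> \<rat>" using assms(1) by (auto simp: a_def coeff_polys_over)
    qed
    finally show ?thesis .
  qed
qed

lemma poly_at_in_span:
  assumes "p \<in> polys_over \<rat>" "p \<noteq> 0" "poly p x = 0" "q \<in> polys_over \<rat>"
  shows "poly q x \<in> rat_space.span ((\<lambda>i. x ^ i) ` {..<degree p})"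
  unfolding poly_altdef using assms
  by (intro rat_space.span_sum rat_space_scale_Rats span_polys_at) (auto simp: coeff_polys_over)

lemma rat_space_span_mult:
  assumes "\<And>b. b \<in> B \<Longrightarrow> z * b \<in> rat_space.span B" "v \<in> rat_space.span B"
  shows "z * v \<in> rat_space.span B"
  using assms(2)
proof (induction rule: rat_space.span_induct_alt)
  case base
  then show ?case using rat_space.span_zero by simp
next
  case (step c b v)
  have "z * (of_rat c * b + v) = of_rat c * (z * b) + z * v" by (simp add: algebra_simps)
  then show ?case using step assms(1) by (auto intro: rat_space.span_add rat_space.span_scale)
qed

text \<open>A finite-dimensional space that contains 1 and is stable under z contains all powers of
  z, so these are linearly dependent.\<close>

lemma algebraic_if_stable_span:
  assumes "finite B" "1 \<in> rat_space.span B" "\<And>b. b \<in> B \<Longrightarrow> z * b \<in> rat_space.span B"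
  shows "algebraic z"
proof -
  have "z ^ i \<in> rat_space.span B" for i
    by (induction i) (use assms rat_space_span_mult[OF assms(3)] in auto)
  then show ?thesis using rat_poly_of_powers[OF assms(1), of z]
    unfolding algebraic_altdef polys_over_def by auto
qed

text \<open>The products x^i * y^j with bounded exponents span a space stable under x and under y,
  hence under their sum and product.\<close>

lemma
  assumes "algebraic x" "algebraic (y::complex)"
  shows algebraic_add: "algebraic (x + y)" and algebraic_mult: "algebraic (x * y)"
proof -
  obtain p where p: "p \<in> polys_over \<rat>" "p \<noteq> 0" "poly p x = 0"
    using assms(1) unfolding algebraic_altdef polys_over_def by auto
  obtain q where q: "q \<in> polys_over \<rat>" "q \<noteq> 0" "poly q y = 0"
    using assms(2) unfolding algebraic_altdef polys_over_def by auto
  define B where "B = (\<lambda>(i,j). x ^ i * y ^ j) ` ({..<degree p} \<times> {..<degree q})"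
  have B: "x ^ m * y ^ n \<in> rat_space.span B" for m n
  proof -
    have 1: "x ^ i * v \<in> rat_space.span B"
      if "i < degree p" "v \<in> rat_space.span ((\<lambda>i. y ^ i) ` {..<degree q})" for i v
      using that(2)
    proof (induction rule: rat_space.span_induct_alt)
      case base
      then show ?case using rat_space.span_zero by simp
    next
      case (step c b v)
      have "x ^ i * b \<in> B" using step that(1) by (auto simp: B_def)
      moreover have "x ^ i * (of_rat c * b + v) = of_rat c * (x ^ i * b) + x ^ i * v"
        by (simp add: algebra_simps)
      ultimately show ?case using step
        by (simp add: rat_space.span_add rat_space.span_scale rat_space.span_base)
    qed
    have "u * y ^ n \<in> rat_space.span B" if "u \<in> rat_space.span ((\<lambda>i. x ^ i) ` {..<degree p})" for u
      using that
    proof (induction rule: rat_space.span_induct_alt)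
      case base
      then show ?case using rat_space.span_zero by simp
    next
      case (step c b v)
      have "b * y ^ n \<in> rat_space.span B" using step 1[OF _ span_polys_at[OF q]] by auto
      moreover have "(of_rat c * b + v) * y ^ n = of_rat c * (b * y ^ n) + v * y ^ n"
        by (simp add: algebra_simps)
      ultimately show ?case using step
        by (auto intro!: rat_space.span_add rat_space.span_scale)
    qed
    then show ?thesis using span_polys_at[OF p] by blast
  qed
  have f: "finite B" by (simp add: B_def)
  have one: "1 \<in> rat_space.span B" using B[of 0 0] by simp
  have xb: "x * b \<in> rat_space.span B" and yb: "y * b \<in> rat_space.span B" if bB: "b \<in> B" for b
  proof -
    obtain i j where b: "b = x ^ i * y ^ j" using bB by (auto simp: B_def)
    show "x * b \<in> rat_space.span B" "y * b \<in> rat_space.span B"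
      using B[of "Suc i" j] B[of i "Suc j"] unfolding b by (simp_all add: ac_simps)
  qed
  show "algebraic (x + y)"
    by (rule algebraic_if_stable_span[OF f one]) (simp add: xb yb distrib_right rat_space.span_add)
  show "algebraic (x * y)"
    by (rule algebraic_if_stable_span[OF f one])
       (simp add: mult.assoc rat_space_span_mult[OF xb] yb)
qed

lemma number_subfield_algebraic: "number_subfield {x. algebraic x}"
  by unfold_locales (auto simp: rat_imp_algebraic algebraic_add algebraic_mult)

lemma algebraic_poly:
  assumes "p \<in> polys_over k" "\<And>x. x \<in> k \<Longrightarrow> algebraic x" "algebraic y"
  shows "algebraic (poly p y)"
proof -
  interpret A: number_subfield "{x. algebraic x}" by (rule number_subfield_algebraic)
  show ?thesis using A.poly_closed[of p y] assms by (auto simp: polys_over_def)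
qed

lemma number_subfield_adjoin_poly:
  assumes "number_subfield k" "algebraic y"
  shows "number_subfield ((\<lambda>p. poly p y) ` polys_over k)"
  using assms number_subfield.algebraic_elems[OF assms(1)]
  by (intro number_subfield_polys_at algebraic_poly) auto

subsection \<open>Subfields in the sense of HOL-Algebra\<close>

lemma complex_field_sel [simp]:
  "carrier complex_field = UNIV" "x \<otimes>\<^bsub>complex_field\<^esub> y = x * y" "x \<oplus>\<^bsub>complex_field\<^esub> y = x + y"
  "\<one>\<^bsub>complex_field\<^esub> = 1" "\<zero>\<^bsub>complex_field\<^esub> = 0"
  by (simp_all add: ring_of_type_algebra_def)

lemma field_complex_field: "field complex_field"
  by (rule field_from_type_algebra)

interpretation complex_field: cring complex_field
  by (rule cring_from_type_algebra)

lemma complex_field_a_inv [simp]: "\<ominus>\<^bsub>complex_field\<^esub> x = - x"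
  using complex_field.minus_equality[of "-x" x] by simp

lemma complex_field_m_inv [simp]: "x \<noteq> 0 \<Longrightarrow> inv\<^bsub>complex_field\<^esub> x = inverse x"
  using complex_field.inv_unique'[of x "inverse x"] by simp

lemma subfield_complexD:
  assumes "subfield k complex_field"
  shows "\<rat> \<subseteq> k" "x \<in> k \<Longrightarrow> y \<in> k \<Longrightarrow> x + y \<in> k" "x \<in> k \<Longrightarrow> y \<in> k \<Longrightarrow> x * y \<in> k"
proof -
  note sr = subfieldE(1)[OF assms]
  have add: "x + y \<in> k" if "x \<in> k" "y \<in> k" for x y
    using subringE(7)[OF sr that] by simp
  have mult: "x * y \<in> k" if "x \<in> k" "y \<in> k" for x y
    using subringE(6)[OF sr that] by simp
  have min: "- x \<in> k" if "x \<in> k" for x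
    using subringE(5)[OF sr that] by simp
  have one: "1 \<in> k" "0 \<in> k" using subringE(2,3)[OF sr] by simp_all
  have nat: "of_nat n \<in> k" for n by (induction n) (use one add in auto)
  have int: "of_int n \<in> k" for n
  proof (cases n)
    case (nonneg m)
    then show ?thesis using nat[of m] by simp
  next
    case (neg m)
    then show ?thesis using min[OF nat[of "Suc m"]] by simp
  qed
  have inv: "inverse x \<in> k" if "x \<in> k" for x
    using complex_field.subfield_m_inv(1)[OF assms, of x] that by (cases "x = 0") auto
  show "\<rat> \<subseteq> k"
  proof
    fix q :: complex assume "q \<in> \<rat>"
    then obtain a b :: int where "q = of_int a / of_int b" by (elim Rats_cases') auto
    then show "q \<in> k" using mult[OF int[of a] inv[OF int[of b]]] by (simp add: divide_inverse)
  qed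
  show "x \<in> k \<Longrightarrow> y \<in> k \<Longrightarrow> x + y \<in> k" "x \<in> k \<Longrightarrow> y \<in> k \<Longrightarrow> x * y \<in> k"
    using add mult by auto
qed

lemma (in number_subfield) subfield_complex: "subfield k complex_field"
  by (rule field.subfieldI'[OF field_complex_field], rule complex_field.subringI)
     (auto intro: uminus_closed inverse_closed)

lemma subfield_imp_number_subfield:
  "subfield k complex_field \<Longrightarrow> (\<And>x. x \<in> k \<Longrightarrow> algebraic x) \<Longrightarrow> number_subfield k"
  by unfold_locales (use subfield_complexD in auto)

declare complex_field.Span.simps [simp del]

text \<open>The bridge from spans of lists over a subfield to spans of sets in a vector space, which
  lets degrees of fields be bounded with the dimension theory of \<open>rat_space\<close>.\<close>

lemma Span_eq_span: "complex_field.Span \<rat> Us = rat_space.span (set Us)"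
proof (induction Us)
  case Nil
  then show ?case by (simp add: complex_field.Span.simps)
next
  case (Cons u Us)
  have "complex_field.Span \<rat> (u # Us) = complex_field.line_extension \<rat> u (rat_space.span (set Us))"
    using Cons by (simp add: complex_field.Span.simps)
  also have "\<dots> = {x. \<exists>k\<in>\<rat>. \<exists>v\<in>rat_space.span (set Us). x = k * u + v}"
    unfolding set_eq_iff complex_field.line_extension_mem_iff by simp
  also have "\<dots> = rat_space.span (set (u # Us))"
  proof (intro Set.set_eqI iffI)
    fix x assume "x \<in> {x. \<exists>k\<in>\<rat>. \<exists>v\<in>rat_space.span (set Us). x = k * u + v}"
    then obtain q v where "x = of_rat q * u + v" "v \<in> rat_space.span (set Us)"
      by (auto elim!: Rats_cases)
    then show "x \<in> rat_space.span (set (u # Us))"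
      unfolding list.set rat_space.span_insert by (auto intro!: exI[of _ q])
  next
    fix x assume "x \<in> rat_space.span (set (u # Us))"
    then obtain q where "x - of_rat q * u \<in> rat_space.span (set Us)"
      unfolding list.set rat_space.span_insert by auto
    then show "x \<in> {x. \<exists>k\<in>\<rat>. \<exists>v\<in>rat_space.span (set Us). x = k * u + v}"
      by (intro CollectI bexI[of _ "of_rat q"] bexI[of _ "x - of_rat q * u"]) auto
  qed
  finally show ?case .
qed

lemma subfield_Rats: "subfield \<rat> complex_field"
  using number_subfield.subfield_complex[OF number_subfield_Rats] .

lemma independent_rat_space:
  "complex_field.independent \<rat> Us \<Longrightarrow> rat_space.independent (set Us) \<and> distinct Us"
proof (induction Us)
  case (Cons u Us)
  from Cons.prems have "u \<notin> complex_field.Span \<rat> Us" "complex_field.independent \<rat> Us"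
    by (auto elim: complex_field.independent.cases)
  then show ?case using Cons.IH rat_space.span_base[of u "set Us"]
    by (auto simp: Span_eq_span rat_space.independent_insert)
qed (auto simp: rat_space.independent_empty)

lemma finite_degree_span:
  assumes "finite_degree F"
  shows "\<exists>B. finite B \<and> card B \<le> field_degree F \<and> F = rat_space.span B"
proof -
  obtain n where n: "complex_field.dimension n \<rat> F"
    using assms complex_field.finite_dimensionE[OF subfield_Rats] by (auto simp: finite_degree_def)
  have d: "field_degree F = n"
    unfolding field_degree_def using complex_field.dimI[OF subfield_Rats n] by (simp add: over_def)
  obtain Vs where "length Vs = n" "complex_field.Span \<rat> Vs = F"
    using complex_field.exists_base[OF subfield_Rats n] by auto
  then show ?thesis using d by (intro exI[of _ "set Vs"]) (auto simp: Span_eq_span card_length)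
qed

lemma span_finite_degree:
  assumes "F = rat_space.span (set Us)"
  shows "finite_degree F" "field_degree F \<le> length Us"
proof -
  have F: "F = complex_field.Span \<rat> Us" using assms by (simp add: Span_eq_span)
  show "finite_degree F" unfolding F finite_degree_def
    using complex_field.Span_finite_dimension[OF subfield_Rats, of Us] by (simp add: over_def)
  obtain Vs where Vs: "complex_field.independent \<rat> Vs" "complex_field.Span \<rat> Vs = F"
    using complex_field.filter_base[OF subfield_Rats, of Us] F by auto
  have "complex_field.dimension (length Vs) \<rat> F"
    using complex_field.dimension_independent[OF Vs(1)] Vs(2) by simp
  then have "field_degree F = length Vs"
    unfolding field_degree_def using complex_field.dimI[OF subfield_Rats] by (simp add: over_def)
  also have "\<dots> = card (set Vs)"
    using independent_rat_space[OF Vs(1)] by (simp add: distinct_card)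
  also have "\<dots> \<le> card (set Us)"
    using rat_space.independent_span_bound[OF _ conjunct1[OF independent_rat_space[OF Vs(1)]], of "set Us"]
      rat_space.span_superset[of "set Vs"] Vs(2) F by (auto simp: Span_eq_span)
  also have "\<dots> \<le> length Us" by (rule card_length)
  finally show "field_degree F \<le> length Us" .
qed

lemma number_field_elem_poly:
  assumes "subfield F complex_field" "finite_degree F" "y \<in> F"
  shows "\<exists>p\<in>polys_over \<rat>. p \<noteq> 0 \<and> degree p \<le> field_degree F \<and> poly p y = 0"
proof -
  obtain B where B: "finite B" "card B \<le> field_degree F" "F = rat_space.span B"
    using finite_degree_span[OF assms(2)] by auto
  have "y ^ i \<in> F" for i
    by (induction i) (use subfield_complexD[OF assms(1)] assms(3) in auto)
  then obtain p where "p \<in> polys_over \<rat>" "p \<noteq> 0" "degree p \<le> card B" "poly p y = 0"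
    using rat_poly_of_powers[OF B(1), of y] B(3) by auto
  then show ?thesis using B(2) by (intro bexI[of _ p]) auto
qed

lemma number_field_number_subfield:
  assumes "number_field F"
  shows "number_subfield F"
proof (rule subfield_imp_number_subfield)
  show "subfield F complex_field" using assms by (simp add: number_field_def)
  fix x assume "x \<in> F"
  then obtain p where "p \<in> polys_over \<rat>" "p \<noteq> 0" "poly p x = 0"
    using assms number_field_elem_poly[of F x] by (auto simp: number_field_def)
  then show "algebraic x" by (auto simp: algebraic_altdef polys_over_def)
qed

section \<open>Fields generated by sets, and the degree of an element\<close>

lemma adjoin_subset:
  assumes "number_subfield k" "S \<subseteq> k"
  shows "adjoin S \<subseteq> k"
  unfolding adjoin_def
  by (rule field.generate_field_min_subfield1[OF field_complex_field])
     (use assms number_subfield.subfield_complex number_subfield.Rats_subset in auto)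

lemma subfield_adjoin: "subfield (adjoin S) complex_field"
  unfolding adjoin_def by (rule field.generate_field_is_subfield[OF field_complex_field]) auto

lemma subset_adjoin: "S \<subseteq> adjoin S"
  unfolding adjoin_def by (auto intro: generate_field.incl)

lemma number_subfield_adjoin:
  assumes "\<And>x. x \<in> S \<Longrightarrow> algebraic x"
  shows "number_subfield (adjoin S)"
  using adjoin_subset[OF number_subfield_algebraic, of S] assms
  by (intro subfield_imp_number_subfield subfield_adjoin) auto

lemma adjoin_single:
  assumes "algebraic y"
  shows "adjoin {y} = (\<lambda>p. poly p y) ` polys_over \<rat>"
proof
  interpret A: number_subfield "adjoin {y}" by (rule number_subfield_adjoin) (use assms in auto)
  have n: "number_subfield ((\<lambda>p. poly p y) ` polys_over \<rat>)"
    by (rule number_subfield_adjoin_poly[OF number_subfield_Rats assms])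
  have "[:0, 1:] \<in> polys_over \<rat>" by (auto simp: polys_over_def coeff_pCons split: nat.splits)
  then have "y \<in> (\<lambda>p. poly p y) ` polys_over \<rat>" by (intro image_eqI[of _ _ "[:0,1:]"]) auto
  then show "adjoin {y} \<subseteq> (\<lambda>p. poly p y) ` polys_over \<rat>" by (intro adjoin_subset[OF n]) auto
  show "(\<lambda>p. poly p y) ` polys_over \<rat> \<subseteq> adjoin {y}"
    using subset_adjoin[of "{y}"] by (auto intro!: A.poly_closed A.Rats_polys_over)
qed

text \<open>Any nonzero rational polynomial of degree at most d with root y certifies the degree:
  the powers of y below its degree span the field. Irreducibility never enters.\<close>

lemma element_degree_le_iff:
  "element_degree_le d y \<longleftrightarrow> (\<exists>p\<in>polys_over \<rat>. p \<noteq> 0 \<and> degree p \<le> d \<and> poly p y = 0)"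
proof
  assume "element_degree_le d y"
  then obtain p where "p \<in> polys_over \<rat>" "p \<noteq> 0" "degree p \<le> field_degree (adjoin {y})"
      "poly p y = 0" "field_degree (adjoin {y}) \<le> d"
    using number_field_elem_poly[OF subfield_adjoin, of "{y}" y] subset_adjoin[of "{y}"]
    unfolding element_degree_le_def by auto
  then show "\<exists>p\<in>polys_over \<rat>. p \<noteq> 0 \<and> degree p \<le> d \<and> poly p y = 0"
    by (intro bexI[of _ p]) auto
next
  assume "\<exists>p\<in>polys_over \<rat>. p \<noteq> 0 \<and> degree p \<le> d \<and> poly p y = 0"
  then obtain p where p: "p \<in> polys_over \<rat>" "p \<noteq> 0" "degree p \<le> d" "poly p y = 0" by auto
  then have alg: "algebraic y" unfolding algebraic_altdef polys_over_def by auto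
  define Us where "Us = map (\<lambda>i. y ^ i) [0..<degree p]"
  have s: "set Us = (\<lambda>i. y ^ i) ` {..<degree p}" by (auto simp: Us_def)
  have "adjoin {y} = rat_space.span (set Us)"
  proof
    show "adjoin {y} \<subseteq> rat_space.span (set Us)"
      unfolding adjoin_single[OF alg] s using poly_at_in_span[OF p(1,2,4)] by auto
    interpret A: number_subfield "adjoin {y}" by (rule number_subfield_adjoin) (use alg in auto)
    show "rat_space.span (set Us) \<subseteq> adjoin {y}"
    proof (rule rat_space.span_minimal)
      show "set Us \<subseteq> adjoin {y}" unfolding s using subset_adjoin[of "{y}"] by auto
      show "rat_space.subspace (adjoin {y})"
        by (rule rat_space.subspaceI) (auto intro!: A.mult_closed)
    qed
  qed
  from span_finite_degree[OF this] p(3) show "element_degree_le d y"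
    unfolding element_degree_le_def by (auto simp: Us_def)
qed

subsection \<open>Extension of homomorphisms\<close>

lemma (in number_field_hom) map_hom_diff:
  "p \<in> polys_over k \<Longrightarrow> q \<in> polys_over k \<Longrightarrow> map_poly f (p - q) = map_poly f p - map_poly f q"
  by (auto simp: poly_eq_iff hom_diff coeff_polys_over)

text \<open>Let g be a polynomial of least degree over k with root y, and y' a root of its image
  under f. Sending p(y) to the value at y' of the image of p is the extension.\<close>

lemma (in number_field_hom) extend_hom:
  assumes "algebraic y"
  shows "\<exists>k' f'. number_field_hom k' f' \<and> k \<subseteq> k' \<and> y \<in> k' \<and> (\<forall>x\<in>k. f' x = f x)"
proof -
  define P where "P = (\<lambda>p. p \<in> polys_over k \<and> p \<noteq> 0 \<and> poly p y = 0)"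
  have "\<exists>p. P p"
    using assms Rats_polys_over unfolding P_def algebraic_altdef polys_over_def by auto
  then obtain g where g: "P g" and min: "\<And>q. P q \<Longrightarrow> degree g \<le> degree q"
    using ex_has_least_nat[of P _ degree] by auto
  have g': "g \<in> polys_over k" "g \<noteq> 0" "poly g y = 0" using g by (auto simp: P_def)
  have "degree g \<noteq> 0"
  proof
    assume "degree g = 0"
    then obtain a where "g = [:a:]" by (metis degree_eq_zeroE)
    with g' show False by auto
  qed
  moreover have "degree g \<le> degree (map_poly f g)"
    by (rule le_degree) (use g' hom_nonzero[OF coeff_polys_over[OF g'(1)]] in auto)
  ultimately have "degree (map_poly f g) \<noteq> 0" by linarith
  then obtain y' where y': "poly (map_poly f g) y' = 0"
    using fundamental_theorem_of_algebra[of "map_poly f g"] by (auto simp: constant_degree)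
  \<comment> \<open>Well-definedness: the remainder of p modulo g vanishes at y and has smaller
    degree than g, so it is 0.\<close>
  have wd0: "poly (map_poly f p) y' = 0" if p: "p \<in> polys_over k" "poly p y = 0" for p
  proof -
    obtain q r where qr: "q \<in> polys_over k" "r \<in> polys_over k" "p = q * g + r"
      "r = 0 \<or> degree r < degree g"
      using polys_over_division[OF g'(1,2) p(1)] by auto
    have "poly r y = 0" using qr(3) p(2) g'(3) by simp
    then have "r = 0" using qr(2,4) min[of r] unfolding P_def by linarith
    then show ?thesis using qr g' y' by (simp add: map_hom_mult)
  qed
  have wd: "poly (map_poly f p) y' = poly (map_poly f q) y'"
    if "p \<in> polys_over k" "q \<in> polys_over k" "poly p y = poly q y" for p q
    using wd0[of "p - q"] that by (auto simp: map_hom_diff)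
  define k' where "k' = (\<lambda>p. poly p y) ` polys_over k"
  define f' where "f' = (\<lambda>z. poly (map_poly f (SOME p. p \<in> polys_over k \<and> poly p y = z)) y')"
  have f': "f' (poly p y) = poly (map_poly f p) y'" if "p \<in> polys_over k" for p
    unfolding f'_def by (rule wd) (use that someI[of "\<lambda>q. q \<in> polys_over k \<and> poly q y = poly p y" p] in auto)
  have n: "number_subfield k'" unfolding k'_def
    by (rule number_subfield_adjoin_poly[OF _ assms]) unfold_locales
  have c: "f' x = f x" if "x \<in> k" for x
    using f'[of "[:x:]"] that by (simp add: map_poly_pCons polys_over_const)
  have "number_field_hom k' f'"
  proof (intro number_field_hom.intro n number_field_hom_axioms.intro)
    show "f' 1 = 1" using c[of 1] by (simp add: hom_one)
    fix u v assume "u \<in> k'" "v \<in> k'"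
    then obtain p q where "p \<in> polys_over k" "q \<in> polys_over k" "u = poly p y" "v = poly q y"
      by (auto simp: k'_def)
    then show "f' (u + v) = f' u + f' v" "f' (u * v) = f' u * f' v"
      using f'[of p] f'[of q] f'[of "p + q"] f'[of "p * q"]
      by (simp_all add: map_hom_add map_hom_mult polys_over_add polys_over_mult)
  qed
  moreover have "k \<subseteq> k'"
  proof
    fix x assume "x \<in> k"
    then show "x \<in> k'" unfolding k'_def by (intro image_eqI[of _ _ "[:x:]"]) auto
  qed
  moreover have "y \<in> k'" unfolding k'_def by (intro image_eqI[of _ _ "[:0,1:]"]) auto
  ultimately show ?thesis using c by blast
qed

lemma extend_hom_finite:
  assumes "number_field_hom k f" "finite Y" "\<And>y. y \<in> Y \<Longrightarrow> algebraic y"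
  shows "\<exists>k' f'. number_field_hom k' f' \<and> k \<subseteq> k' \<and> Y \<subseteq> k' \<and> (\<forall>x\<in>k. f' x = f x)"
  using assms(2,3)
proof (induction Y)
  case empty
  then show ?case using assms(1) by auto
next
  case (insert y Y)
  then obtain k1 f1 where 1: "number_field_hom k1 f1" "k \<subseteq> k1" "Y \<subseteq> k1" "\<forall>x\<in>k. f1 x = f x"
    by auto
  obtain k2 f2 where 2: "number_field_hom k2 f2" "k1 \<subseteq> k2" "y \<in> k2" "\<forall>x\<in>k1. f2 x = f1 x"
    using number_field_hom.extend_hom[OF 1(1), of y] insert.prems by auto
  show ?case using 1 2 by (intro exI[of _ k2] exI[of _ f2]) auto
qed

text \<open>The cycle of y under the injection f of Y into itself has length at most d, and every
  such length divides d!.\<close>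

lemma funpow_fact_fixed:
  assumes "finite Y" "f ` Y \<subseteq> Y" "inj_on f Y" "card Y \<le> d" "y \<in> Y"
  shows "(f ^^ fact d) y = y"
proof -
  have mem: "(f ^^ i) y \<in> Y" for i by (induction i) (use assms in auto)
  have "\<not> inj_on (\<lambda>i. (f ^^ i) y) {..d}"
  proof
    assume "inj_on (\<lambda>i. (f ^^ i) y) {..d}"
    then have "card {..d} \<le> card Y"
      by (rule card_inj_on_le) (use mem assms(1) in auto)
    then show False using assms(4) by simp
  qed
  then obtain i j where ij: "i < j" "j \<le> d" "(f ^^ i) y = (f ^^ j) y"
    by (auto simp: inj_on_def) (metis linorder_neqE_nat)
  have canc: "(f ^^ i) a = (f ^^ i) b \<Longrightarrow> a = b" if "a \<in> Y" "b \<in> Y" for a b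
    using that
  proof (induction i arbitrary: a b)
    case (Suc i)
    have "(f ^^ i) (f a) = (f ^^ i) (f b)" using Suc.prems(1) by (simp add: funpow_swap1)
    then have "f a = f b" using Suc.IH[of "f a" "f b"] Suc.prems assms(2) by auto
    then show ?case using Suc.prems assms(3) by (auto simp: inj_on_def)
  qed auto
  have "(f ^^ i) ((f ^^ (j - i)) y) = (f ^^ i) y"
    using ij funpow_add[of i "j - i" f] by simp
  then have e: "(f ^^ (j - i)) y = y" using canc[OF mem assms(5)] by blast
  have "(j - i) dvd fact d" by (rule dvd_fact) (use ij in auto)
  then obtain m where m: "fact d = (j - i) * m" by auto
  have "((f ^^ (j - i)) ^^ m) y = y" by (induction m) (use e in auto)
  then show ?thesis unfolding m by (simp add: funpow_mult mult.commute)
qed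

text \<open>As f may leave k, its iterates are homomorphisms only on elements whose whole forward
  orbit stays in k; this condition is made part of the field.\<close>

lemma number_subfield_funpow_fixed:
  assumes "number_field_hom k f"
  shows "number_subfield {z \<in> k. (\<forall>i. (f ^^ i) z \<in> k) \<and> (f ^^ n) z = z}"
proof -
  interpret number_field_hom k f by fact
  have add: "(f ^^ i) (z + w) = (f ^^ i) z + (f ^^ i) w"
    and mult: "(f ^^ i) (z * w) = (f ^^ i) z * (f ^^ i) w"
    if "\<forall>i. (f ^^ i) z \<in> k" "\<forall>i. (f ^^ i) w \<in> k" for z w i
    by (induction i) (use that in \<open>auto simp: hom_add hom_mult\<close>)
  have rat: "(f ^^ i) q = q" if "q \<in> \<rat>" for q i
    by (induction i) (use that hom_Rats in auto)
  show ?thesis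
    by unfold_locales (auto simp: rat add mult algebraic_elems)
qed

subsection \<open>Automorphisms of a field and their orbits\<close>

text \<open>Only the values on \<open>K\<close> are constrained, unlike for the extensional elements
  of \<open>gal_group\<close>. Composition and iteration are then those of plain functions.\<close>

definition auts :: "complex set \<Rightarrow> (complex \<Rightarrow> complex) set" where
  "auts K = {s. number_field_hom K s \<and> s ` K = K}"

text \<open>Each element of a generated field involves finitely many generators, and an element of a
  field of degree at most d is itself a root of a rational polynomial of degree at most d.\<close>

lemma compositum_elem_finite:
  assumes "x \<in> compositum_degree_le d"
  shows "\<exists>Y. finite Y \<and> (\<forall>y\<in>Y. \<exists>p\<in>polys_over \<rat>. p \<noteq> 0 \<and> degree p \<le> d \<and> poly p y = 0) \<and>
    (\<forall>k. number_subfield k \<longrightarrow> Y \<subseteq> k \<longrightarrow> x \<in> k)"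
proof -
  define A where "A = {y. \<exists>p\<in>polys_over \<rat>. p \<noteq> 0 \<and> degree p \<le> d \<and> poly p y = (0::complex)}"
  define B where "B = (\<lambda>Y x. \<forall>k. number_subfield k \<longrightarrow> Y \<subseteq> k \<longrightarrow> (x::complex) \<in> k)"
  have "\<exists>Y. finite Y \<and> Y \<subseteq> A \<and> B Y x"
    using assms unfolding compositum_degree_le_def
  proof (induction rule: generate_field.induct)
    case one
    have "B {} 1" by (auto simp: B_def number_subfield.one_closed)
    then show ?case by (intro exI[of _ "{}"]) simp
  next
    case (incl h)
    then obtain F where F: "number_field F" "field_degree F \<le> d" "h \<in> F" by auto
    then obtain p where "p\<in>polys_over \<rat>" "p \<noteq> 0" "degree p \<le> field_degree F" "poly p h = 0"
      using number_field_elem_poly[of F h] by (auto simp: number_field_def)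
    then have "h \<in> A" using F(2) unfolding A_def by (intro CollectI bexI[of _ p]) auto
    then show ?case by (intro exI[of _ "{h}"]) (auto simp: B_def)
  next
    case (a_inv h)
    then obtain Y where "finite Y" "Y \<subseteq> A" "B Y h" by blast
    then show ?case by (intro exI[of _ Y]) (simp add: B_def number_subfield.uminus_closed)
  next
    case (m_inv h)
    then obtain Y where "finite Y" "Y \<subseteq> A" "B Y h" by blast
    then show ?case using m_inv(2) by (intro exI[of _ Y]) (simp add: B_def number_subfield.inverse_closed)
  next
    case (eng_add a b)
    then obtain Y Z where "finite Y" "Y \<subseteq> A" "B Y a" "finite Z" "Z \<subseteq> A" "B Z b" by blast
    then show ?case
      by (intro exI[of _ "Y \<union> Z"]) (simp add: B_def number_subfield.add_closed)
  next
    case (eng_mult a b)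
    then obtain Y Z where "finite Y" "Y \<subseteq> A" "B Y a" "finite Z" "Z \<subseteq> A" "B Z b" by blast
    then show ?case
      by (intro exI[of _ "Y \<union> Z"]) (simp add: B_def number_subfield.mult_closed)
  qed
  then obtain Y where "finite Y" "Y \<subseteq> A" "B Y x" by blast
  then show ?thesis by (intro exI[of _ Y]) (auto simp: A_def B_def)
qed

text \<open>The elements of degree at most d from which x is built need not lie in \<open>K\<close>.
  So s is first extended to an embedding f of a field that contains all roots of their polynomials;
  f permutes the roots of each polynomial.\<close>

lemma auts_exponent_of_compositum:
  assumes "s \<in> auts K" "x \<in> K" "K \<subseteq> compositum_degree_le d"
  shows "(s ^^ fact d) x = x"
proof -
  interpret S: number_field_hom K s using assms(1) by (simp add: auts_def)
  obtain Y where Y: "finite Y" "\<forall>y\<in>Y. \<exists>p\<in>polys_over \<rat>. p \<noteq> 0 \<and> degree p \<le> d \<and> poly p y = 0"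
    "\<And>k. number_subfield k \<Longrightarrow> Y \<subseteq> k \<Longrightarrow> x \<in> k"
    using compositum_elem_finite[of x d] assms(2,3) by auto
  from bchoice[OF Y(2)[unfolded Bex_def]] obtain P where
    P: "\<And>y. y \<in> Y \<Longrightarrow> P y \<in> polys_over \<rat> \<and> P y \<noteq> 0 \<and> degree (P y) \<le> d \<and> poly (P y) y = 0"
    by auto
  define Y' where "Y' = (\<Union>y\<in>Y. {z. poly (P y) z = 0})"
  have "finite Y'" using P Y(1) by (auto simp: Y'_def poly_roots_finite)
  moreover have "algebraic z" if "z \<in> Y'" for z
    using that P unfolding Y'_def algebraic_altdef polys_over_def by auto
  ultimately obtain k f where kf: "number_field_hom k f" "K \<subseteq> k" "Y' \<subseteq> k" "\<forall>x\<in>K. f x = s x"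
    using extend_hom_finite[OF S.number_field_hom_axioms, of Y'] by auto
  interpret F: number_field_hom k f by fact
  have "x \<in> {z \<in> k. (\<forall>i. (f ^^ i) z \<in> k) \<and> (f ^^ fact d) z = z}"
  proof (rule Y(3)[OF number_subfield_funpow_fixed[OF kf(1)]], rule subsetI)
    fix y assume y: "y \<in> Y"
    define R where "R = {z. poly (P y) z = 0}"
    have R: "R \<subseteq> k" "y \<in> R" using y P kf(3) by (auto simp: R_def Y'_def)
    have fR: "f ` R \<subseteq> R"
    proof
      fix w assume "w \<in> f ` R"
      then obtain z where z: "z \<in> R" "w = f z" by auto
      have "poly (P y) (f z) = f (poly (P y) z)"
        using F.hom_poly_Rats[of "P y" z] P[OF y] R(1) z(1) by auto
      then show "w \<in> R" using z by (simp add: R_def)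
    qed
    have mem: "(f ^^ i) y \<in> R" for i by (induction i) (use R fR in auto)
    have "(f ^^ fact d) y = y"
    proof (rule funpow_fact_fixed[of R])
      show "finite R" using P[OF y] by (auto simp: R_def poly_roots_finite)
      show "inj_on f R" using F.hom_inj R(1) by (rule inj_on_subset)
      show "card R \<le> d" using P[OF y] card_poly_roots_bound[of "P y"] by (auto simp: R_def)
    qed (use fR R in auto)
    then show "y \<in> {z \<in> k. (\<forall>i. (f ^^ i) z \<in> k) \<and> (f ^^ fact d) z = z}"
      using mem R by auto
  qed
  then have "(f ^^ fact d) x = x" by simp
  \<comment> \<open>The iterates of s at x never leave \<open>K\<close>, where f and s
    agree.\<close>
  moreover have "(f ^^ i) x = (s ^^ i) x \<and> (s ^^ i) x \<in> K" for i
    by (induction i) (use assms(1,2) kf(4) in \<open>auto simp: auts_def\<close>)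
  ultimately show ?thesis by simp
qed

section \<open>Conjugates, traces and simple subfields of an abelian field\<close>

locale abelian_number_field = number_subfield K for K +
  assumes auts_commute: "s \<in> auts K \<Longrightarrow> t \<in> auts K \<Longrightarrow> x \<in> K \<Longrightarrow> s (t x) = t (s x)"
    and fixed_Rats: "x \<in> K \<Longrightarrow> (\<And>s. s \<in> auts K \<Longrightarrow> s x = x) \<Longrightarrow> x \<in> \<rat>"
begin

lemma aut_hom: "s \<in> auts K \<Longrightarrow> number_field_hom K s"
  by (simp add: auts_def)

lemma aut_closed [intro]: "s \<in> auts K \<Longrightarrow> x \<in> K \<Longrightarrow> s x \<in> K"
  by (auto simp: auts_def)

lemmas aut_add = number_field_hom.hom_add[OF aut_hom]
  and aut_mult = number_field_hom.hom_mult[OF aut_hom]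
  and aut_Rats = number_field_hom.hom_Rats[OF aut_hom]
  and aut_sum = number_field_hom.hom_sum[OF aut_hom]
  and aut_prod = number_field_hom.hom_prod[OF aut_hom]
  and aut_inj = number_field_hom.hom_inj[OF aut_hom]

lemma aut_zero [simp]: "s \<in> auts K \<Longrightarrow> s 0 = 0"
  by (simp add: aut_Rats)

lemma id_aut [intro, simp]: "(\<lambda>x. x) \<in> auts K"
  by (auto simp: auts_def number_field_hom_def number_field_hom_axioms_def number_subfield_axioms)

lemma aut_comp [intro]:
  assumes "s \<in> auts K" "t \<in> auts K"
  shows "(\<lambda>x. s (t x)) \<in> auts K"
proof -
  have "number_field_hom K (\<lambda>x. s (t x))"
    using assms by (intro number_field_hom.intro number_field_hom_axioms.intro number_subfield_axioms)
      (auto simp: aut_add aut_mult aut_Rats aut_closed)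
  moreover have "(\<lambda>x. s (t x)) ` K = K"
    using assms unfolding auts_def by (simp add: image_image[symmetric])
  ultimately show ?thesis by (simp add: auts_def)
qed

lemma aut_funpow [intro]: "s \<in> auts K \<Longrightarrow> (s ^^ n) \<in> auts K"
  by (induction n) (use aut_comp in \<open>auto simp: comp_def id_def\<close>)

lemma aut_inverse:
  assumes "s \<in> auts K"
  shows "\<exists>t\<in>auts K. \<forall>x\<in>K. t (s x) = x \<and> s (t x) = x"
proof -
  define t where "t = inv_into K s"
  have sK: "s ` K = K" using assms by (simp add: auts_def)
  have ts: "t (s x) = x" if "x \<in> K" for x using that aut_inj[OF assms] by (simp add: t_def)
  have st: "s (t x) = x" "t x \<in> K" if "x \<in> K" for x
    using that sK by (auto simp: t_def f_inv_into_f inv_into_into)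
  have "number_field_hom K t"
  proof (intro number_field_hom.intro number_field_hom_axioms.intro number_subfield_axioms)
    show "t 1 = 1" using ts[of 1] assms by (simp add: aut_Rats)
    fix x y assume "x \<in> K" "y \<in> K"
    then have xy: "t x \<in> K" "t y \<in> K" "s (t x) = x" "s (t y) = y" using st by auto
    then show "t (x + y) = t x + t y" "t (x * y) = t x * t y"
      using ts[of "t x + t y"] ts[of "t x * t y"] assms by (auto simp: aut_add aut_mult)
  qed
  moreover have "t ` K = K"
  proof
    show "t ` K \<subseteq> K" using st by auto
    show "K \<subseteq> t ` K"
    proof
      fix x assume "x \<in> K"
      then show "x \<in> t ` K" using ts[of x] aut_closed[OF assms] by (intro image_eqI[of _ _ "s x"]) auto
    qed
  qed
  ultimately show ?thesis using ts st by (intro bexI[of _ t]) (auto simp: auts_def)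
qed

definition orb :: "complex \<Rightarrow> complex set" where
  "orb x = (\<lambda>s. s x) ` auts K"

lemma orb_self [simp, intro]: "x \<in> orb x"
  unfolding orb_def by (rule image_eqI[of _ _ "\<lambda>x. x"]) auto

lemma orb_subset: "x \<in> K \<Longrightarrow> orb x \<subseteq> K"
  by (auto simp: orb_def)

lemma finite_orb:
  assumes "x \<in> K"
  shows "finite (orb x)"
proof -
  obtain p where p: "p \<in> polys_over \<rat>" "p \<noteq> 0" "poly p x = 0"
    using algebraic_elems[OF assms] unfolding algebraic_altdef polys_over_def by auto
  have "orb x \<subseteq> {z. poly p z = 0}"
    using number_field_hom.hom_poly_Rats[OF aut_hom p(1) assms] p(3) aut_Rats
    by (auto simp: orb_def)
  then show ?thesis using p(2) poly_roots_finite finite_subset by blast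
qed

lemma aut_image_orb:
  assumes "s \<in> auts K" "x \<in> K"
  shows "s ` orb x = orb x"
proof (rule endo_inj_surj)
  show "finite (orb x)" by (rule finite_orb) fact
  show "s ` orb x \<subseteq> orb x" using assms by (auto simp: orb_def)
  show "inj_on s (orb x)" using aut_inj[OF assms(1)] orb_subset[OF assms(2)] by (rule inj_on_subset)
qed

lemma aut_inj_orb: "s \<in> auts K \<Longrightarrow> x \<in> K \<Longrightarrow> inj_on s (orb x)"
  by (rule inj_on_subset[OF aut_inj orb_subset])

lemma polys_over_Rats_if_fixed:
  assumes "p \<in> polys_over K" "\<And>s. s \<in> auts K \<Longrightarrow> map_poly s p = p"
  shows "p \<in> polys_over \<rat>"
proof -
  have "coeff p i \<in> \<rat>" for i
  proof (rule fixed_Rats)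
    show "coeff p i \<in> K" using assms(1) by (rule coeff_polys_over)
    fix s assume "s \<in> auts K"
    then show "s (coeff p i) = coeff p i"
      using arg_cong[OF assms(2), of s "\<lambda>p. coeff p i"] by (simp add: coeff_map_poly)
  qed
  then show ?thesis by (simp add: polys_over_def)
qed

lemma linear_factor_over: "y \<in> K \<Longrightarrow> [:- y, 1:] \<in> polys_over K"
  by (intro polys_over_pCons) (auto intro: uminus_closed)

lemma map_linear_factors:
  assumes "s \<in> auts K" "Y \<subseteq> K"
  shows "map_poly s (\<Prod>y\<in>Y. [:- y, 1:]) = (\<Prod>y\<in>s ` Y. [:- y, 1:])"
proof -
  interpret S: number_field_hom K s by (rule aut_hom) fact
  have "map_poly s (\<Prod>y\<in>Y. [:- y, 1:]) = (\<Prod>y\<in>Y. map_poly s [:- y, 1:])"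
    using assms(2) linear_factor_over by (intro S.map_hom_prod) auto
  also have "\<dots> = (\<Prod>y\<in>Y. [:- s y, 1:])"
    using assms(2) by (intro prod.cong) (auto simp: map_poly_pCons S.hom_uminus S.hom_one)
  also have "\<dots> = (\<Prod>y\<in>s ` Y. [:- y, 1:])"
    using inj_on_subset[OF S.hom_inj assms(2)] by (simp add: prod.reindex)
  finally show ?thesis .
qed

lemma orb_poly_Rats: "x \<in> K \<Longrightarrow> (\<Prod>y\<in>orb x. [:- y, 1:]) \<in> polys_over \<rat>"
  using orb_subset[of x] linear_factor_over
  by (intro polys_over_Rats_if_fixed) (auto simp: map_linear_factors aut_image_orb intro!: polys_over_prod)

lemma element_degree_le_orb:
  assumes "x \<in> K" "card (orb x) \<le> d"
  shows "element_degree_le d x"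
  unfolding element_degree_le_iff
proof (intro bexI conjI)
  show "(\<Prod>y\<in>orb x. [:- y, 1:]) \<noteq> 0" using finite_orb[OF assms(1)] by simp
  show "degree (\<Prod>y\<in>orb x. [:- y, 1:]) \<le> d"
    using degree_prod_eq_sum_degree[of "orb x" "\<lambda>y. [:- y, 1:]"] assms(2) by simp
  show "poly (\<Prod>y\<in>orb x. [:- y, 1:]) x = 0"
    using finite_orb[OF assms(1)] by (auto simp: poly_prod intro!: prod_zero bexI[of _ x])
qed (rule orb_poly_Rats[OF assms(1)])

text \<open>For x in \<open>K\<close> this is \<rat>(x), the Galois correspondence being proved in
  \<open>fixfield_minimal\<close>. Described through the stabiliser of x, it is visibly preserved by
  all automorphisms when these commute.\<close>

definition fixfield :: "complex \<Rightarrow> complex set" where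
  "fixfield x = {z \<in> K. \<forall>s\<in>auts K. s x = x \<longrightarrow> s z = z}"

lemma fixfieldD: "z \<in> fixfield x \<Longrightarrow> z \<in> K"
  by (simp add: fixfield_def)

lemma fixfield_self: "x \<in> K \<Longrightarrow> x \<in> fixfield x"
  by (simp add: fixfield_def)

lemma number_subfield_fixfield: "number_subfield (fixfield x)"
  by unfold_locales (auto simp: fixfield_def aut_Rats aut_add aut_mult algebraic_elems)

lemma aut_fixfield: "s \<in> auts K \<Longrightarrow> z \<in> fixfield x \<Longrightarrow> s z \<in> fixfield x"
  unfolding fixfield_def by (auto simp: auts_commute[of _ s z])

text \<open>The inverse of t composed with s fixes x, hence fixes \<rat>(x) pointwise.\<close>

lemma aut_eq_fixfield:
  assumes "x \<in> K" "z \<in> fixfield x" "s \<in> auts K" "t \<in> auts K" "s x = t x"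
  shows "s z = t z"
proof -
  obtain r where r: "r \<in> auts K" "\<And>x. x \<in> K \<Longrightarrow> r (t x) = x \<and> t (r x) = x"
    using aut_inverse[OF assms(4)] by auto
  have "r (s x) = x" using assms(1,5) r(2)[of x] by simp
  moreover have "(\<lambda>x. r (s x)) \<in> auts K" using r(1) assms(3) by (rule aut_comp)
  ultimately have "r (s z) = z" using assms(2) by (auto simp: fixfield_def)
  moreover have "t (r (s z)) = s z" using r(2)[of "s z"] assms(2,3) by (auto simp: fixfield_def)
  ultimately show ?thesis by simp
qed

text \<open>The conjugate of z that belongs to the conjugate y of x. By
  \<open>aut_eq_fixfield\<close> the choice of s does not matter for z in \<rat>(x).\<close>

definition conj_at :: "complex \<Rightarrow> complex \<Rightarrow> complex \<Rightarrow> complex" where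
  "conj_at x z y = (SOME s. s \<in> auts K \<and> s x = y) z"

lemma conj_at_eq:
  assumes "x \<in> K" "z \<in> fixfield x" "s \<in> auts K"
  shows "conj_at x z (s x) = s z"
  unfolding conj_at_def
  by (rule aut_eq_fixfield[OF assms(1,2)])
     (use assms(3) someI[of "\<lambda>t. t \<in> auts K \<and> t x = s x" s] in auto)

text \<open>The sum is the trace of z from \<rat>(x) to \<rat>; an automorphism permutes its
  terms.\<close>

lemma sum_conj_Rats:
  assumes "x \<in> K" "z \<in> fixfield x"
  shows "(\<Sum>y\<in>orb x. conj_at x z y) \<in> \<rat>"
proof (rule fixed_Rats)
  have mem: "conj_at x z y \<in> K" if "y \<in> orb x" for y
    using that assms fixfieldD[OF assms(2)] by (auto simp: orb_def conj_at_eq)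
  show "(\<Sum>y\<in>orb x. conj_at x z y) \<in> K" using mem by auto
  fix s assume s: "s \<in> auts K"
  have "s (\<Sum>y\<in>orb x. conj_at x z y) = (\<Sum>y\<in>orb x. s (conj_at x z y))"
    using mem by (intro aut_sum[OF s]) auto
  also have "\<dots> = (\<Sum>y\<in>orb x. conj_at x z (s y))"
  proof (rule sum.cong[OF refl])
    fix y assume "y \<in> orb x"
    then obtain t where t: "t \<in> auts K" "y = t x" by (auto simp: orb_def)
    show "s (conj_at x z y) = conj_at x z (s y)"
      using conj_at_eq[OF assms t(1)] conj_at_eq[OF assms aut_comp[OF s t(1)]] t(2) by simp
  qed
  also have "\<dots> = (\<Sum>y\<in>s ` orb x. conj_at x z y)"
    using aut_inj_orb[OF s assms(1)] by (simp add: sum.reindex)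
  finally show "s (\<Sum>y\<in>orb x. conj_at x z y) = (\<Sum>y\<in>orb x. conj_at x z y)"
    using aut_image_orb[OF s assms(1)] by simp
qed

text \<open>
  Lagrange interpolation of the conjugates of \<open>z\<close> at the conjugates of \<open>x\<close>, without denominators.
\<close>

lemma fixfield_interpolation:
  assumes "x \<in> K" "z \<in> fixfield x"
  shows "\<exists>p\<in>polys_over \<rat>. poly p x = z * (\<Prod>y\<in>orb x - {x}. x - y)"
proof -
  define L where "L = (\<lambda>y. \<Prod>y'\<in>orb x - {y}. [:- y', 1:])"
  define p where "p = (\<Sum>y\<in>orb x. smult (conj_at x z y) (L y))"
  have mem: "conj_at x z y \<in> K" if "y \<in> orb x" for y
    using that assms fixfieldD[OF assms(2)] by (auto simp: orb_def conj_at_eq)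
  have L: "L y \<in> polys_over K" for y
    unfolding L_def using orb_subset[OF assms(1)] linear_factor_over by auto
  have "p \<in> polys_over \<rat>"
  proof (rule polys_over_Rats_if_fixed)
    show "p \<in> polys_over K" unfolding p_def using mem L by auto
    fix s assume s: "s \<in> auts K"
    interpret S: number_field_hom K s by (rule aut_hom) fact
    have "map_poly s p = (\<Sum>y\<in>orb x. map_poly s (smult (conj_at x z y) (L y)))"
      unfolding p_def using mem L by (intro S.map_hom_sum) auto
    also have "\<dots> = (\<Sum>y\<in>orb x. smult (conj_at x z (s y)) (L (s y)))"
    proof (rule sum.cong[OF refl])
      fix y assume y: "y \<in> orb x"
      then obtain t where t: "t \<in> auts K" "y = t x" by (auto simp: orb_def)
      have 1: "s (conj_at x z y) = conj_at x z (s y)"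
        using conj_at_eq[OF assms t(1)] conj_at_eq[OF assms aut_comp[OF s t(1)]] t(2) by simp
      have "map_poly s (L y) = (\<Prod>y\<in>s ` (orb x - {y}). [:- y, 1:])"
        unfolding L_def using orb_subset[OF assms(1)] by (intro map_linear_factors s) auto
      also have "s ` (orb x - {y}) = orb x - {s y}"
        using y aut_image_orb[OF s assms(1)] inj_on_image_set_diff[OF aut_inj_orb[OF s assms(1)], of "orb x" "{y}"]
        by auto
      finally have 2: "map_poly s (L y) = L (s y)" by (simp add: L_def)
      have "map_poly s (smult (conj_at x z y) (L y)) = smult (s (conj_at x z y)) (map_poly s (L y))"
        using L[of y] mem[OF y] by (auto simp: poly_eq_iff S.hom_mult coeff_polys_over)
      then show "map_poly s (smult (conj_at x z y) (L y)) = smult (conj_at x z (s y)) (L (s y))"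
        by (simp add: 1 2)
    qed
    also have "\<dots> = (\<Sum>y\<in>s ` orb x. smult (conj_at x z y) (L y))"
      using aut_inj_orb[OF s assms(1)] by (simp add: sum.reindex)
    also have "\<dots> = p" by (simp add: p_def aut_image_orb[OF s assms(1)])
    finally show "map_poly s p = p" .
  qed
  moreover have "poly p x = (\<Sum>y\<in>{x}. poly (smult (conj_at x z y) (L y)) x)"
    unfolding p_def poly_sum
  proof (rule sum.mono_neutral_right)
    show "\<forall>y\<in>orb x - {x}. poly (smult (conj_at x z y) (L y)) x = 0"
      using finite_orb[OF assms(1)] by (auto simp: L_def poly_prod)
  qed (use finite_orb[OF assms(1)] in auto)
  moreover have "conj_at x z x = z" using conj_at_eq[OF assms id_aut] by simp
  ultimately show ?thesis by (intro bexI[of _ p]) (auto simp: L_def poly_prod)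
qed

text \<open>Interpolation puts z * D into k, where D is the product of the differences of x from its
  other conjugates. Interpolating the element 1 puts D itself into k.\<close>

lemma fixfield_minimal:
  assumes "x \<in> K" "z \<in> fixfield x" "number_subfield k" "x \<in> k"
  shows "z \<in> k"
proof -
  interpret k: number_subfield k by fact
  define D where "D = (\<Prod>y\<in>orb x - {x}. x - y)"
  have D: "D \<noteq> 0" using finite_orb[OF assms(1)] by (auto simp: D_def)
  have "1 \<in> fixfield x" using number_subfield_fixfield by (rule number_subfield.one_closed)
  then obtain p where "p \<in> polys_over \<rat>" "poly p x = D"
    using fixfield_interpolation[OF assms(1), of 1] by (auto simp: D_def)
  then have "D \<in> k" using k.poly_closed[OF k.Rats_polys_over assms(4), of p] by simp
  moreover obtain q where "q \<in> polys_over \<rat>" "poly q x = z * D"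
    using fixfield_interpolation[OF assms(1,2)] by (auto simp: D_def)
  then have "z * D \<in> k" using k.poly_closed[OF k.Rats_polys_over assms(4), of q] by simp
  ultimately have "z * D / D \<in> k" by (intro k.divide_closed)
  then show ?thesis using D by simp
qed

end

subsection \<open>Decomposition into elements with small orbits\<close>

text \<open>Functions on Z/N, kept as functions on the integers so that shifts of the argument need
  no reduction.\<close>

definition periodic :: "nat \<Rightarrow> (int \<Rightarrow> complex) \<Rightarrow> bool" where
  "periodic N c \<longleftrightarrow> (\<forall>m. c (m + int N) = c m)"

lemma periodic_mult:
  assumes "periodic N c"
  shows "c (m + k * int N) = c m"
proof (induction k rule: int_induct[where k = 0])
  case base
  then show ?case by simp
next
  case (step1 i)
  have "c (m + (i + 1) * int N) = c ((m + i * int N) + int N)" by (simp add: algebra_simps)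
  then show ?case using step1 assms by (simp add: periodic_def)
next
  case (step2 i)
  have "c (m + i * int N) = c ((m + (i - 1) * int N) + int N)" by (simp add: algebra_simps)
  then show ?case using step2 assms by (simp add: periodic_def)
qed

lemma periodic_mod: "periodic N c \<Longrightarrow> c (m mod int N) = c m"
  using periodic_mult[of N c "m mod int N" "m div int N"] by simp

lemma sum_periodic_shift:
  assumes "periodic N c" "N > 0"
  shows "(\<Sum>m\<in>{0..<int N}. c (m + a)) = (\<Sum>m\<in>{0..<int N}. c m)"
proof (rule sum.reindex_bij_witness[of _ "\<lambda>m. (m - a) mod int N" "\<lambda>m. (m + a) mod int N"])
  fix m assume "m \<in> {0..<int N}"
  then show "((m + a) mod int N - a) mod int N = m" "((m - a) mod int N + a) mod int N = m"
    by (simp_all add: mod_diff_left_eq mod_add_left_eq)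
  show "c ((m + a) mod int N) = c (m + a)" using assms(1) by (rule periodic_mod)
qed (use assms(2) in auto)

text \<open>The function c stands for the sum of the c m \<otimes> \<zeta>^m; the map l evaluates
  the second factor.\<close>

definition twisted_sum :: "nat \<Rightarrow> complex \<Rightarrow> (complex \<Rightarrow> complex) \<Rightarrow> (int \<Rightarrow> complex) \<Rightarrow> complex" where
  "twisted_sum N \<zeta> l c = (\<Sum>m\<in>{0..<int N}. l (\<zeta> powi m) * c m)"

text \<open>Shifting the argument by i * j is multiplication by \<zeta>^(-i*j). This is therefore
  the projector (1/N) \<Sum> \<zeta>^(-i*j) s^i onto the \<zeta>^j-eigenspace of s acting on
  coefficients.\<close>

definition spectral_part ::
    "nat \<Rightarrow> (complex \<Rightarrow> complex) \<Rightarrow> nat \<Rightarrow> (int \<Rightarrow> complex) \<Rightarrow> int \<Rightarrow> complex" where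
  "spectral_part N s j c m = (1 / of_nat N) * (\<Sum>i<N. (s ^^ i) (c (m + int i * int j)))"

locale primitive_root =
  fixes N :: nat and \<zeta> :: complex
  assumes N_pos: "N > 0" and root_one: "\<zeta> ^ N = 1"
    and primitive: "0 < i \<Longrightarrow> i < N \<Longrightarrow> \<zeta> ^ i \<noteq> 1"
begin

lemma root_nonzero [simp]: "\<zeta> \<noteq> 0"
  using root_one N_pos by (auto simp: power_0_left)

lemma powi_periodic: "\<zeta> powi (m + int N) = \<zeta> powi m"
  by (simp add: power_int_add root_one)

lemma sum_root_powers:
  assumes "i < N"
  shows "(\<Sum>j<N. \<zeta> powi (- (int i * int j))) = (if i = 0 then of_nat N else 0)"
proof (cases "i = 0")
  case False
  define w where "w = inverse (\<zeta> ^ i)"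
  have "\<zeta> powi (- (int i * int j)) = w ^ j" for j
    by (simp add: w_def power_int_minus power_int_mult power_inverse)
  moreover have "w \<noteq> 1" using primitive[of i] False assms by (auto simp: w_def)
  moreover have "w ^ N = 1"
    by (simp add: w_def power_inverse power_mult[symmetric]) (simp add: mult.commute power_mult root_one)
  ultimately show ?thesis using False by (simp add: sum_gp_strict)
qed simp

end

locale abelian_exponent = abelian_number_field + primitive_root +
  assumes exponent: "s \<in> auts K \<Longrightarrow> x \<in> K \<Longrightarrow> (s ^^ N) x = x"
begin

definition graded :: "complex \<Rightarrow> (int \<Rightarrow> complex) \<Rightarrow> bool" where
  "graded x c \<longleftrightarrow> periodic N c \<and> (\<forall>m. c m \<in> fixfield x)"

text \<open>In the group ring: c is an eigenvector of s whose eigenvalue is the power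
  \<zeta>^k.\<close>

definition shifts :: "(complex \<Rightarrow> complex) \<Rightarrow> (int \<Rightarrow> complex) \<Rightarrow> bool" where
  "shifts s c \<longleftrightarrow> (\<exists>k. \<forall>m. s (c m) = c (m - k))"

lemma graded_spectral_part:
  assumes "s \<in> auts K" "graded x c"
  shows "graded x (spectral_part N s j c)"
proof -
  interpret F: number_subfield "fixfield x" by (rule number_subfield_fixfield)
  have "spectral_part N s j c (m + int N) = spectral_part N s j c m" for m
  proof -
    have "c (m + int N + int i * int j) = c (m + int i * int j)" for i
      using assms(2) unfolding graded_def periodic_def by (metis add.commute add.left_commute)
    then show ?thesis by (simp add: spectral_part_def)
  qed
  moreover have "spectral_part N s j c m \<in> fixfield x" for m
    unfolding spectral_part_def using assms aut_fixfield[OF aut_funpow[OF assms(1)]]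
    by (intro F.mult_closed F.sum_closed) (auto simp: graded_def)
  ultimately show ?thesis by (simp add: graded_def periodic_def)
qed

lemma graded_in_K: "graded x c \<Longrightarrow> c m \<in> K"
  by (auto simp: graded_def fixfield_def)

lemma aut_spectral_part:
  assumes "s \<in> auts K" "t \<in> auts K" "graded x c"
  shows "t (spectral_part N s j c m) = (1 / of_nat N) * (\<Sum>i<N. t ((s ^^ i) (c (m + int i * int j))))"
proof -
  have mem: "(s ^^ i) (c n) \<in> K" for i n
    using aut_closed[OF aut_funpow[OF assms(1)] graded_in_K[OF assms(3)]] .
  have "t (spectral_part N s j c m) =
      t (1 / of_nat N) * t (\<Sum>i<N. (s ^^ i) (c (m + int i * int j)))"
    unfolding spectral_part_def using mem by (intro aut_mult[OF assms(2)] sum_closed) auto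
  also have "t (\<Sum>i<N. (s ^^ i) (c (m + int i * int j))) = (\<Sum>i<N. t ((s ^^ i) (c (m + int i * int j))))"
    using mem by (intro aut_sum[OF assms(2)]) auto
  finally show ?thesis using aut_Rats[OF assms(2), of "1 / of_nat N"] by simp
qed

lemma shifts_spectral_part:
  assumes "s \<in> auts K" "graded x c"
  shows "shifts s (spectral_part N s j c)"
  unfolding shifts_def
proof (intro exI allI)
  fix m
  define g where "g = (\<lambda>i. (s ^^ i) (c (m - int j + int i * int j)))"
  have "c (m - int j + int N * int j) = c (m - int j)"
    using periodic_mult[of N c "m - int j" "int j"] assms(2) by (simp add: graded_def mult.commute)
  \<comment> \<open>The cycle closes for two reasons at once: s^N is the identity on
    \<open>K\<close>, and c has period N.\<close>
  then have "g N = g 0" using exponent[OF assms(1) graded_in_K[OF assms(2)]] by (simp add: g_def)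
  then have "(\<Sum>i<N. g (Suc i)) = (\<Sum>i<N. g i)"
    using sum.lessThan_Suc_shift[of g N] by simp
  moreover have "s ((s ^^ i) (c (m + int i * int j))) = g (Suc i)" for i
    by (simp add: g_def algebra_simps)
  ultimately show "s (spectral_part N s j c m) = spectral_part N s j c (m - int j)"
    using aut_spectral_part[OF assms(1,1,2)] by (simp add: spectral_part_def g_def)
qed

text \<open>Since automorphisms commute, projecting to an eigenspace of s keeps the eigenvectors of
  t.\<close>

lemma shifts_spectral_part_other:
  assumes "s \<in> auts K" "t \<in> auts K" "graded x c" "shifts t c"
  shows "shifts t (spectral_part N s j c)"
proof -
  obtain k where k: "\<And>m. t (c m) = c (m - k)" using assms(4) by (auto simp: shifts_def)
  have "t ((s ^^ i) (c n)) = (s ^^ i) (c (n - k))" for i n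
    using auts_commute[OF assms(2) aut_funpow[OF assms(1)] graded_in_K[OF assms(3)]] k by simp
  then have "t (spectral_part N s j c m) = spectral_part N s j c (m - k)" for m
    using aut_spectral_part[OF assms(1,2,3)] by (simp add: spectral_part_def diff_add_eq)
  then show ?thesis by (auto simp: shifts_def)
qed

text \<open>The projectors of s add up to the identity: summing \<zeta>^(-i*j) over j leaves only i
  = 0. Additivity of l is all that is used of it, and the parts do not depend on l.\<close>

lemma sum_spectral_parts:
  assumes "s \<in> auts K" "graded x c" "\<And>u v. l (u + v) = l u + l v"
  shows "(\<Sum>j<N. twisted_sum N \<zeta> l (spectral_part N s j c)) = twisted_sum N \<zeta> l c"
proof -
  have l0: "l 0 = 0" using assms(3)[of 0 0] by simp
  have lsum: "l (sum u J) = (\<Sum>j\<in>J. l (u j))" for u and J :: "nat set"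
    by (induction J rule: infinite_finite_induct) (auto simp: l0 assms(3))
  have lN: "l (of_nat n * z) = of_nat n * l z" for n z
    by (induction n) (auto simp: l0 assms(3) algebra_simps)
  have c: "periodic N c" using assms(2) by (simp add: graded_def)
  let ?M = "{0..<int N}"
  have shift: "(\<Sum>m\<in>?M. l (\<zeta> powi m) * (s ^^ i) (c (m + int i * int j))) =
      (\<Sum>m\<in>?M. l (\<zeta> powi (m - int i * int j)) * (s ^^ i) (c m))" for i j
  proof -
    have "periodic N (\<lambda>m. l (\<zeta> powi (m - int i * int j)) * (s ^^ i) (c m))"
      using c powi_periodic[of "m - int i * int j" for m] by (auto simp: periodic_def algebra_simps)
    from sum_periodic_shift[OF this N_pos, of "int i * int j"] show ?thesis by simp
  qed
  have inner: "(\<Sum>j<N. l (\<zeta> powi (m - int i * int j))) = (if i = 0 then of_nat N * l (\<zeta> powi m) else 0)"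
    if "i < N" for i m
  proof -
    have "(\<Sum>j<N. l (\<zeta> powi (m - int i * int j))) = l (\<zeta> powi m * (\<Sum>j<N. \<zeta> powi (- (int i * int j))))"
      by (simp add: lsum[symmetric] sum_distrib_left power_int_diff power_int_minus divide_inverse)
    then show ?thesis using sum_root_powers[OF that] lN[of N "\<zeta> powi m"] by (simp add: l0 mult.commute)
  qed
  have "(\<Sum>j<N. twisted_sum N \<zeta> l (spectral_part N s j c)) =
      (1 / of_nat N) * (\<Sum>j<N. \<Sum>m\<in>?M. \<Sum>i<N. l (\<zeta> powi m) * (s ^^ i) (c (m + int i * int j)))"
    by (simp add: twisted_sum_def spectral_part_def sum_distrib_left ac_simps)
  also have "(\<Sum>j<N. \<Sum>m\<in>?M. \<Sum>i<N. l (\<zeta> powi m) * (s ^^ i) (c (m + int i * int j))) =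
      (\<Sum>j<N. \<Sum>i<N. \<Sum>m\<in>?M. l (\<zeta> powi m) * (s ^^ i) (c (m + int i * int j)))"
    by (intro sum.cong refl sum.swap)
  also have "\<dots> = (\<Sum>i<N. \<Sum>j<N. \<Sum>m\<in>?M. l (\<zeta> powi (m - int i * int j)) * (s ^^ i) (c m))"
    unfolding shift by (rule sum.swap)
  also have "\<dots> = (\<Sum>i<N. \<Sum>m\<in>?M. \<Sum>j<N. l (\<zeta> powi (m - int i * int j)) * (s ^^ i) (c m))"
    by (intro sum.cong refl sum.swap)
  also have "\<dots> = (\<Sum>i<N. if i = 0 then of_nat N * twisted_sum N \<zeta> l c else 0)"
  proof (intro sum.cong refl)
    fix i assume "i \<in> {..<N}"
    then have "(\<Sum>m\<in>?M. \<Sum>j<N. l (\<zeta> powi (m - int i * int j)) * (s ^^ i) (c m)) =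
        (\<Sum>m\<in>?M. (if i = 0 then of_nat N * l (\<zeta> powi m) else 0) * (s ^^ i) (c m))"
      using inner by (simp add: sum_distrib_right[symmetric])
    then show "(\<Sum>m\<in>?M. \<Sum>j<N. l (\<zeta> powi (m - int i * int j)) * (s ^^ i) (c m)) =
        (if i = 0 then of_nat N * twisted_sum N \<zeta> l c else 0)"
      by (simp add: twisted_sum_def sum_distrib_left mult.assoc)
  qed
  also have "\<dots> = of_nat N * twisted_sum N \<zeta> l c" using N_pos by simp
  finally show ?thesis using N_pos by simp
qed

text \<open>Simultaneous diagonalisation of the automorphisms: split by the projectors of one after
  the other. The same list serves every additive l, which allows both a rational functional and the
  identity later.\<close>

lemma spectral_decomposition:
  assumes "x \<in> K"
  shows "\<exists>cs. (\<forall>c\<in>set cs. graded x c \<and> (\<forall>s\<in>auts K. shifts s c)) \<and>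
    (\<forall>l. (\<forall>u v. l (u + v) = l u + l v) \<longrightarrow> sum_list (map (twisted_sum N \<zeta> l) cs) = l 1 * x)"
proof -
  have "orb x \<subseteq> (\<lambda>s. s x) ` auts K" by (simp add: orb_def)
  \<comment> \<open>Finitely many automorphisms realise all conjugates of x; any other agrees with
    one of them on \<rat>(x), where all coefficients lie.\<close>
  from finite_subset_image[OF finite_orb[OF assms] this] obtain S where
    S: "S \<subseteq> auts K" "finite S" "orb x = (\<lambda>s. s x) ` S" by auto
  have "\<exists>cs. (\<forall>c\<in>set cs. graded x c \<and> (\<forall>s\<in>S. shifts s c)) \<and>
    (\<forall>l. (\<forall>u v. l (u + v) = l u + l v) \<longrightarrow> sum_list (map (twisted_sum N \<zeta> l) cs) = l 1 * x)"
    using S(2,1)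
  proof (induction S)
    case empty
    \<comment> \<open>The element x \<otimes> 1.\<close>
    define c where "c = (\<lambda>m. if int N dvd m then x else 0)"
    have "0 \<in> fixfield x" using number_subfield_fixfield by (rule number_subfield.zero_closed)
    then have "graded x c" using fixfield_self[OF assms] by (auto simp: graded_def periodic_def c_def)
    moreover have "twisted_sum N \<zeta> l c = l 1 * x" for l
    proof -
      have "twisted_sum N \<zeta> l c = (\<Sum>m\<in>{0}. l (\<zeta> powi m) * c m)"
        unfolding twisted_sum_def
        by (rule sum.mono_neutral_right) (use N_pos in \<open>auto simp: c_def dest: zdvd_imp_le\<close>)
      then show ?thesis by (simp add: c_def)
    qed
    ultimately show ?case by (intro exI[of _ "[c]"]) auto
  next
    case (insert s S)
    then obtain cs where "\<forall>c\<in>set cs. graded x c \<and> (\<forall>s\<in>S. shifts s c)"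
      "\<forall>l. (\<forall>u v. l (u + v) = l u + l v) \<longrightarrow> sum_list (map (twisted_sum N \<zeta> l) cs) = l 1 * x"
      by auto
    then have cs: "\<And>c. c \<in> set cs \<Longrightarrow> graded x c" "\<And>c t. c \<in> set cs \<Longrightarrow> t \<in> S \<Longrightarrow> shifts t c"
      "\<And>l. (\<And>u v. l (u + v) = l u + l v) \<Longrightarrow> sum_list (map (twisted_sum N \<zeta> l) cs) = l 1 * x"
      by simp_all
    have s: "s \<in> auts K" "S \<subseteq> auts K" using insert.prems by auto
    define cs' where "cs' = concat (map (\<lambda>c. map (\<lambda>j. spectral_part N s j c) [0..<N]) cs)"
    have 1: "graded x c" if "c \<in> set cs'" for c
      using that cs(1) graded_spectral_part[OF s(1)] by (auto simp: cs'_def)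
    have 2: "shifts t c" if "c \<in> set cs'" "t \<in> insert s S" for c t
    proof -
      have "\<exists>d\<in>set cs. \<exists>j. c = spectral_part N s j d" using that(1) by (auto simp: cs'_def)
      then obtain d j where d: "d \<in> set cs" "c = spectral_part N s j d" by auto
      show ?thesis
      proof (cases "t = s")
        case True
        then show ?thesis using shifts_spectral_part[OF s(1) cs(1)[OF d(1)]] d(2) by simp
      next
        case False
        then have "t \<in> S" using that(2) by simp
        then show ?thesis
          using shifts_spectral_part_other[OF s(1) _ cs(1)[OF d(1)] cs(2)[OF d(1)]] s(2) d(2) by auto
      qed
    qed
    have 3: "sum_list (map (twisted_sum N \<zeta> l) cs') = l 1 * x"
      if l: "\<And>u v. l (u + v) = l u + l v" for l
    proof -
      have "sum_list (map (twisted_sum N \<zeta> l) cs') =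
          sum_list (map (\<lambda>c. \<Sum>j<N. twisted_sum N \<zeta> l (spectral_part N s j c)) cs)"
        unfolding cs'_def
        by (induction cs) (simp_all add: sum_list_distinct_conv_sum_set comp_def atLeast0LessThan)
      also have "\<dots> = sum_list (map (twisted_sum N \<zeta> l) cs)"
        by (intro arg_cong[of _ _ sum_list] map_cong refl sum_spectral_parts[OF s(1) cs(1)] l)
      finally show ?thesis using cs(3)[OF l] by simp
    qed
    show ?case by (intro exI[of _ cs']) (use 1 2 3 in auto)
  qed
  then obtain cs where "\<forall>c\<in>set cs. graded x c \<and> (\<forall>s\<in>S. shifts s c)"
    "\<forall>l. (\<forall>u v. l (u + v) = l u + l v) \<longrightarrow> sum_list (map (twisted_sum N \<zeta> l) cs) = l 1 * x"
    by auto
  then have cs: "\<And>c. c \<in> set cs \<Longrightarrow> graded x c" "\<And>c t. c \<in> set cs \<Longrightarrow> t \<in> S \<Longrightarrow> shifts t c"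
      "\<And>l. (\<forall>u v. l (u + v) = l u + l v) \<Longrightarrow> sum_list (map (twisted_sum N \<zeta> l) cs) = l 1 * x"
    by simp_all
  have "shifts s c" if "c \<in> set cs" "s \<in> auts K" for s c
  proof -
    have "s x \<in> orb x" using that by (auto simp: orb_def)
    then obtain t where t: "t \<in> S" "s x = t x" using S(3) by auto
    have "s (c m) = t (c m)" for m
    proof (rule aut_eq_fixfield[of x "c m" s t])
      show "c m \<in> fixfield x" using cs(1)[OF that(1)] by (simp add: graded_def)
      show "t \<in> auts K" using S(1) t(1) by auto
    qed fact+
    then show ?thesis using cs(2)[OF that(1) t(1)] by (simp add: shifts_def)
  qed
  then show ?thesis using cs by (intro exI[of _ cs]) auto
qed

text \<open>Every automorphism moves c m to another value of c, and c has at most N values.\<close>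

lemma card_orb_shifts:
  assumes "graded x c" "\<And>s. s \<in> auts K \<Longrightarrow> shifts s c"
  shows "card (orb (c m)) \<le> N"
proof -
  have "orb (c m) \<subseteq> c ` {0..<int N}"
  proof
    fix y assume "y \<in> orb (c m)"
    then obtain s where "s \<in> auts K" "y = s (c m)" by (auto simp: orb_def)
    then obtain k where "y = c (m - k)" using assms(2)[of s] by (auto simp: shifts_def)
    then have "y = c ((m - k) mod int N)" using assms(1) by (simp add: periodic_mod graded_def)
    then show "y \<in> c ` {0..<int N}" using N_pos by simp
  qed
  then have "card (orb (c m)) \<le> card (c ` {0..<int N})" by (intro card_mono) auto
  also have "\<dots> \<le> N" using card_image_le[of "{0..<int N}" c] by simp
  finally show ?thesis .
qed

end

text \<open>A \<rat>-linear projection of the complex numbers onto \<rat>, read off a basis that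
  contains 1. Applied to the powers of \<zeta>, it turns the twisted sums into rational combinations
  of the coefficients.\<close>

lemma rational_functional:
  "\<exists>l::complex \<Rightarrow> complex. (\<forall>u v. l (u + v) = l u + l v) \<and> (\<forall>u. l u \<in> \<rat>) \<and> l 1 = 1"
proof -
  define B where "B = rat_space.extend_basis {1::complex}"
  have i: "rat_space.independent {1::complex}" by (simp add: rat_space.dependent_single)
  have B: "rat_space.independent B" "rat_space.span B = UNIV" "1 \<in> B"
    using rat_space.independent_extend_basis[OF i] rat_space.span_extend_basis[OF i]
      rat_space.extend_basis_superset[OF i] by (auto simp: B_def)
  define l where "l = (\<lambda>u. complex_of_rat (rat_space.representation B u 1))"
  have "l (u + v) = l u + l v" for u v
    using rat_space.representation_add[OF B(1), of v u] B(2) by (simp add: l_def of_rat_add)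
  moreover have "l 1 = 1" using rat_space.representation_basis[OF B(1,3)] by (simp add: l_def)
  ultimately show ?thesis by (intro exI[of _ l]) (auto simp: l_def)
qed

text \<open>With a rational functional, x is a rational combination of the values c m. These lie in
  \<rat>(x), hence in F, and have at most N conjugates.\<close>

lemma (in abelian_exponent) number_field_eq_adjoin:
  assumes "number_subfield F" "F \<subseteq> K"
  shows "F = adjoin {y \<in> F. card (orb y) \<le> N}"
proof
  define S where "S = {y \<in> F. card (orb y) \<le> N}"
  interpret F: number_subfield F by fact
  interpret A: number_subfield "adjoin S"
    by (rule number_subfield_adjoin) (auto simp: S_def F.algebraic_elems)
  show "adjoin {y \<in> F. card (orb y) \<le> N} \<subseteq> F" by (rule adjoin_subset[OF assms(1)]) auto
  show "F \<subseteq> adjoin {y \<in> F. card (orb y) \<le> N}"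
  proof
    fix x assume xF: "x \<in> F"
    then have x: "x \<in> K" using assms(2) by auto
    obtain l :: "complex \<Rightarrow> complex" where l: "\<forall>u v. l (u + v) = l u + l v" "\<And>u. l u \<in> \<rat>" "l 1 = 1"
      using rational_functional by auto
    obtain cs where "\<forall>c\<in>set cs. graded x c \<and> (\<forall>s\<in>auts K. shifts s c)"
      "\<forall>l. (\<forall>u v. l (u + v) = l u + l v) \<longrightarrow> sum_list (map (twisted_sum N \<zeta> l) cs) = l 1 * x"
      using spectral_decomposition[OF x] by auto
    then have cs: "\<And>c. c \<in> set cs \<Longrightarrow> graded x c" "\<And>c s. c \<in> set cs \<Longrightarrow> s \<in> auts K \<Longrightarrow> shifts s c"
      "sum_list (map (twisted_sum N \<zeta> l) cs) = x"
      using l by simp_all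
    have "twisted_sum N \<zeta> l c \<in> adjoin S" if c: "c \<in> set cs" for c
    proof -
      have "c m \<in> S" for m
        using card_orb_shifts[OF cs(1,2)[OF c]] fixfield_minimal[OF x _ assms(1) xF, of "c m"] cs(1)[OF c]
        by (auto simp: S_def graded_def)
      then show ?thesis unfolding twisted_sum_def using l(2) subset_adjoin[of S]
        by (intro A.sum_closed A.mult_closed) auto
    qed
    then have "sum_list (map (twisted_sum N \<zeta> l) cs) \<in> adjoin S"
      by (induction cs) auto
    then show "x \<in> adjoin {y \<in> F. card (orb y) \<le> N}" using cs(3) by (simp add: S_def)
  qed
qed

lemma primitive_root_cis:
  assumes "N > 0"
  shows "primitive_root N (cis (2 * pi / real N))"
proof
  show "cis (2 * pi / real N) ^ N = 1" using assms by (simp add: DeMoivre)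
  fix i assume i: "0 < i" "i < N"
  show "cis (2 * pi / real N) ^ i \<noteq> 1"
  proof
    assume "cis (2 * pi / real N) ^ i = 1"
    then have "cos (2 * pi * real i / real N) = 1"
      by (simp add: DeMoivre complex_eq_iff ac_simps)
    then obtain n :: int where "2 * pi * real i / real N = of_int n * 2 * pi"
      by (auto simp: cos_one_2pi_int)
    then have "real i = of_int n * real N" using assms by (simp add: field_simps)
    then have "int i = n * int N" by (metis of_int_eq_iff of_int_mult of_int_of_nat_eq)
    then have "int N dvd int i" by simp
    then show False using i by (auto dest: dvd_imp_le)
  qed
qed fact

text \<open>The hypothesis is applied to \<rat>(x) for each x in K. The maximum with 1 makes the
  bound positive, as condition (b) demands.\<close>

lemma compositum_if_generated:
  assumes "number_subfield K"
    and "\<And>F. number_field F \<Longrightarrow> F \<subseteq> K \<Longrightarrow> \<exists>S. (\<forall>x\<in>S. element_degree_le D x) \<and> F = adjoin S"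
  shows "K \<subseteq> compositum_degree_le (max 1 D)"
proof
  fix x assume x: "x \<in> K"
  interpret number_subfield K by fact
  obtain p where "p \<in> polys_over \<rat>" "p \<noteq> 0" "poly p x = 0"
    using algebraic_elems[OF x] unfolding algebraic_altdef polys_over_def by auto
  then have "element_degree_le (degree p) x" unfolding element_degree_le_iff by (intro bexI[of _ p]) auto
  then have "number_field (adjoin {x})" by (simp add: number_field_def element_degree_le_def subfield_adjoin)
  moreover have "adjoin {x} \<subseteq> K" using x by (intro adjoin_subset[OF assms(1)]) auto
  ultimately have "\<exists>S. (\<forall>x\<in>S. element_degree_le D x) \<and> adjoin {x} = adjoin S"
    by (rule assms(2))
  then obtain S where S: "\<And>x. x \<in> S \<Longrightarrow> element_degree_le D x" "adjoin {x} = adjoin S"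
    by auto
  have sub: "subfield (compositum_degree_le (max 1 D)) complex_field"
    unfolding compositum_degree_le_def by (rule field.generate_field_is_subfield[OF field_complex_field]) auto
  have "S \<subseteq> compositum_degree_le (max 1 D)"
  proof
    fix s assume "s \<in> S"
    from S(1)[OF this] have "number_field (adjoin {s})" "field_degree (adjoin {s}) \<le> max 1 D"
      by (auto simp: number_field_def element_degree_le_def subfield_adjoin)
    moreover have "s \<in> adjoin {s}" using subset_adjoin[of "{s}"] by auto
    ultimately show "s \<in> compositum_degree_le (max 1 D)"
      unfolding compositum_degree_le_def by (intro generate_field.incl) auto
  qed
  then have "adjoin S \<subseteq> compositum_degree_le (max 1 D)"
    unfolding adjoin_def using subfield_complexD(1)[OF sub]
    by (intro field.generate_field_min_subfield1[OF field_complex_field _ sub]) auto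
  then show "x \<in> compositum_degree_le (max 1 D)" using S(2) subset_adjoin[of "{x}"] by auto
qed

lemma poly_as_sum:
  fixes q :: "'a::comm_ring_1 poly"
  assumes "degree q \<le> n"
  shows "poly q x = (\<Sum>i\<le>n. coeff q i * x ^ i)"
  unfolding poly_altdef by (rule sum.mono_neutral_left) (use assms in \<open>auto simp: coeff_eq_0\<close>)

section \<open>Absolute values\<close>

text \<open>
  A valuation \<open>v\<close> is handled through the real-valued absolute value \<open>exp (- v)\<close>; the normalisation
  of the \<open>p\<close>-adic absolute value is \<open>\<bar>p\<bar> = exp (-1)\<close>.
\<close>

locale nonarch = number_subfield K for K +
  fixes av :: "complex \<Rightarrow> real"
  assumes av_nonneg [simp]: "x \<in> K \<Longrightarrow> av x \<ge> 0"
    and av_eq_0 [simp]: "x \<in> K \<Longrightarrow> av x = 0 \<longleftrightarrow> x = 0"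
    and av_mult: "x \<in> K \<Longrightarrow> y \<in> K \<Longrightarrow> av (x * y) = av x * av y"
    and av_add: "x \<in> K \<Longrightarrow> y \<in> K \<Longrightarrow> av (x + y) \<le> max (av x) (av y)"
begin

lemma av_0 [simp]: "av 0 = 0"
  by (subst av_eq_0) auto

lemma av_1 [simp]: "av 1 = 1"
  using av_mult[of 1 1] by auto

lemma av_pos: "x \<in> K \<Longrightarrow> x \<noteq> 0 \<Longrightarrow> av x > 0"
  using av_nonneg[of x] av_eq_0[of x] by linarith

lemma av_uminus [simp]: 
  assumes "x \<in> K"
  shows "av (- x) = av x"
proof -
  have "av (-1) * av (-1) = 1" using av_mult[of "-1" "-1"] by auto
  moreover have "av (-1) \<ge> 0" by (rule av_nonneg) auto
  ultimately have "av (-1) = 1" by (metis abs_of_nonneg abs_square_eq_1 power2_eq_square)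
  then show ?thesis using av_mult[of "-1" x] assms by auto
qed

lemma av_diff: "x \<in> K \<Longrightarrow> y \<in> K \<Longrightarrow> av (x - y) \<le> max (av x) (av y)"
  using av_add[of x "-y"] av_uminus[of y] uminus_closed[of y] by simp

lemma av_diff_commute: "x \<in> K \<Longrightarrow> y \<in> K \<Longrightarrow> av (x - y) = av (y - x)"
  using av_uminus[of "x - y"] diff_closed[of x y] by simp

lemma av_diff_trans:
  "x \<in> K \<Longrightarrow> y \<in> K \<Longrightarrow> z \<in> K \<Longrightarrow> av (x - z) \<le> max (av (x - y)) (av (y - z))"
  using av_add[of "x - y" "y - z"] diff_closed by auto

lemma av_power: "x \<in> K \<Longrightarrow> av (x ^ n) = av x ^ n"
  by (induction n) (auto simp: av_mult power_closed)

lemma av_inverse: "x \<in> K \<Longrightarrow> av (inverse x) = inverse (av x)"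
  using av_mult[of x "inverse x"] inverse_closed[of x]
  by (cases "x = 0") (auto simp: inverse_unique[symmetric])

lemma av_divide: "x \<in> K \<Longrightarrow> y \<in> K \<Longrightarrow> av (x / y) = av x / av y"
  by (simp add: divide_inverse av_mult av_inverse inverse_closed)

lemma av_add_eq:
  assumes "x \<in> K" "y \<in> K" "av y < av x"
  shows "av (x + y) = av x"
proof -
  have "av x \<le> max (av (x + y)) (av y)" using av_diff[of "x + y" y] assms by auto
  moreover have "av (x + y) \<le> av x" using av_add[of x y] assms by auto
  ultimately show ?thesis using assms(3) by auto
qed

lemma av_eq_if_close: "x \<in> K \<Longrightarrow> y \<in> K \<Longrightarrow> av (x - y) < av x \<Longrightarrow> av y = av x"
  using av_add_eq[of x "y - x"] av_diff_commute[of x y] diff_closed[of y x] by simp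

lemma av_sum_le:
  assumes "\<And>i. i \<in> I \<Longrightarrow> f i \<in> K" "\<And>i. i \<in> I \<Longrightarrow> av (f i) \<le> C" "C \<ge> 0"
  shows "av (sum f I) \<le> C"
  using assms(1,2)
proof (induction I rule: infinite_finite_induct)
  case (insert i I)
  have "av (f i + sum f I) \<le> max (av (f i)) (av (sum f I))"
    using insert by (intro av_add sum_closed) auto
  also have "\<dots> \<le> C" using insert by auto
  finally show ?case using insert by simp
qed (use assms(3) in auto)

lemma av_prod: "(\<And>i. i \<in> I \<Longrightarrow> f i \<in> K) \<Longrightarrow> av (prod f I) = (\<Prod>i\<in>I. av (f i))"
  by (induction I rule: infinite_finite_induct) (auto simp: av_mult prod_closed)

lemma av_of_nat_le: "av (of_nat n) \<le> 1"
proof (induction n)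
  case (Suc n)
  then show ?case using av_add[of 1 "of_nat n"] by auto
qed simp

lemma av_of_int_le: "av (of_int n) \<le> 1"
  using av_of_nat_le[of "nat n"] av_of_nat_le[of "nat (-n)"] av_uminus[of "of_int n"]
  by (cases "n \<ge> 0") auto

end

locale padic_abs = nonarch +
  fixes p :: nat
  assumes prime_p: "prime p" and av_p: "av (of_nat p) = exp (-1)"
begin

lemma p_pos: "p > 0"
  using prime_p prime_gt_0_nat by blast

text \<open>From s * n + t * p = 1 and |t * p| < 1 it follows that |s * n| = 1, while neither factor
  exceeds 1.\<close>

lemma av_coprime:
  assumes "coprime n (int p)"
  shows "av (of_int n) = 1"
proof -
  obtain s t where st: "s * n + t * int p = 1"
    using bezout_int[of n "int p"] assms by (auto simp: coprime_iff_gcd_eq_1)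
  have "av (of_int (t * int p)) = av (of_int t) * exp (-1)"
    using av_mult[of "of_int t" "of_nat p"] by (simp add: av_p)
  also have "\<dots> \<le> 1 * exp (-1)" using av_of_int_le[of t] by (intro mult_right_mono) auto
  also have "\<dots> < 1" by simp
  finally have tp: "av (of_int (t * int p)) < 1" .
  have eq: "of_int s * of_int n + of_int (t * int p) = (1 :: complex)"
    by (metis (no_types) of_int_1 of_int_add of_int_mult st)
  have "av (of_int s * of_int n + of_int (t * int p)) \<le> max (av (of_int s * of_int n)) (av (of_int (t * int p)))"
    by (rule av_add) auto
  then have "1 \<le> max (av (of_int s * of_int n)) (av (of_int (t * int p)))" unfolding eq by simp
  then have "1 \<le> av (of_int s) * av (of_int n)" using tp av_mult[of "of_int s" "of_int n"] by auto
  also have "\<dots> \<le> 1 * av (of_int n)" using av_of_int_le[of s] by (intro mult_right_mono) auto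
  finally show ?thesis using av_of_int_le[of n] by simp
qed

lemma av_int_dvd:
  assumes "int p dvd n"
  shows "av (of_int n) < 1"
proof -
  obtain m where m: "n = int p * m" using assms by auto
  have "av (of_int n) = exp (-1) * av (of_int m)"
    using av_mult[of "of_nat p" "of_int m"] by (simp add: m av_p)
  also have "\<dots> \<le> exp (-1) * 1" using av_of_int_le[of m] by (intro mult_left_mono) auto
  finally show ?thesis by (rule le_less_trans) simp
qed

end

text \<open>A prime dividing the denominator would make the absolute value exceed 1. For a rational
  number one absolute value above each prime tells enough, on whatever field it lives.\<close>

lemma Ints_if_all_av_le_1:
  assumes "q \<in> \<rat>" "\<And>p. prime p \<Longrightarrow> \<exists>K av. padic_abs K av p \<and> av q \<le> 1"
  shows "q \<in> \<int>"
proof -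
  obtain a b :: int where ab: "b > 0" "coprime a b" "q = of_int a / of_int b"
    using assms(1) by (elim Rats_cases') auto
  have "b = 1"
  proof (rule ccontr)
    assume "b \<noteq> 1"
    then obtain r where r: "prime r" "r dvd b"
      using prime_divisor_exists[of b] ab(1) by auto
    define p where "p = nat r"
    have p2: "int p = r" using prime_ge_0_int[OF r(1)] by (simp add: p_def)
    then have "prime (int p)" using r(1) by simp
    then have p: "prime p" "int p = r" using p2 by (simp_all add: prime_nat_int_transfer[symmetric])
    obtain K av where "padic_abs K av p" and q: "av q \<le> 1" using assms(2)[OF p(1)] by auto
    then interpret padic_abs K av p by simp
    have "coprime a r" using ab(2) r(2) by (metis coprime_imp_coprime dvd_trans)
    then have "av (of_int a) = 1" using av_coprime p by simp
    moreover have "av (of_int b) < 1" using av_int_dvd r(2) p by simp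
    moreover have "av (of_int b) > 0" using ab(1) by (intro av_pos) auto
    ultimately have "av q > 1" unfolding ab(3) by (subst av_divide) auto
    then show False using q by simp
  qed
  then show ?thesis using ab by simp
qed

subsection \<open>Existence of absolute values\<close>

locale complex_subring =
  fixes R :: "complex set"
  assumes one_in: "1 \<in> R" and add_in: "x \<in> R \<Longrightarrow> y \<in> R \<Longrightarrow> x + y \<in> R"
    and mult_in: "x \<in> R \<Longrightarrow> y \<in> R \<Longrightarrow> x * y \<in> R" and uminus_in: "x \<in> R \<Longrightarrow> - x \<in> R"
begin

lemma zero_in: "0 \<in> R"
  using add_in[OF one_in uminus_in[OF one_in]] by simp

lemma sum_in: "(\<And>i. i \<in> I \<Longrightarrow> f i \<in> R) \<Longrightarrow> sum f I \<in> R"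
  by (induction I rule: infinite_finite_induct) (auto simp: add_in zero_in)

lemma power_in: "x \<in> R \<Longrightarrow> x ^ n \<in> R"
  by (induction n) (auto simp: mult_in one_in)

lemma diff_in: "x \<in> R \<Longrightarrow> y \<in> R \<Longrightarrow> x - y \<in> R"
  using add_in[OF _ uminus_in[of y], of x] by simp

lemma of_nat_in: "of_nat n \<in> R"
  by (induction n) (auto simp: zero_in one_in add_in)

lemma of_int_in: "of_int n \<in> R"
  using of_nat_in[of "nat n"] uminus_in[OF of_nat_in[of "nat (- n)"]] by (cases "n \<ge> 0") auto

lemma subring_adjoin: "complex_subring ((\<lambda>q. poly q z) ` polys_over R)"
proof
  show "1 \<in> (\<lambda>q. poly q z) ` polys_over R"
    by (intro image_eqI[of _ _ 1]) (auto simp: polys_over_def coeff_pCons one_in zero_in split: nat.splits)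
  fix x y assume "x \<in> (\<lambda>q. poly q z) ` polys_over R"
  then obtain a where a: "a \<in> polys_over R" "x = poly a z" by auto
  then show "- x \<in> (\<lambda>q. poly q z) ` polys_over R"
    by (intro image_eqI[of _ _ "-a"]) (auto simp: polys_over_def uminus_in)
  assume "y \<in> (\<lambda>q. poly q z) ` polys_over R"
  then obtain b where b: "b \<in> polys_over R" "y = poly b z" by auto
  show "x + y \<in> (\<lambda>q. poly q z) ` polys_over R" using a b
    by (intro image_eqI[of _ _ "a + b"]) (auto simp: polys_over_def add_in)
  show "x * y \<in> (\<lambda>q. poly q z) ` polys_over R" using a b
    by (intro image_eqI[of _ _ "a * b"]) (auto simp: polys_over_def coeff_mult mult_in sum_in)
qed

lemma subset_adjoin_poly: "R \<subseteq> (\<lambda>q. poly q z) ` polys_over R"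
proof
  fix x assume "x \<in> R"
  then show "x \<in> (\<lambda>q. poly q z) ` polys_over R"
    by (intro image_eqI[of _ _ "[:x:]"]) (auto simp: polys_over_def coeff_pCons zero_in split: nat.splits)
qed

lemma in_adjoin_poly: "z \<in> (\<lambda>q. poly q z) ` polys_over R"
  by (intro image_eqI[of _ _ "[:0, 1:]"])
     (auto simp: polys_over_def coeff_pCons zero_in one_in split: nat.splits)

end

text \<open>
  A subring that is maximal among those not containing \<open>1 / p\<close> is a valuation ring of rank one.
\<close>

locale maximal_p_ring = complex_subring R + number_subfield K for R K +
  fixes p :: nat
  assumes prime: "prime p" and R_subset: "R \<subseteq> K" and inv_p_notin: "1 / of_nat p \<notin> R"
    and maximal: "complex_subring S \<Longrightarrow> R \<subseteq> S \<Longrightarrow> S \<subseteq> K \<Longrightarrow> 1 / of_nat p \<notin> S \<Longrightarrow> S = R"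
begin

lemma p_nonzero [simp]: "p \<noteq> 0"
  using prime by (metis not_prime_0)

text \<open>By maximality R[z] contains 1/p as soon as z is not in R; n bounds the degree in z of
  such an expression. The degrees drive the descent in \<open>valuation_ring\<close>.\<close>

definition expr :: "nat \<Rightarrow> complex \<Rightarrow> bool" where
  "expr n z \<longleftrightarrow> (\<exists>q\<in>polys_over R. degree q \<le> n \<and> poly q z = 1 / of_nat p)"

lemma expr_if_notin:
  assumes "z \<in> K" "z \<notin> R"
  shows "\<exists>n. expr n z"
proof (rule ccontr)
  assume n: "\<nexists>n. expr n z"
  have "(\<lambda>q. poly q z) ` polys_over R = R"
  proof (rule maximal[OF subring_adjoin subset_adjoin_poly])
    show "(\<lambda>q. poly q z) ` polys_over R \<subseteq> K"
      using polys_over_mono[OF R_subset] poly_closed[OF _ assms(1)] by auto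
    show "1 / of_nat p \<notin> (\<lambda>q. poly q z) ` polys_over R"
    proof
      assume "1 / of_nat p \<in> (\<lambda>q. poly q z) ` polys_over R"
      then obtain q where "q \<in> polys_over R" "poly q z = 1 / of_nat p" by auto
      then have "expr (degree q) z" unfolding expr_def by (intro bexI[of _ q]) auto
      then show False using n by auto
    qed
  qed
  then show False using in_adjoin_poly[of z] assms(2) by auto
qed

text \<open>Let u = 1 - p * b. If its inverse were not in R, then 1/p would be a polynomial in it;
  clearing denominators puts u^d / p into R. As u^d is 1 modulo p * R, this puts 1/p into R.\<close>

lemma one_minus_unit:
  assumes "b \<in> R"
  shows "1 - of_nat p * b \<noteq> 0" "inverse (1 - of_nat p * b) \<in> R"
proof -
  define u where "u = 1 - of_nat p * b"
  show u0: "1 - of_nat p * b \<noteq> 0"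
  proof
    assume "1 - of_nat p * b = 0"
    then have "b = 1 / of_nat p" by (simp add: eq_divide_eq mult.commute)
    then show False using inv_p_notin assms by simp
  qed
  have uR: "u \<in> R" unfolding u_def by (intro diff_in mult_in one_in of_nat_in assms)
  have pow: "\<exists>d\<in>R. u ^ n = 1 - of_nat p * d" for n
  proof (induction n)
    case 0
    then show ?case by (intro bexI[of _ 0]) (auto simp: zero_in)
  next
    case (Suc n)
    then obtain d where d: "d \<in> R" "u ^ n = 1 - of_nat p * d" by auto
    have "u ^ Suc n = u * (1 - of_nat p * d)" by (simp add: d(2))
    also have "\<dots> = 1 - of_nat p * (d + b - of_nat p * b * d)"
      by (simp add: u_def algebra_simps)
    finally have "u ^ Suc n = 1 - of_nat p * (d + b - of_nat p * b * d)" .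
    moreover have "d + b - of_nat p * b * d \<in> R"
      by (intro diff_in add_in mult_in of_nat_in assms d)
    ultimately show ?case by blast
  qed
  show "inverse (1 - of_nat p * b) \<in> R"
  proof (rule ccontr)
    assume "inverse (1 - of_nat p * b) \<notin> R"
    then have "\<exists>n. expr n (inverse u)"
      unfolding u_def[symmetric] using uR R_subset by (intro expr_if_notin inverse_closed) auto
    then obtain n q where q: "q \<in> polys_over R" "degree q \<le> n" "poly q (inverse u) = 1 / of_nat p"
      by (auto simp: expr_def)
    define c where "c = (\<Sum>i\<le>degree q. coeff q i * u ^ (degree q - i))"
    have c: "c \<in> R" unfolding c_def using q(1) uR by (intro sum_in mult_in power_in) (auto simp: coeff_polys_over)
    have "u ^ degree q * poly q (inverse u) = c"
      unfolding poly_altdef c_def sum_distrib_left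
    proof (rule sum.cong[OF refl])
      fix i assume "i \<in> {..degree q}"
      then have "u ^ degree q = u ^ (degree q - i) * u ^ i" by (simp add: power_add[symmetric])
      then show "u ^ degree q * (coeff q i * inverse u ^ i) = coeff q i * u ^ (degree q - i)"
        using u0 by (simp add: u_def[symmetric] power_inverse)
    qed
    then have c': "u ^ degree q / of_nat p = c" using q(3) by simp
    obtain d where d: "d \<in> R" "u ^ degree q = 1 - of_nat p * d" using pow by auto
    have "1 / of_nat p = c + d" using c'[symmetric] by (simp add: d field_simps)
    then show False using inv_p_notin c d by (simp add: add_in)
  qed
qed

text \<open>In an expression for the inverse of z, the constant term moves to the other side and
  leaves the unit 1 - p * b_0. Dividing by it and multiplying by z^n writes z^n through lower
  powers, which removes the top term of the expression for z.\<close>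

lemma expr_reduce:
  assumes "expr n z" "expr m (inverse z)" "m \<le> n" "z \<noteq> 0" "n > 0"
  shows "expr (n - 1) z"
proof -
  obtain a where a: "a \<in> polys_over R" "degree a \<le> n" "poly a z = 1 / of_nat p"
    using assms(1) by (auto simp: expr_def)
  obtain b where b: "b \<in> polys_over R" "degree b \<le> m" "poly b (inverse z) = 1 / of_nat p"
    using assms(2) by (auto simp: expr_def)
  define u where "u = 1 - of_nat p * coeff b 0"
  have u: "u \<noteq> 0" "inverse u \<in> R" using one_minus_unit[OF coeff_polys_over[OF b(1), of 0]] by (auto simp: u_def)
  define b' where "b' = (\<lambda>j. inverse u * of_nat p * coeff b (Suc j))"
  have b': "b' j \<in> R" for j unfolding b'_def using u b(1)
    by (intro mult_in of_nat_in) (auto simp: coeff_polys_over)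
  have "1 / of_nat p = (\<Sum>j\<le>m. coeff b j * inverse z ^ j)"
    using b(3) poly_as_sum[OF b(2), of "inverse z"] by simp
  also have "\<dots> = coeff b 0 + (\<Sum>j<m. coeff b (Suc j) * inverse z ^ Suc j)"
    by (simp add: sum.atMost_shift)
  finally have "u = of_nat p * (\<Sum>j<m. coeff b (Suc j) * inverse z ^ Suc j)"
    by (simp add: u_def field_simps)
  then have "1 = inverse u * (of_nat p * (\<Sum>j<m. coeff b (Suc j) * inverse z ^ Suc j))"
    by (metis left_inverse u(1))
  also have "\<dots> = (\<Sum>j<m. b' j * inverse z ^ Suc j)"
    by (simp only: b'_def sum_distrib_left mult.assoc)
  finally have e: "z ^ n = (\<Sum>j<m. b' j * z ^ (n - Suc j))"
  proof -
    assume 1: "1 = (\<Sum>j<m. b' j * inverse z ^ Suc j)"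
    have "z ^ n = (\<Sum>j<m. b' j * inverse z ^ Suc j) * z ^ n" using 1 by simp
    also have "\<dots> = (\<Sum>j<m. b' j * z ^ (n - Suc j))"
      unfolding sum_distrib_right
    proof (rule sum.cong[OF refl])
      fix j assume "j \<in> {..<m}"
      then have "z ^ n = z ^ (n - Suc j) * z ^ Suc j" using assms(3) by (simp only: power_add[symmetric]) auto
      then show "b' j * inverse z ^ Suc j * z ^ n = b' j * z ^ (n - Suc j)"
        using assms(4) by (simp add: power_inverse field_simps)
    qed
    finally show ?thesis .
  qed
  define q where "q = (\<Sum>i<n. monom (coeff a i) i) + (\<Sum>j<m. monom (coeff a n * b' j) (n - Suc j))"
  have "poly q z = (\<Sum>i<n. coeff a i * z ^ i) + coeff a n * (\<Sum>j<m. b' j * z ^ (n - Suc j))"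
    by (simp add: q_def poly_sum poly_monom sum_distrib_left mult.assoc)
  also have "\<dots> = (\<Sum>i\<le>n. coeff a i * z ^ i)"
    by (simp add: e[symmetric] lessThan_Suc_atMost[symmetric])
  also have "\<dots> = 1 / of_nat p" using a(3) poly_as_sum[OF a(2), of z] by simp
  finally have "poly q z = 1 / of_nat p" .
  moreover have "q \<in> polys_over R"
    using coeff_polys_over[OF a(1)] b'
    by (auto simp: q_def polys_over_def coeff_sum coeff_monom intro!: add_in sum_in mult_in zero_in)
  moreover have "degree q \<le> n - 1"
    unfolding q_def using assms(5)
    by (intro degree_add_le degree_sum_le) (auto intro!: order_trans[OF degree_monom_le])
  ultimately show ?thesis by (auto simp: expr_def)
qed

lemma not_expr_0: "\<not> expr 0 z"
proof
  assume "expr 0 z"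
  then obtain q where q: "q \<in> polys_over R" "degree q = 0" "poly q z = 1 / of_nat p" by (auto simp: expr_def)
  then obtain c where "q = [:c:]" by (metis degree_eq_zeroE)
  then have "c \<in> R" "c = 1 / of_nat p" using q coeff_polys_over[of q R 0] by auto
  then show False using inv_p_notin by simp
qed

text \<open>If neither z nor its inverse is in R, take expressions of least degree for both; the one
  of larger degree can be reduced.\<close>

lemma valuation_ring:
  assumes "z \<in> K" "z \<notin> R"
  shows "inverse z \<in> R"
proof (rule ccontr)
  assume i: "inverse z \<notin> R"
  have z0: "z \<noteq> 0" using assms(2) zero_in by auto
  define n where "n = (LEAST n. expr n z)"
  define m where "m = (LEAST m. expr m (inverse z))"
  have n: "expr n z" unfolding n_def using expr_if_notin[OF assms] by (rule LeastI_ex)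
  have m: "expr m (inverse z)" unfolding m_def
    using expr_if_notin[OF inverse_closed[OF assms(1)] i] by (rule LeastI_ex)
  have pos: "n > 0" "m > 0" using n m not_expr_0 by (auto intro!: Nat.gr0I)
  show False
  proof (cases "m \<le> n")
    case True
    then have "expr (n - 1) z" using expr_reduce[OF n m] z0 pos by simp
    then have "n \<le> n - 1" unfolding n_def by (rule Least_le)
    then show False using pos by simp
  next
    case False
    then have "expr (m - 1) (inverse z)" using expr_reduce[OF m, of n] n z0 pos by simp
    then have "m \<le> m - 1" unfolding m_def by (rule Least_le)
    then show False using pos by simp
  qed
qed

section \<open>The real-valued valuation of a maximal ring\<close>

definition unit :: "complex \<Rightarrow> bool" where
  "unit u \<longleftrightarrow> u \<in> R \<and> inverse u \<in> R \<and> u \<noteq> 0"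

lemma unit_mult: "unit u \<Longrightarrow> unit w \<Longrightarrow> unit (u * w)"
  by (auto simp: unit_def mult_in)

lemma unit_inverse: "unit u \<Longrightarrow> unit (inverse u)"
  by (auto simp: unit_def)

lemma unit_1 [simp]: "unit 1"
  by (auto simp: unit_def one_in)

lemma unit_power: "unit u \<Longrightarrow> unit (u ^ n)"
  by (induction n) (auto intro: unit_mult)

lemma not_unit_powi_p:
  assumes "unit (of_nat p powi n)"
  shows "n = 0"
proof (rule ccontr)
  assume "n \<noteq> 0"
  define k where "k = nat \<bar>n\<bar>"
  have k: "k > 0" using \<open>n \<noteq> 0\<close> by (simp add: k_def)
  have "inverse (of_nat p ^ k) \<in> R"
    using assms by (cases "n \<ge> 0") (auto simp: unit_def k_def power_int_def power_inverse)
  then have "of_nat p ^ (k - 1) * inverse (of_nat p ^ k) \<in> R" by (intro mult_in power_in of_nat_in)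
  moreover have "of_nat p ^ (k - 1) * inverse (of_nat p ^ k) = 1 / (of_nat p :: complex)"
    using k by (cases k) (auto simp: field_simps)
  ultimately show False using inv_p_notin by simp
qed

lemma unit_of_int:
  assumes "coprime n (int p)"
  shows "unit (of_int n)"
proof -
  obtain s t where st: "s * n + t * int p = 1"
    using bezout_int[of n "int p"] assms by (auto simp: coprime_iff_gcd_eq_1)
  have e: "of_int s * of_int n = 1 - of_nat p * (of_int t :: complex)"
    using arg_cong[OF st, of "of_int :: int \<Rightarrow> complex"] by (simp add: algebra_simps eq_diff_eq)
  note u = one_minus_unit[OF of_int_in[of t], folded e]
  have "of_int s * inverse (of_int s * of_int n) \<in> R" using u by (intro mult_in of_int_in)
  moreover have "of_int s * inverse (of_int s * of_int n) = inverse (of_int n :: complex)"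
    using u(1) by (simp add: field_simps)
  ultimately have "inverse (of_int n :: complex) \<in> R" by (simp only:)
  then show ?thesis using u(1) by (auto simp: unit_def of_int_in)
qed

text \<open>The valuation normalised to 1 at p: its value at z is a/n if z^n and p^a differ by a
  unit. That all nonzero z in K have one is where algebraicity makes the rank one.\<close>

definition pvalue :: "complex \<Rightarrow> real \<Rightarrow> bool" where
  "pvalue z r \<longleftrightarrow> (\<exists>n>0. \<exists>a::int. r = real_of_int a / real n \<and> unit (z ^ n * of_nat p powi (- a)))"

lemma pvalue_unique:
  assumes "pvalue z r" "pvalue z s"
  shows "r = s"
proof -
  obtain n a where n: "n > 0" "r = real_of_int a / real n" "unit (z ^ n * of_nat p powi (- a))"
    using assms(1) by (auto simp: pvalue_def)
  obtain m b where m: "m > 0" "s = real_of_int b / real m" "unit (z ^ m * of_nat p powi (- b))"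
    using assms(2) by (auto simp: pvalue_def)
  have z0: "z \<noteq> 0" using n by (auto simp: unit_def power_0_left)
  have "unit ((z ^ n * of_nat p powi (- a)) ^ m * inverse ((z ^ m * of_nat p powi (- b)) ^ n))"
    by (rule unit_mult, rule unit_power, rule n(3), rule unit_inverse, rule unit_power, rule m(3))
  also have "(z ^ n * of_nat p powi (- a)) ^ m * inverse ((z ^ m * of_nat p powi (- b)) ^ n) =
      of_nat p powi (b * int n - a * int m)"
  proof -
    have "(z ^ n * of_nat p powi (- a)) ^ m = z ^ (n * m) * of_nat p powi (- (a * int m))"
      by (simp add: power_mult_distrib power_mult[symmetric] power_int_power')
    moreover have "(z ^ m * of_nat p powi (- b)) ^ n = z ^ (n * m) * of_nat p powi (- (b * int n))"
      by (simp add: power_mult_distrib power_mult[symmetric] power_int_power' mult.commute)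
    ultimately show ?thesis using z0
      by (simp only:) (simp add: power_int_minus power_int_diff divide_inverse)
  qed
  finally have "b * int n = a * int m" using not_unit_powi_p by force
  then have "real_of_int b * real n = real_of_int a * real m"
    by (metis of_int_mult of_int_of_nat_eq)
  then show ?thesis using n(1) m(1) unfolding n(2) m(2) by (simp add: frac_eq_eq)
qed

lemma pvalue_Rats:
  assumes "c \<in> \<rat>" "c \<noteq> 0"
  shows "\<exists>a. unit (c * of_nat p powi (- a))"
proof -
  have int: "\<exists>k::nat. unit (of_int n * of_nat p powi (- int k))" if n0: "n \<noteq> 0" for n :: int
  proof -
    have nu: "\<not> is_unit (int p)" using prime by (metis prime_nat_int_transfer not_prime_unit)
    obtain m where m: "n = int p ^ multiplicity (int p) n * m" "\<not> int p dvd m"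
      using multiplicity_decompose'[OF n0 nu] .
    have "coprime m (int p)" using m(2) prime
      by (metis coprime_commute prime_imp_coprime prime_nat_int_transfer)
    moreover have "of_int n * of_nat p powi (- int (multiplicity (int p) n)) = (of_int m :: complex)"
      by (subst m(1)) (simp add: power_int_minus)
    ultimately show ?thesis using unit_of_int by metis
  qed
  obtain a b :: int where ab: "b > 0" "c = of_int a / of_int b" using assms(1) by (elim Rats_cases') auto
  then have a0: "a \<noteq> 0" using assms(2) by auto
  obtain k l where kl: "unit (of_int a * of_nat p powi (- int k))" "unit (of_int b * of_nat p powi (- int l))"
    using int[OF a0] int[of b] ab(1) by auto
  have "unit (of_int a * of_nat p powi (- int k) * inverse (of_int b * of_nat p powi (- int l)))"
    by (intro unit_mult unit_inverse kl)
  also have "of_int a * of_nat p powi (- int k) * inverse (of_int b * of_nat p powi (- int l)) =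
      c * of_nat p powi (- (int k - int l))"
    using ab by (simp add: power_int_minus power_int_diff field_simps)
  finally show ?thesis by blast
qed

text \<open>In a valuation ring divisibility is total, so some t j has least value.\<close>

lemma common_divisor:
  assumes "finite I" "I \<noteq> {}" "\<And>i. i \<in> I \<Longrightarrow> t i \<in> K - {0}"
  shows "\<exists>j\<in>I. \<forall>i\<in>I. t i / t j \<in> R"
  using assms
proof (induction I rule: finite_ne_induct)
  case (singleton i)
  then show ?case by (auto simp: one_in)
next
  case (insert i I)
  then obtain j where j: "j \<in> I" "\<And>i. i \<in> I \<Longrightarrow> t i / t j \<in> R" by auto
  have K: "t i \<in> K" "t j \<in> K" "t i \<noteq> 0" "t j \<noteq> 0" using insert.prems j(1) by auto
  show ?case
  proof (cases "t i / t j \<in> R")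
    case True
    then show ?thesis using j by auto
  next
    case False
    then have "t j / t i \<in> R" using valuation_ring[of "t i / t j"] K by (auto simp: divide_closed)
    moreover have "t l / t i = t l / t j * (t j / t i)" for l using K by simp
    ultimately have "t l / t i \<in> R" if "l \<in> I" for l using j(2)[OF that] by (metis mult_in)
    then show ?thesis using K by (auto simp: one_in)
  qed
qed

text \<open>In a rational equation for z two terms must share the least value, for a single smallest
  one could not cancel. Their quotient is a rational number times a power of z with nonzero
  exponent, so this power has a value.\<close>

lemma pvalue_exists:
  assumes "z \<in> K" "z \<noteq> 0"
  shows "\<exists>r. pvalue z r"
proof -
  obtain q where q: "q \<in> polys_over \<rat>" "q \<noteq> 0" "poly q z = 0"
    using algebraic_elems[OF assms(1)] unfolding algebraic_altdef polys_over_def by auto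
  define t where "t = (\<lambda>i. coeff q i * z ^ i)"
  define I where "I = {i. i \<le> degree q \<and> coeff q i \<noteq> 0}"
  have tK: "t i \<in> K" for i unfolding t_def using q(1) assms(1) by (auto simp: coeff_polys_over)
  have t0: "t i \<noteq> 0" if "i \<in> I" for i using that assms(2) by (auto simp: t_def I_def)
  have fin: "finite I" by (simp add: I_def)
  have ne: "I \<noteq> {}" using q(2) by (auto simp: I_def intro!: exI[of _ "degree q"])
  have sum0: "(\<Sum>i\<in>I. t i) = 0"
  proof -
    have "0 = (\<Sum>i\<le>degree q. t i)" using q(3) by (simp add: t_def poly_altdef)
    also have "\<dots> = (\<Sum>i\<in>I. t i)" by (rule sum.mono_neutral_right) (auto simp: I_def t_def)
    finally show ?thesis by simp
  qed
  obtain j where j: "j \<in> I" "\<And>i. i \<in> I \<Longrightarrow> t i / t j \<in> R"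
    using common_divisor[OF fin ne, of t] tK t0 by auto
  have split: "t j = - (\<Sum>i\<in>I - {j}. t i)"
    using sum0 sum.remove[OF fin j(1), of t] by (simp add: eq_neg_iff_add_eq_0)
  have ne': "I - {j} \<noteq> {}"
  proof
    assume "I - {j} = {}"
    then have "t j = 0" using split by (simp only: sum.empty) simp
    then show False using t0[OF j(1)] by simp
  qed
  \<comment> \<open>The term t k has least value among the others. As t j is minus their sum, t k
    divides t j, and t j divides t k by its own choice.\<close>
  obtain k where k: "k \<in> I - {j}" "\<And>i. i \<in> I - {j} \<Longrightarrow> t i / t k \<in> R"
    using common_divisor[of "I - {j}" t] fin ne' tK t0 by auto
  have "t j / t k = - (\<Sum>i\<in>I - {j}. t i / t k)" by (subst split) (simp add: sum_divide_distrib)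
  then have "t j / t k \<in> R" using k by (auto intro: uminus_in sum_in)
  moreover have "t k / t j \<in> R" using j k by auto
  ultimately have u: "unit (t j / t k)" using t0 j k by (auto simp: unit_def)
  have jk: "coeff q j \<noteq> 0" "coeff q k \<noteq> 0" "j \<noteq> k" using j k by (auto simp: I_def)
  define c where "c = coeff q j / coeff q k"
  have c: "c \<in> \<rat>" "c \<noteq> 0" using jk q(1) by (auto simp: c_def coeff_polys_over)
  obtain b where b: "unit (c * of_nat p powi (- b))" using pvalue_Rats[OF c] by auto
  define e where "e = int j - int k"
  have "t j / t k = c * z powi e"
    using assms(2) jk by (simp add: t_def c_def e_def power_int_diff)
  then have "unit (c * z powi e * inverse (c * of_nat p powi (- b)))"
    using unit_mult[OF u unit_inverse[OF b]] by (simp only:)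
  also have "c * z powi e * inverse (c * of_nat p powi (- b)) = z powi e * of_nat p powi b"
    using c by (simp add: power_int_minus)
  finally have u2: "unit (z powi e * of_nat p powi b)" .
  define n where "n = nat \<bar>e\<bar>"
  have n: "n > 0" using jk by (simp add: n_def e_def)
  have "\<exists>a. unit (z ^ n * of_nat p powi (- a))"
  proof (cases "e \<ge> 0")
    case True
    then have "z powi e = z ^ n" by (simp add: n_def power_int_def)
    then show ?thesis using u2 by (intro exI[of _ "- b"]) simp
  next
    case False
    then have "inverse (z powi e) = z ^ n" by (simp add: n_def power_int_def power_inverse)
    then show ?thesis using unit_inverse[OF u2] by (intro exI[of _ b]) (simp add: power_int_minus)
  qed
  then show ?thesis using n unfolding pvalue_def by blast
qed

lemma pvalue_mult:
  assumes "pvalue z r" "pvalue w s"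
  shows "pvalue (z * w) (r + s)"
proof -
  obtain n a where n: "n > 0" "r = real_of_int a / real n" "unit (z ^ n * of_nat p powi (- a))"
    using assms(1) by (auto simp: pvalue_def)
  obtain m b where m: "m > 0" "s = real_of_int b / real m" "unit (w ^ m * of_nat p powi (- b))"
    using assms(2) by (auto simp: pvalue_def)
  have "unit ((z ^ n * of_nat p powi (- a)) ^ m * (w ^ m * of_nat p powi (- b)) ^ n)"
    by (rule unit_mult, rule unit_power, rule n(3), rule unit_power, rule m(3))
  also have "(z ^ n * of_nat p powi (- a)) ^ m * (w ^ m * of_nat p powi (- b)) ^ n =
      (z * w) ^ (n * m) * of_nat p powi (- (a * int m + b * int n))"
  proof -
    have "(z ^ n * of_nat p powi (- a)) ^ m = z ^ (n * m) * of_nat p powi (- (a * int m))"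
      by (simp add: power_mult_distrib power_mult[symmetric] power_int_power')
    moreover have "(w ^ m * of_nat p powi (- b)) ^ n = w ^ (n * m) * of_nat p powi (- (b * int n))"
      by (simp add: power_mult_distrib power_mult[symmetric] power_int_power' mult.commute)
    moreover have "of_nat p powi (- (a * int m + b * int n)) =
        of_nat p powi (- (a * int m)) * (of_nat p powi (- (b * int n)) :: complex)"
      by (subst power_int_add[symmetric]) auto
    ultimately show ?thesis by (simp add: power_mult_distrib)
  qed
  finally show ?thesis unfolding pvalue_def using n m
    by (intro exI[of _ "n * m"] exI[of _ "a * int m + b * int n"] conjI) (auto simp: field_simps)
qed

lemma pvalue_nonneg:
  assumes "z \<in> R" "pvalue z r"
  shows "r \<ge> 0"
proof (rule ccontr)
  assume "\<not> r \<ge> 0"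
  obtain n a where n: "n > 0" "r = real_of_int a / real n" "unit (z ^ n * of_nat p powi (- a))"
    using assms(2) by (auto simp: pvalue_def)
  have "a < 0" using \<open>\<not> r \<ge> 0\<close> n(1,2) by (auto simp: divide_less_0_iff not_le)
  define k where "k = nat (- a)"
  have k: "k > 0" "of_nat p powi (- a) = (of_nat p ^ k :: complex)"
    using \<open>a < 0\<close> by (auto simp: k_def power_int_def)
  have "z ^ n * of_nat p ^ (k - 1) * inverse (z ^ n * of_nat p powi (- a)) \<in> R"
    using n(3) assms(1) by (intro mult_in power_in of_nat_in) (auto simp: unit_def)
  moreover have "z \<noteq> 0" using n by (auto simp: unit_def power_0_left)
  then have "z ^ n * of_nat p ^ (k - 1) * inverse (z ^ n * of_nat p powi (- a)) = 1 / of_nat p"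
    unfolding k(2) using k(1) by (cases k) (auto simp: field_simps)
  ultimately show False using inv_p_notin by simp
qed

definition ring_abs :: "complex \<Rightarrow> real" where
  "ring_abs z = (if z = 0 then 0 else exp (- (THE r. pvalue z r)))"

lemma ring_abs_eq: "pvalue z r \<Longrightarrow> ring_abs z = exp (- r)"
proof -
  assume z: "pvalue z r"
  then have "z \<noteq> 0" by (auto simp: pvalue_def unit_def power_0_left)
  moreover have "(THE r. pvalue z r) = r" using z pvalue_unique by blast
  ultimately show ?thesis by (simp add: ring_abs_def)
qed

lemma ring_abs_le_1: "z \<in> R \<Longrightarrow> ring_abs z \<le> 1"
  using pvalue_exists[of z] R_subset pvalue_nonneg[of z] ring_abs_eq[of z]
  by (cases "z = 0") (auto simp: ring_abs_def)

lemma ring_abs_mult: "x \<in> K \<Longrightarrow> y \<in> K \<Longrightarrow> ring_abs (x * y) = ring_abs x * ring_abs y"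
proof (cases "x = 0 \<or> y = 0")
  case True
  then show ?thesis by (auto simp: ring_abs_def)
next
  case False
  assume "x \<in> K" "y \<in> K"
  then obtain r s where "pvalue x r" "pvalue y s" using pvalue_exists False by meson
  then show ?thesis using pvalue_mult[of x r y s] by (simp add: ring_abs_eq exp_add[symmetric])
qed

lemma padic_abs_ring_abs: "padic_abs K ring_abs p"
proof
  fix x y assume xy: "x \<in> K" "y \<in> K"
  show "0 \<le> ring_abs x" "ring_abs x = 0 \<longleftrightarrow> x = 0" by (auto simp: ring_abs_def)
  show "ring_abs (x * y) = ring_abs x * ring_abs y" using xy by (rule ring_abs_mult)
  have aux: "ring_abs (a + b) \<le> ring_abs a" if "a \<in> K" "b \<in> K" "a \<noteq> 0" "b / a \<in> R" for a b
  proof -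
    have "a + b = a * (1 + b / a)" using that by (simp add: field_simps)
    then have "ring_abs (a + b) = ring_abs a * ring_abs (1 + b / a)"
      using that R_subset by (metis ring_abs_mult add_in one_in subsetD)
    also have "\<dots> \<le> ring_abs a * 1" using that
      by (intro mult_left_mono ring_abs_le_1 add_in one_in) (auto simp: ring_abs_def)
    finally show ?thesis by simp
  qed
  show "ring_abs (x + y) \<le> max (ring_abs x) (ring_abs y)"
  proof (cases "x = 0 \<or> y = 0")
    case True
    then show ?thesis by (auto simp: ring_abs_def)
  next
    case False
    show ?thesis
    proof (cases "y / x \<in> R")
      case True
      then show ?thesis using aux[of x y] xy False by auto
    next
      case F: False
      then have "x / y \<in> R" using valuation_ring[of "y / x"] xy by (auto simp: divide_closed)
      then show ?thesis using aux[of y x] xy False by (auto simp: add.commute)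
    qed
  qed
next
  show "prime p" by (rule prime)
  have "pvalue (of_nat p) 1" unfolding pvalue_def
    by (intro exI[of _ 1] conjI) (auto simp: power_int_minus intro!: exI[of _ 1])
  then show "ring_abs (of_nat p) = exp (- 1)" by (rule ring_abs_eq)
qed

end

text \<open>Zorn's lemma gives a maximal ring without 1/p above R0, since a union of a chain omits
  1/p too. Prescribing R0 is what makes extensions possible.\<close>

lemma padic_abs_exists:
  assumes "number_subfield K" "prime p" "complex_subring R0" "R0 \<subseteq> K" "1 / of_nat p \<notin> R0"
  shows "\<exists>av. padic_abs K av p \<and> (\<forall>x\<in>R0. av x \<le> 1)"
proof -
  interpret K: number_subfield K by fact
  define A where "A = {R. complex_subring R \<and> R0 \<subseteq> R \<and> R \<subseteq> K \<and> 1 / of_nat p \<notin> R}"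
  have "\<exists>M\<in>A. \<forall>T\<in>A. M \<subseteq> T \<longrightarrow> T = M"
  proof (rule subset_Zorn)
    fix C assume C: "subset.chain A C"
    show "\<exists>U\<in>A. \<forall>T\<in>C. T \<subseteq> U"
    proof (cases "C = {}")
      case True
      then show ?thesis using assms by (auto simp: A_def)
    next
      case False
      have CA: "C \<subseteq> A" using C by (simp add: subset.chain_def)
      have two: "\<exists>T\<in>C. x \<in> T \<and> y \<in> T" if xy: "x \<in> \<Union>C" "y \<in> \<Union>C" for x y
      proof -
        obtain T T2 where TT: "T \<in> C" "x \<in> T" "T2 \<in> C" "y \<in> T2" using xy by auto
        then have "T \<subseteq> T2 \<or> T2 \<subseteq> T" using C by (auto simp: subset.chain_def subset_iff_psubset_eq)
        then show ?thesis using TT by blast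
      qed
      have sub: "complex_subring T" if "T \<in> C" for T using that CA by (auto simp: A_def)
      have "complex_subring (\<Union>C)"
      proof
        show "1 \<in> \<Union>C" using False sub complex_subring.one_in by blast
        fix x y assume x: "x \<in> \<Union>C"
        then show "- x \<in> \<Union>C" using sub complex_subring.uminus_in by blast
        assume y: "y \<in> \<Union>C"
        obtain T where "T \<in> C" "x \<in> T" "y \<in> T" using two[OF x y] by auto
        then show "x + y \<in> \<Union>C" "x * y \<in> \<Union>C"
          using sub[of T] complex_subring.add_in[of T x y] complex_subring.mult_in[of T x y] by auto
      qed
      then have "\<Union>C \<in> A" using CA False by (auto simp: A_def)
      then show ?thesis by (intro bexI[of _ "\<Union>C"]) auto
    qed
  qed
  then obtain M where M: "M \<in> A" "\<And>T. T \<in> A \<Longrightarrow> M \<subseteq> T \<Longrightarrow> T = M" by auto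
  have "maximal_p_ring M K p"
  proof (intro maximal_p_ring.intro maximal_p_ring_axioms.intro assms)
    show "complex_subring M" "M \<subseteq> K" "1 / of_nat p \<notin> M" using M(1) by (auto simp: A_def)
    fix T assume "complex_subring T" "M \<subseteq> T" "T \<subseteq> K" "1 / of_nat p \<notin> T"
    then have "T \<in> A" "M \<subseteq> T" using M(1) by (auto simp: A_def)
    then show "T = M" by (rule M(2))
  qed
  then interpret maximal_p_ring M K p .
  show ?thesis using padic_abs_ring_abs ring_abs_le_1 M(1) by (intro exI[of _ ring_abs]) (auto simp: A_def)
qed

text \<open>Start from the valuation ring of \<open>av\<close>. If aw x > av x, a fraction a/n
  between the logarithms makes x^n * p^a lie in this ring although aw exceeds 1 there. The common
  normalisation at p rules out a mere equivalence.\<close>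

lemma padic_abs_extend:
  assumes "padic_abs K av p" "number_subfield L" "K \<subseteq> L"
  shows "\<exists>aw. padic_abs L aw p \<and> (\<forall>x\<in>K. aw x = av x)"
proof -
  interpret padic_abs K av p by fact
  define R where "R = {x \<in> K. av x \<le> 1}"
  have sr: "complex_subring R"
  proof
    show "1 \<in> R" by (simp add: R_def)
    fix x y assume x: "x \<in> R"
    then show "- x \<in> R" by (auto simp: R_def uminus_closed)
    assume y: "y \<in> R"
    show "x + y \<in> R" using x y av_add[of x y] by (auto simp: R_def)
    show "x * y \<in> R" using x y by (auto simp: R_def av_mult mult_le_one)
  qed
  have "av (1 / of_nat p) = exp 1" by (subst av_divide) (auto simp: av_p exp_minus divide_inverse)
  then have "1 / of_nat p \<notin> R" by (simp add: R_def)
  then obtain aw where aw: "padic_abs L aw p" "\<And>x. x \<in> R \<Longrightarrow> aw x \<le> 1"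
    using padic_abs_exists[OF assms(2) prime_p sr] assms(3) by (auto simp: R_def)
  interpret w: padic_abs L aw p by fact
  have le: "aw x \<le> av x" if x: "x \<in> K" "x \<noteq> 0" for x
  proof (rule ccontr)
    assume "\<not> aw x \<le> av x"
    then have "av x < aw x" by simp
    have xL: "x \<in> L" using x assms(3) by auto
    have pos: "av x > 0" "aw x > 0" using av_pos[OF x] w.av_pos[OF xL x(2)] by auto
    then have "ln (av x) < ln (aw x)" using \<open>av x < aw x\<close> by simp
    then obtain q where q: "q \<in> \<rat>" "ln (av x) < q" "q < ln (aw x)" using Rats_dense_in_real by metis
    then obtain a b :: int where ab: "b > 0" "q = of_int a / of_int b" by (elim Rats_cases') auto
    define n where "n = nat b"
    have n: "n > 0" "q * real n = of_int a" using ab by (auto simp: n_def)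
    have pw: "aw (of_nat p powi a) = exp (- of_int a)" "av (of_nat p powi a) = exp (- of_int a)"
      "of_nat p powi a \<in> K"
      using p_pos
      by (auto simp: power_int_def w.av_power w.av_inverse av_power av_inverse av_p w.av_p
          exp_of_nat_mult[symmetric] exp_minus power_inverse intro!: power_closed inverse_closed)
    define y where "y = x ^ n * of_nat p powi a"
    have "av y = av x ^ n * exp (- of_int a)" unfolding y_def using x pw by (simp add: av_mult av_power power_closed)
    also have "\<dots> = exp (real n * ln (av x) - of_int a)"
      using pos by (simp add: exp_diff exp_minus exp_of_nat_mult divide_inverse)
    also have "\<dots> \<le> 1" using q(2) n by (simp add: mult.commute[of "real n"]) (metis less_eq_real_def mult_right_mono of_nat_0_le_iff)
    finally have "y \<in> R" using x pw by (simp add: R_def y_def mult_closed power_closed)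
    then have "aw y \<le> 1" by (rule aw(2))
    moreover have "aw y = aw x ^ n * exp (- of_int a)"
      unfolding y_def using xL pw assms(3) by (subst w.av_mult) (auto simp: w.av_power w.power_closed)
    moreover have "\<dots> = exp (real n * ln (aw x) - of_int a)"
      using pos by (simp add: exp_diff exp_minus exp_of_nat_mult divide_inverse)
    moreover have "real n * ln (aw x) > of_int a"
      using q(3) n by (metis mult.commute mult_strict_right_mono of_nat_0_less_iff)
    ultimately show False by simp
  qed
  have "aw x = av x" if x: "x \<in> K" for x
  proof (cases "x = 0")
    case False
    have xL: "x \<in> L" using x assms(3) by auto
    have "aw (inverse x) \<le> av (inverse x)" using x False by (intro le) auto
    then have "inverse (aw x) \<le> inverse (av x)" using x xL by (simp add: av_inverse w.av_inverse)
    then have "av x \<le> aw x" using av_pos[OF x False] w.av_pos[OF xL False] by (simp add: inverse_le_iff_le)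
    then show ?thesis using le[OF x False] by simp
  qed simp
  then show ?thesis using aw(1) by auto
qed

section \<open>Bounded local degrees force a bounded exponent\<close>

subsection \<open>Lagrange interpolation\<close>

definition lagrange_basis :: "complex set \<Rightarrow> complex \<Rightarrow> complex poly" where
  "lagrange_basis Y y = smult (inverse (\<Prod>y'\<in>Y - {y}. y - y')) (\<Prod>y'\<in>Y - {y}. [:- y', 1:])"

lemma poly_lagrange_basis:
  assumes "finite Y" "y \<in> Y" "z \<in> Y"
  shows "poly (lagrange_basis Y y) z = (if z = y then 1 else 0)"
  using assms by (auto simp: lagrange_basis_def poly_prod prod_zero_iff)

lemma degree_lagrange_basis:
  assumes "finite Y" "y \<in> Y"
  shows "degree (lagrange_basis Y y) \<le> card Y - 1"
proof -
  have "degree (\<Prod>y'\<in>Y - {y}. [:- y', 1:]) = card (Y - {y})"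
    using degree_prod_eq_sum_degree[of "Y - {y}" "\<lambda>y'. [:- y', 1:]"] by simp
  then show ?thesis using assms degree_smult_le[of _ "\<Prod>y'\<in>Y - {y}. [:- y', 1:]"]
    unfolding lagrange_basis_def by (metis card_Diff_singleton)
qed

lemma lagrange_interpolation:
  assumes "finite Y" "degree q < card Y"
  shows "q = (\<Sum>y\<in>Y. smult (poly q y) (lagrange_basis Y y))"
proof (rule poly_eqI_degree[of Y])
  fix z assume z: "z \<in> Y"
  have "poly (\<Sum>y\<in>Y. smult (poly q y) (lagrange_basis Y y)) z = (\<Sum>y\<in>Y. if z = y then poly q y else 0)"
    unfolding poly_sum by (rule sum.cong) (use assms(1) z in \<open>auto simp: poly_lagrange_basis\<close>)
  then show "poly q z = poly (\<Sum>y\<in>Y. smult (poly q y) (lagrange_basis Y y)) z"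
    using assms(1) z by simp
next
  have "degree (\<Sum>y\<in>Y. smult (poly q y) (lagrange_basis Y y)) \<le> card Y - 1"
  proof (rule degree_sum_le[OF assms(1)])
    fix y assume "y \<in> Y"
    then show "degree (smult (poly q y) (lagrange_basis Y y)) \<le> card Y - 1"
      using degree_lagrange_basis[OF assms(1)] degree_smult_le order_trans by blast
  qed
  then show "degree (\<Sum>y\<in>Y. smult (poly q y) (lagrange_basis Y y)) < card Y" using assms(2) by linarith
qed (fact assms(2))

context nonarch begin

lemma lagrange_basis_over:
  assumes "Y \<subseteq> K" "y \<in> Y"
  shows "lagrange_basis Y y \<in> polys_over K"
proof -
  have "[:- y', 1:] \<in> polys_over K" if "y' \<in> Y" for y'
    using assms that by (intro polys_over_pCons) (auto intro: uminus_closed)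
  moreover have "inverse (\<Prod>y'\<in>Y - {y}. y - y') \<in> K"
    using assms by (intro inverse_closed prod_closed diff_closed) auto
  ultimately show ?thesis unfolding lagrange_basis_def
    by (intro polys_over_smult polys_over_prod) auto
qed

lemma av_sum_le_sum:
  assumes "\<And>i. i \<in> I \<Longrightarrow> f i \<in> K"
  shows "av (sum f I) \<le> (\<Sum>i\<in>I. av (f i))"
proof (cases "finite I")
  case True
  show ?thesis
  proof (rule av_sum_le)
    fix i assume "i \<in> I"
    then show "av (f i) \<le> (\<Sum>i\<in>I. av (f i))"
      using True assms by (intro member_le_sum) auto
  qed (use assms in \<open>auto intro: sum_nonneg\<close>)
qed simp

text \<open>By interpolation each coefficient is a fixed linear combination of the values at the
  points of Y, which outnumber the degree.\<close>

lemma coeffs_tendsto_0: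
  assumes "finite Y" "Y \<subseteq> K" "\<And>n. q n \<in> polys_over K" "\<And>n. degree (q n) < card Y"
    and "\<And>y. y \<in> Y \<Longrightarrow> (\<lambda>n. av (poly (q n) y)) \<longlonglongrightarrow> 0"
  shows "(\<lambda>n. av (coeff (q n) i)) \<longlonglongrightarrow> 0"
proof -
  define c where "c = (\<lambda>y. coeff (lagrange_basis Y y) i)"
  have c: "c y \<in> K" if "y \<in> Y" for y
    unfolding c_def using lagrange_basis_over[OF assms(2) that] by (rule coeff_polys_over)
  have pk: "poly (q n) y \<in> K" if "y \<in> Y" for n y
    using that assms(2,3) by (auto intro: poly_closed)
  have "coeff (q n) i = (\<Sum>y\<in>Y. poly (q n) y * c y)" for n
    by (subst lagrange_interpolation[OF assms(1,4)]) (simp add: coeff_sum c_def)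
  then have "av (coeff (q n) i) \<le> (\<Sum>y\<in>Y. av (poly (q n) y) * av (c y))" for n
    using av_sum_le_sum[of Y "\<lambda>y. poly (q n) y * c y"] c pk by (simp add: av_mult mult_closed)
  moreover have "(\<lambda>n. \<Sum>y\<in>Y. av (poly (q n) y) * av (c y)) \<longlonglongrightarrow> 0"
    by (intro tendsto_null_sum tendsto_mult_left_zero assms(5))
  moreover have "0 \<le> av (coeff (q n) i)" for n
    using assms(3) by (intro av_nonneg coeff_polys_over)
  ultimately show ?thesis
    by (intro tendsto_sandwich[of "\<lambda>_. 0" "\<lambda>n. av (coeff (q n) i)" _ "\<lambda>n. \<Sum>y\<in>Y. av (poly (q n) y) * av (c y)"])
       auto
qed

end

subsection \<open>Weak approximation\<close>

text \<open>If b z < a z, choose c/n strictly between the two logarithms. Multiplying z^n by p^c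
  moves the threshold to 1.\<close>

lemma separate_two:
  assumes "padic_abs F a p" "padic_abs F b p" "z \<in> F" "a z \<noteq> b z"
  shows "\<exists>y\<in>F. a y > 1 \<and> b y < 1"
proof -
  interpret A: padic_abs F a p by fact
  interpret B: padic_abs F b p by fact
  have *: "\<exists>y\<in>F. a y > 1 \<and> b y < 1" if z: "z \<in> F" "z \<noteq> 0" "b z < a z" for z
  proof -
    have pos: "a z > 0" "b z > 0" using A.av_pos B.av_pos z by auto
    then have "ln (b z) < ln (a z)" using z(3) by simp
    then obtain q where q: "q \<in> \<rat>" "ln (b z) < q" "q < ln (a z)" using Rats_dense_in_real by metis
    then obtain c d :: int where cd: "d > 0" "q = of_int c / of_int d" by (elim Rats_cases') auto
    define n where "n = nat d"
    have n: "n > 0" "q * real n = of_int c" using cd by (auto simp: n_def)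
    have pw: "a (of_nat p powi c) = exp (- of_int c)" "b (of_nat p powi c) = exp (- of_int c)"
      "of_nat p powi c \<in> F"
      using A.p_pos
      by (auto simp: power_int_def A.av_power A.av_inverse B.av_power B.av_inverse A.av_p B.av_p
          exp_of_nat_mult[symmetric] exp_minus power_inverse intro!: A.power_closed A.inverse_closed)
    define y where "y = z ^ n * of_nat p powi c"
    have yF: "y \<in> F" unfolding y_def using z pw by (auto intro: A.mult_closed A.power_closed)
    have "a y = exp (real n * ln (a z) - of_int c)"
      unfolding y_def using z pos pw
      by (simp add: A.av_mult A.av_power A.power_closed exp_diff exp_minus exp_of_nat_mult divide_inverse)
    moreover have "b y = exp (real n * ln (b z) - of_int c)"
      unfolding y_def using z pos pw
      by (simp add: B.av_mult B.av_power A.power_closed exp_diff exp_minus exp_of_nat_mult divide_inverse)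
    moreover have "real n * ln (a z) > of_int c" "real n * ln (b z) < of_int c"
      using q n by (metis mult.commute mult_strict_right_mono of_nat_0_less_iff)+
    ultimately show ?thesis using yF by (intro bexI[of _ y]) auto
  qed
  have z0: "z \<noteq> 0" using assms(4) by auto
  show ?thesis
  proof (cases "b z < a z")
    case True
    then show ?thesis using *[OF assms(3) z0] by simp
  next
    case False
    then have "a z < b z" using assms(4) by simp
    then have "b (inverse z) < a (inverse z)"
      using A.av_pos[OF assms(3) z0] assms(3)
      by (simp add: A.av_inverse B.av_inverse less_imp_inverse_less)
    then show ?thesis using *[of "inverse z"] assms(3) z0 by (auto intro: A.inverse_closed)
  qed
qed

lemma (in nonarch) av_limits:
  assumes "y \<in> K" "av y > 1"
  shows "(\<lambda>n. inverse (av y ^ n)) \<longlonglongrightarrow> 0"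
  using LIMSEQ_inverse_realpow_zero[OF assms(2)] by simp

text \<open>Let z separate a from I and y separate a from the new index j. If b j z \<le> 1, then
  z^n * y works for large n. Otherwise z^n is replaced by z^n / (1 + z^n), which has size 1 where z
  is large and is small where z is small.\<close>

lemma separate_many:
  assumes "padic_abs F a p" "finite I" "\<And>i. i \<in> I \<Longrightarrow> padic_abs F (b i) p"
    and "\<And>i. i \<in> I \<Longrightarrow> \<exists>z\<in>F. a z \<noteq> b i z"
  shows "\<exists>y\<in>F. a y > 1 \<and> (\<forall>i\<in>I. b i y < 1)"
  using assms(2,3,4)
proof (induction I rule: finite_induct)
  case empty
  interpret A: padic_abs F a p by fact
  have "a (inverse (of_nat p)) > 1" by (subst A.av_inverse) (auto simp: A.av_p exp_minus)
  then show ?case by (auto intro!: bexI[of _ "inverse (of_nat p)"])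
next
  case (insert j I)
  interpret A: padic_abs F a p by fact
  obtain z where z: "z \<in> F" "a z > 1" "\<And>i. i \<in> I \<Longrightarrow> b i z < 1"
    using insert.IH insert.prems by auto
  have "padic_abs F (b j) p" using insert.prems by auto
  then interpret B: padic_abs F "b j" p .
  obtain x where x: "x \<in> F" "a x \<noteq> b j x" using insert.prems(2)[of j] by auto
  obtain y where y: "y \<in> F" "a y > 1" "b j y < 1"
    using separate_two[OF A.padic_abs_axioms B.padic_abs_axioms x] by auto
  have small: "eventually (\<lambda>n. b i z ^ n * b i y < 1) sequentially" if "i \<in> I" for i
  proof -
    interpret Bi: padic_abs F "b i" p using insert.prems that by auto
    have "(\<lambda>n. b i z ^ n * b i y) \<longlonglongrightarrow> 0 * b i y"
      using z Bi.av_nonneg[OF z(1)] that by (intro tendsto_mult LIMSEQ_power_zero tendsto_const) auto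
    then show ?thesis by (intro order_tendstoD(2)) auto
  qed
  show ?case
  proof (cases "b j z \<le> 1")
    case True
    have "eventually (\<lambda>n. \<forall>i\<in>I. b i z ^ n * b i y < 1) sequentially"
      using small insert.hyps(1) by (simp add: eventually_ball_finite)
    then obtain n where n: "\<And>i. i \<in> I \<Longrightarrow> b i z ^ n * b i y < 1"
      unfolding eventually_sequentially by auto
    define w where "w = z ^ n * y"
    have w: "w \<in> F" unfolding w_def using z y by auto
    have "b i w < 1" if i: "i \<in> I" for i
    proof -
      interpret Bi: padic_abs F "b i" p using insert.prems i by auto
      show ?thesis unfolding w_def using n[OF i] z y by (simp add: Bi.av_mult Bi.av_power A.power_closed)
    qed
    moreover have "b j w < 1"
    proof -
      have "b j z ^ n * b j y \<le> 1 * b j y"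
        using True z(1) y(1) by (intro mult_right_mono power_le_one) auto
      then show ?thesis unfolding w_def using z y by (simp add: B.av_mult B.av_power A.power_closed)
    qed
    moreover have "a w > 1"
    proof -
      have "1 * a y \<le> a z ^ n * a y" using z y by (intro mult_right_mono one_le_power) auto
      then have "1 < a z ^ n * a y" using y(2) by linarith
      then show ?thesis unfolding w_def using z y by (simp add: A.av_mult A.av_power A.power_closed)
    qed
    ultimately show ?thesis using w by auto
  next
    case False
    have "eventually (\<lambda>n. \<forall>i\<in>I. b i z ^ n * b i y < 1) sequentially"
      using small insert.hyps(1) by (simp add: eventually_ball_finite)
    then have "eventually (\<lambda>n. n > 0 \<and> (\<forall>i\<in>I. b i z ^ n * b i y < 1)) sequentially"
      using eventually_gt_at_top[of 0] by eventually_elim auto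
    then obtain n where n: "n > 0" "\<And>i. i \<in> I \<Longrightarrow> b i z ^ n * b i y < 1"
      unfolding eventually_sequentially by auto
    have zn: "z ^ n \<in> F" "1 + z ^ n \<in> F" using z by auto
    define w where "w = z ^ n / (1 + z ^ n) * y"
    have w: "w \<in> F" unfolding w_def using zn y by (intro A.mult_closed A.divide_closed)
    have big: "c (z ^ n / (1 + z ^ n)) = 1" if "padic_abs F c p" "c z > 1" for c
    proof -
      interpret C: padic_abs F c p by fact
      have g: "c (z ^ n) > 1" using that(2) z n(1) by (simp add: C.av_power)
      then have "c (z ^ n + 1) = c (z ^ n)" using zn by (intro C.av_add_eq) auto
      moreover have "z \<noteq> 0" using that(2) by auto
      ultimately show ?thesis using zn g by (simp add: C.av_divide add.commute)
    qed
    have "a w = a (z ^ n / (1 + z ^ n)) * a y"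
      unfolding w_def using zn y by (intro A.av_mult A.divide_closed)
    then have "a w > 1" using big[OF A.padic_abs_axioms z(2)] y by simp
    moreover have "b j w = b j (z ^ n / (1 + z ^ n)) * b j y"
      unfolding w_def using zn y by (intro B.av_mult A.divide_closed)
    then have "b j w < 1" using big[OF B.padic_abs_axioms] False y by simp
    moreover have "b i w < 1" if i: "i \<in> I" for i
    proof -
      interpret Bi: padic_abs F "b i" p using insert.prems i by auto
      have "b i (z ^ n) < 1" using z i n(1) by (simp add: Bi.av_power power_less_one_iff)
      then have "b i (1 + z ^ n) = 1" using zn Bi.av_add_eq[of 1 "z ^ n"] by simp
      then have "b i (z ^ n / (1 + z ^ n)) = b i z ^ n" using zn z(1) by (simp add: Bi.av_divide Bi.av_power)
      moreover have "b i w = b i (z ^ n / (1 + z ^ n)) * b i y"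
        unfolding w_def using zn y by (intro Bi.av_mult A.divide_closed)
      ultimately show ?thesis using n(2)[OF i] by simp
    qed
    ultimately show ?thesis using w by auto
  qed
qed

text \<open>For a separating z, the quotients z^n / (1 + z^n) tend to 1 at a and to 0 at each b i.
  The b i have to differ from a only, not from each other.\<close>

lemma weak_approximation:
  assumes "padic_abs F a p" "finite I" "\<And>i. i \<in> I \<Longrightarrow> padic_abs F (b i) p"
    and "\<And>i. i \<in> I \<Longrightarrow> \<exists>z\<in>F. a z \<noteq> b i z" "e > 0"
  shows "\<exists>y\<in>F. a (y - 1) < e \<and> (\<forall>i\<in>I. b i y < e)"
proof -
  interpret A: padic_abs F a p by fact
  obtain z where z: "z \<in> F" "a z > 1" "\<And>i. i \<in> I \<Longrightarrow> b i z < 1"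
  proof -
    have "\<exists>y\<in>F. a y > 1 \<and> (\<forall>i\<in>I. b i y < 1)" using assms(1-4) by (rule separate_many)
    then show thesis using that by auto
  qed
  have small: "eventually (\<lambda>n. b i z ^ n < e) sequentially" if "i \<in> I" for i
  proof -
    interpret Bi: padic_abs F "b i" p using assms that by auto
    have "(\<lambda>n. b i z ^ n) \<longlonglongrightarrow> 0"
      using z Bi.av_nonneg[OF z(1)] that by (intro LIMSEQ_power_zero) auto
    then show ?thesis using assms(5) by (intro order_tendstoD(2)) auto
  qed
  have "eventually (\<lambda>n. \<forall>i\<in>I. b i z ^ n < e) sequentially"
    using small assms(2) by (simp add: eventually_ball_finite)
  moreover have "eventually (\<lambda>n. inverse (a z ^ n) < e) sequentially"
    using A.av_limits[OF z(1,2)] assms(5) by (intro order_tendstoD(2)) auto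
  ultimately have "eventually (\<lambda>n. n > 0 \<and> (\<forall>i\<in>I. b i z ^ n < e) \<and> inverse (a z ^ n) < e) sequentially"
    using eventually_gt_at_top[of 0] by eventually_elim auto
  then obtain n where n: "n > 0" "\<And>i. i \<in> I \<Longrightarrow> b i z ^ n < e" "inverse (a z ^ n) < e"
    unfolding eventually_sequentially by auto
  have zn: "z ^ n \<in> F" "1 + z ^ n \<in> F" using z by auto
  define y where "y = z ^ n / (1 + z ^ n)"
  have y: "y \<in> F" unfolding y_def using zn by auto
  have g: "a (z ^ n) > 1" using z n(1) by (simp add: A.av_power)
  then have 1: "a (1 + z ^ n) = a (z ^ n)" using zn A.av_add_eq[of "z ^ n" 1] by (simp add: add.commute)
  then have "1 + z ^ n \<noteq> 0" using g by auto
  then have "y - 1 = - (1 / (1 + z ^ n))" by (simp add: y_def field_simps)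
  then have "a (y - 1) = inverse (a z ^ n)"
    using zn z 1 by (simp add: A.divide_closed A.av_divide A.av_power inverse_eq_divide)
  moreover have "b i y < e" if i: "i \<in> I" for i
  proof -
    interpret Bi: padic_abs F "b i" p using assms i by auto
    have "b i (z ^ n) < 1" using z i n(1) by (simp add: Bi.av_power power_less_one_iff)
    then have "b i (1 + z ^ n) = 1" using zn Bi.av_add_eq[of 1 "z ^ n"] by simp
    then show ?thesis using n(2)[OF i] zn z by (simp add: y_def Bi.av_divide Bi.av_power)
  qed
  ultimately show ?thesis using n y by (intro bexI[of _ y]) auto
qed

subsection \<open>Approximation by rational numbers\<close>

text \<open>A nontrivial relation between 1, x, ..., x^(B-1) over the p-adic numbers, stated by
  rational approximations so that no completion is involved. Nontriviality is the failure of some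
  coefficient to tend to 0.\<close>

definition rat_dependent :: "complex set \<Rightarrow> (complex \<Rightarrow> real) \<Rightarrow> nat \<Rightarrow> complex \<Rightarrow> bool" where
  "rat_dependent K av B x \<longleftrightarrow> (\<exists>q::nat \<Rightarrow> complex poly.
     (\<forall>n. q n \<in> polys_over \<rat> \<and> degree (q n) < B) \<and>
     (\<lambda>n. av (poly (q n) x)) \<longlonglongrightarrow> 0 \<and> \<not> (\<forall>i. (\<lambda>n. av (coeff (q n) i)) \<longlonglongrightarrow> 0))"

text \<open>Membership in the closure of \<rat>: in the completion, x is a p-adic number.\<close>

definition rat_approx :: "(complex \<Rightarrow> real) \<Rightarrow> complex \<Rightarrow> bool" where
  "rat_approx av x \<longleftrightarrow> (\<forall>e>0. \<exists>q\<in>\<rat>. av (x - q) < e)"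

context abelian_number_field begin

lemma padic_abs_conj:
  assumes "padic_abs K av p" "s \<in> auts K"
  shows "padic_abs (fixfield x) (\<lambda>z. av (s z)) p"
proof -
  interpret padic_abs K av p by fact
  interpret F: number_subfield "fixfield x" by (rule number_subfield_fixfield)
  interpret S: number_field_hom K s by (rule aut_hom) fact
  show ?thesis
  proof
    fix u v assume "u \<in> fixfield x" "v \<in> fixfield x"
    then have uv: "u \<in> K" "v \<in> K" "s u \<in> K" "s v \<in> K" using assms(2) by (auto simp: fixfield_def)
    show "0 \<le> av (s u)" using uv by simp
    show "av (s u) = 0 \<longleftrightarrow> u = 0" using uv S.hom_nonzero[of u] by auto
    show "av (s (u * v)) = av (s u) * av (s v)" using uv by (simp add: S.hom_mult av_mult)
    show "av (s (u + v)) \<le> max (av (s u)) (av (s v))" using uv by (simp add: S.hom_add av_add)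
  next
    show "prime p" by (rule prime_p)
    show "av (s (of_nat p)) = exp (- 1)" by (simp add: S.hom_of_nat av_p)
  qed
qed

text \<open>
  An isometric automorphism of the field \<open>fixfield x\<close> acts on its completion, and the powers of it
  that differ at \<open>x\<close> give distinct roots of any polynomial over the \<open>p\<close>-adic numbers killing \<open>x\<close>.
\<close>

lemma isometry_order:
  assumes "padic_abs K av p" "rat_dependent K av B x" "x \<in> K" "h \<in> auts K"
    and "\<And>z. z \<in> fixfield x \<Longrightarrow> av (h z) = av z"
  shows "(h ^^ fact B) x = x"
proof -
  interpret padic_abs K av p by fact
  have iso: "av ((h ^^ i) z) = av z" if "z \<in> fixfield x" for z i
    using that
  proof (induction i)
    case (Suc i)
    then show ?case using assms(5) aut_fixfield[OF aut_funpow[OF assms(4)], of z x i] by simp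
  qed simp
  have "\<not> inj_on (\<lambda>i. (h ^^ i) x) {..<B}"
  proof
    assume inj: "inj_on (\<lambda>i. (h ^^ i) x) {..<B}"
    define Y where "Y = (\<lambda>i. (h ^^ i) x) ` {..<B}"
    have card: "card Y = B" unfolding Y_def using inj by (simp add: card_image)
    obtain q where q: "\<And>n. q n \<in> polys_over \<rat>" "\<And>n. degree (q n) < B"
      "(\<lambda>n. av (poly (q n) x)) \<longlonglongrightarrow> 0" "\<not> (\<forall>i. (\<lambda>n. av (coeff (q n) i)) \<longlonglongrightarrow> 0)"
      using assms(2) by (auto simp: rat_dependent_def)
    have "(\<lambda>n. av (coeff (q n) i)) \<longlonglongrightarrow> 0" for i
    proof (rule coeffs_tendsto_0[of Y])
      show "Y \<subseteq> K" using assms(3) aut_closed[OF aut_funpow[OF assms(4)]] by (auto simp: Y_def)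
      fix y assume "y \<in> Y"
      then obtain i where y: "y = (h ^^ i) x" by (auto simp: Y_def)
      have "av (poly (q n) y) = av (poly (q n) x)" for n
      proof -
        have "poly (q n) x \<in> fixfield x"
          using number_subfield.poly_closed[OF number_subfield_fixfield
              number_subfield.Rats_polys_over[OF number_subfield_fixfield q(1)] fixfield_self[OF assms(3)]] .
        moreover have "poly (q n) y = (h ^^ i) (poly (q n) x)"
          using number_field_hom.hom_poly_Rats[OF aut_hom[OF aut_funpow[OF assms(4)]] q(1) assms(3)] y by simp
        ultimately show ?thesis using iso by simp
      qed
      then show "(\<lambda>n. av (poly (q n) y)) \<longlonglongrightarrow> 0" using q(3) by simp
    qed (use q card Rats_polys_over in \<open>auto simp: Y_def\<close>)
    then show False using q(4) by simp
  qed
  then obtain i j where ij: "i < j" "j < B" "(h ^^ i) x = (h ^^ j) x"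
    unfolding inj_on_def by (metis lessThan_iff linorder_neqE_nat)
  have "(h ^^ i) ((h ^^ (j - i)) x) = (h ^^ i) x"
    using ij funpow_add[of i "j - i" h] by simp
  then have e: "(h ^^ (j - i)) x = x"
    using inj_onD[OF aut_inj[OF aut_funpow[OF assms(4), of i]]] assms(3)
      aut_closed[OF aut_funpow[OF assms(4)] assms(3)] by blast
  have "(j - i) dvd fact B" by (rule dvd_fact) (use ij in auto)
  then obtain m where m: "fact B = (j - i) * m" by auto
  have "((h ^^ (j - i)) ^^ m) x = x" by (induction m) (use e in auto)
  then show ?thesis unfolding m by (simp add: funpow_mult mult.commute)
qed

text \<open>The set D below represents the decomposition group of \<open>av\<close> on \<rat>(x).
  Take c in \<rat>(x) near 1 at \<open>av\<close> and near 0 at all other conjugate absolute values.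
  In the trace of a * c, the terms from D are near a, because \<open>isometry_order\<close> makes
  the hypothesis \<open>fixed\<close> apply to them, and the others are near 0. So the trace is a
  rational number near |D| * a.\<close>

lemma rat_approx_if_fixed:
  assumes "padic_abs K av p" "rat_dependent K av B x" "x \<in> K" "a \<in> K"
    and fixed: "\<And>h. h \<in> auts K \<Longrightarrow> (h ^^ fact B) x = x \<Longrightarrow> h a = a"
  shows "rat_approx av a"
  unfolding rat_approx_def
proof (intro allI impI)
  fix e :: real assume e: "e > 0"
  interpret padic_abs K av p by fact
  interpret F: number_subfield "fixfield x" by (rule number_subfield_fixfield)
  have funpow_x: "(h ^^ n) x = x" if "h x = x" for h n by (induction n) (use that in auto)
  have aF: "a \<in> fixfield x" using assms(4) fixed funpow_x by (auto simp: fixfield_def)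
  define g where "g = (\<lambda>y. SOME s. s \<in> auts K \<and> s x = y)"
  have g: "g y \<in> auts K" "g y x = y" if "y \<in> orb x" for y
    using that someI_ex[of "\<lambda>s. s \<in> auts K \<and> s x = y"] by (auto simp: g_def orb_def)
  define D where "D = {y \<in> orb x. \<forall>z\<in>fixfield x. av (g y z) = av z}"
  have fin: "finite (orb x)" using assms(3) by (rule finite_orb)
  have D: "finite D" "D \<subseteq> orb x" using fin by (auto simp: D_def)
  have "x \<in> D"
  proof -
    have "g x z = z" if "z \<in> fixfield x" for z
      using aut_eq_fixfield[OF assms(3) that g(1) id_aut] g(2) by simp
    then show ?thesis by (simp add: D_def)
  qed
  then have cardD: "card D > 0" using D card_gt_0_iff by blast
  define M where "M = (of_nat (card D) :: complex)"
  have M: "M \<noteq> 0" "M \<in> K" "av M > 0" using cardD by (auto simp: M_def intro!: av_pos)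
  define C where "C = 1 + av a + (\<Sum>y\<in>orb x. av (g y a))"
  have gK: "g y z \<in> K" if "y \<in> orb x" "z \<in> K" for y z using g(1)[OF that(1)] that(2) by auto
  have C: "C > 0" "av a \<le> C" "\<And>y. y \<in> orb x \<Longrightarrow> av (g y a) \<le> C"
  proof -
    have nn: "0 \<le> (\<Sum>y\<in>orb x. av (g y a))" using gK assms(4) by (intro sum_nonneg) auto
    show "C > 0" "av a \<le> C" using nn av_nonneg[OF assms(4)] unfolding C_def by linarith+
    fix y assume "y \<in> orb x"
    then have "av (g y a) \<le> (\<Sum>y\<in>orb x. av (g y a))"
      using gK assms(4) fin by (intro member_le_sum) auto
    then show "av (g y a) \<le> C" using av_nonneg[OF assms(4)] unfolding C_def by linarith
  qed
  \<comment> \<open>C bounds a and its conjugates. The factor \<open>av M\<close> pays for the final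
    division by |D|, which may be divisible by p.\<close>
  define e' where "e' = e / 2 * av M / C"
  have e': "e' > 0" using e M C by (simp add: e'_def)
  obtain c where c: "c \<in> fixfield x" "av (c - 1) < e'" "\<And>y. y \<in> orb x - D \<Longrightarrow> av (g y c) < e'"
  proof -
    have "padic_abs (fixfield x) av p" using padic_abs_conj[OF assms(1) id_aut] .
    moreover have "finite (orb x - D)" using fin by simp
    moreover have "padic_abs (fixfield x) (\<lambda>z. av (g y z)) p" if "y \<in> orb x - D" for y
      using padic_abs_conj[OF assms(1) g(1)] that by blast
    moreover have "\<exists>z\<in>fixfield x. av z \<noteq> av (g y z)" if "y \<in> orb x - D" for y
    proof -
      have "\<not> (\<forall>z\<in>fixfield x. av (g y z) = av z)" using that by (simp add: D_def)
      then obtain z where "z \<in> fixfield x" "av (g y z) \<noteq> av z" by auto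
      then show ?thesis by (intro bexI[of _ z]) auto
    qed
    ultimately have "\<exists>y\<in>fixfield x. av (y - 1) < e' \<and> (\<forall>i\<in>orb x - D. av (g i y) < e')"
      using e' by (rule weak_approximation)
    then show thesis using that by auto
  qed
  have cK: "c \<in> K" using c(1) by (rule fixfieldD)
  define b where "b = a * c"
  have bF: "b \<in> fixfield x" unfolding b_def using aF c(1) by auto
  have bK: "b \<in> K" using bF by (rule fixfieldD)
  define T where "T = (\<Sum>y\<in>orb x. conj_at x b y)"
  have T: "T \<in> \<rat>" unfolding T_def using sum_conj_Rats[OF assms(3) bF] .
  \<comment> \<open>Unfolding \<open>conj_at\<close> yields the very choice that defines g.\<close>
  have Tg: "T = (\<Sum>y\<in>orb x. g y b)" by (simp add: T_def conj_at_def g_def)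
  have "T - M * a = (\<Sum>y\<in>D. g y b - a) + (\<Sum>y\<in>orb x - D. g y b)"
    unfolding Tg using sum.subset_diff[OF D(2) fin, of "\<lambda>y. g y b"] by (simp add: M_def sum_subtractf)
  moreover have "av (\<Sum>y\<in>D. g y b - a) \<le> C * e'"
  proof (rule av_sum_le)
    fix y assume y: "y \<in> D"
    then have yo: "y \<in> orb x" using D by auto
    show "g y b - a \<in> K" using gK[OF yo bK] assms(4) by auto
    have "(g y ^^ fact B) x = x"
      by (rule isometry_order[OF assms(1-3) g(1)[OF yo]]) (use y in \<open>auto simp: D_def\<close>)
    then have ga: "g y a = a" using fixed[OF g(1)[OF yo]] by simp
    interpret S: number_field_hom K "g y" by (rule aut_hom[OF g(1)[OF yo]])
    have "g y b - a = g y (b - a)" using ga bK assms(4) by (simp add: S.hom_diff)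
    then have "av (g y b - a) = av (b - a)" using y bF aF by (auto simp: D_def intro: F.diff_closed)
    also have "b - a = a * (c - 1)" by (simp add: b_def algebra_simps)
    also have "av (a * (c - 1)) = av a * av (c - 1)" using assms(4) cK by (intro av_mult) auto
    also have "\<dots> \<le> C * e'" using C c(2) av_nonneg[OF diff_closed[OF cK one_closed]] by (intro mult_mono) auto
    finally show "av (g y b - a) \<le> C * e'" .
  qed (use C e' in auto)
  moreover have "av (\<Sum>y\<in>orb x - D. g y b) \<le> C * e'"
  proof (rule av_sum_le)
    fix y assume y: "y \<in> orb x - D"
    show "g y b \<in> K" using gK bK y by auto
    have "g y b = g y a * g y c" unfolding b_def using y g(1)[of y] assms(4) cK by (intro aut_mult) auto
    then have "av (g y b) = av (g y a) * av (g y c)" using gK y cK assms(4) by (simp add: av_mult)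
    also have "\<dots> \<le> C * e'" using C c(3)[OF y] gK y cK assms(4) by (intro mult_mono) auto
    finally show "av (g y b) \<le> C * e'" .
  qed (use C e' in auto)
  moreover have "(\<Sum>y\<in>D. g y b - a) \<in> K" "(\<Sum>y\<in>orb x - D. g y b) \<in> K"
    using gK bK assms(4) D by (auto intro!: sum_closed diff_closed)
  ultimately have "av (T - M * a) \<le> C * e'" using av_add[of "\<Sum>y\<in>D. g y b - a" "\<Sum>y\<in>orb x - D. g y b"] by auto
  moreover have "a - T / M = - ((T - M * a) / M)" using M by (simp add: field_simps)
  then have "av (a - T / M) = av (T - M * a) / av M"
    using T M assms(4) by (simp add: av_divide diff_closed mult_closed divide_closed)
  moreover have "C * e' = e / 2 * av M" using C by (simp add: e'_def)
  ultimately have "av (a - T / M) \<le> e / 2" using M by (simp add: divide_le_eq)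
  moreover have "T / M \<in> \<rat>" using T by (simp add: M_def)
  ultimately show "\<exists>q\<in>\<rat>. av (a - q) < e" using e by (intro bexI[of _ "T / M"]) auto
qed

end

lemma fact_in_Rats [simp, intro]: "(fact k :: complex) \<in> \<rat>"
  by (metis Rats_of_nat of_nat_fact)

subsection \<open>Algebraic numbers that are \<open>p\<close>-adic for all primes \<open>p\<close>\<close>

text \<open>The denominator b is prime to p, so b * m = a can be solved modulo any power of p: the
  natural numbers are dense in the p-adic integers.\<close>

lemma (in padic_abs) near_nat:
  assumes "q \<in> \<rat>" "av q \<le> 1" "e > 0"
  shows "\<exists>m::nat. av (q - of_nat m) < e"
proof -
  obtain a b :: int where ab: "b > 0" "coprime a b" "q = of_int a / of_int b"
    using assms(1) by (elim Rats_cases') auto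
  have "\<not> int p dvd b"
  proof
    assume dvd: "int p dvd b"
    have "coprime a (int p)" using ab(2) dvd by (metis coprime_imp_coprime dvd_trans)
    then have "av (of_int a) = 1" by (rule av_coprime)
    moreover have "av (of_int b) < 1" using av_int_dvd[OF dvd] .
    moreover have "av (of_int b) > 0" using ab(1) by (intro av_pos) auto
    ultimately have "av q > 1" unfolding ab(3) by (subst av_divide) auto
    then show False using assms(2) by simp
  qed
  then have cop: "coprime b (int p)" using prime_p
    by (metis coprime_commute prime_imp_coprime prime_nat_int_transfer)
  have "(\<lambda>n. exp (-1) ^ n) \<longlonglongrightarrow> (0::real)" by (intro LIMSEQ_power_zero) simp
  then have "eventually (\<lambda>n. exp (-1) ^ n < e) sequentially" using assms(3) by (intro order_tendstoD(2))
  then obtain n where n: "exp (-1) ^ n < e" unfolding eventually_sequentially by auto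
  define P where "P = int p ^ n"
  have P: "P > 0" using p_pos by (simp add: P_def)
  have "coprime b P" using cop by (simp add: P_def)
  then obtain x z where xz: "x * b + z * P = 1"
    using bezout_int[of b P] by (auto simp: coprime_iff_gcd_eq_1)
  define m where "m = nat ((a * x) mod P)"
  define c where "c = a * z + b * ((a * x) div P)"
  have "int m = a * x - P * ((a * x) div P)"
    using P by (simp add: m_def minus_mult_div_eq_mod)
  then have "b * int m = b * (a * x) - b * (P * ((a * x) div P))" by (simp add: right_diff_distrib)
  then have "a - b * int m = a * (1 - x * b) + b * P * ((a * x) div P)"
    by (simp add: algebra_simps)
  also have "1 - x * b = z * P" using xz by simp
  finally have c: "a - b * int m = P * c" by (simp add: c_def algebra_simps)
  have "q - of_nat m = of_int (a - b * int m) / of_int b"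
    using ab by (simp add: field_simps)
  also have "\<dots> = of_nat p ^ n * of_int c / of_int b" unfolding c by (simp add: P_def)
  finally have "av (q - of_nat m) = exp (-1) ^ n * av (of_int c)"
    using av_coprime[OF cop] by (simp add: av_divide av_mult av_power av_p)
  also have "\<dots> \<le> exp (-1) ^ n * 1" using av_of_int_le[of c] by (intro mult_left_mono) auto
  finally show ?thesis using n by (intro exI[of _ m]) simp
qed

text \<open>Binomial coefficients are integers at natural numbers, these are dense in the p-adic
  integers, and the falling factorial does not increase distances there.\<close>

lemma (in padic_abs) av_gbinomial_le:
  assumes "y \<in> K" "av y \<le> 1" "rat_approx av y"
  shows "av (y gchoose k) \<le> 1"
proof -
  have fk: "av (fact k) > 0" by (intro av_pos) auto
  \<comment> \<open>An error below |k!| survives the division by k!; the bound 1 keeps the rational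
    approximation p-integral.\<close>
  define e where "e = min 1 (av (fact k))"
  have e: "e > 0" using fk by (simp add: e_def)
  obtain q where q: "q \<in> \<rat>" "av (y - q) < e" using assms(3) e unfolding rat_approx_def by blast
  have "av q \<le> max (av (y - (y - q))) 0" by simp
  have "av q \<le> max (av y) (av (y - q))" using av_diff[of y "y - q"] assms(1) q by auto
  then have "av q \<le> 1" using assms(2) q(2) by (auto simp: e_def max_def split: if_splits)
  then obtain m where m: "av (q - of_nat m) < e" using near_nat q(1) e by auto
  have ym: "av (y - of_nat m) < e"
    using av_diff_trans[of y q "of_nat m"] assms(1) q m by auto
  have close: "av ((\<Prod>i<j. y - of_nat i) - (\<Prod>i<j. of_nat m - of_nat i)) \<le> av (y - of_nat m)" for j
  proof (induction j)
    case 0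
    then show ?case using assms(1) by (auto intro!: av_nonneg)
  next
    case (Suc j)
    define A where "A = (\<Prod>i<j. y - of_nat i)"
    define B where "B = (\<Prod>i<j. of_nat m - of_nat i :: complex)"
    have K: "A \<in> K" "B \<in> K" using assms(1) by (auto simp: A_def B_def intro!: prod_closed diff_closed)
    have 1: "av (of_nat m - of_nat j) \<le> 1" using av_of_int_le[of "int m - int j"] by simp
    have A1: "av A \<le> 1" unfolding A_def using assms(1,2)
    proof (subst av_prod, goal_cases)
      case 2
      show ?case
      proof (rule prod_le_1)
        fix i assume "i \<in> {..<j}"
        show "0 \<le> av (y - of_nat i) \<and> av (y - of_nat i) \<le> 1"
          using av_diff[of y "of_nat i"] av_of_nat_le[of i] assms(1,2) by (auto intro!: av_nonneg)
      qed
    qed auto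
    have "A * (y - of_nat j) - B * (of_nat m - of_nat j) = A * (y - of_nat m) + (A - B) * (of_nat m - of_nat j)"
      by (simp add: algebra_simps)
    moreover have "av (A * (y - of_nat m) + (A - B) * (of_nat m - of_nat j)) \<le>
        max (av (A * (y - of_nat m))) (av ((A - B) * (of_nat m - of_nat j)))"
      using K assms(1) by (intro av_add mult_closed diff_closed) auto
    moreover have "av (A * (y - of_nat m)) \<le> av (y - of_nat m)"
    proof -
      have ymK: "y - of_nat m \<in> K" using assms(1) by (intro diff_closed) auto
      have "av (A * (y - of_nat m)) = av A * av (y - of_nat m)" using K(1) ymK by (rule av_mult)
      then show ?thesis using A1 K(1) ymK by (simp add: mult_left_le_one_le)
    qed
    moreover have "av ((A - B) * (of_nat m - of_nat j)) \<le> av (y - of_nat m)"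
    proof -
      have "av ((A - B) * (of_nat m - of_nat j)) = av (A - B) * av (of_nat m - of_nat j)"
        using K by (intro av_mult) auto
      also have "\<dots> \<le> av (A - B) * 1" using 1 av_nonneg[OF diff_closed[OF K]] by (intro mult_left_mono) auto
      finally show ?thesis using Suc by (simp add: A_def B_def)
    qed
    ultimately have "av (A * (y - of_nat j) - B * (of_nat m - of_nat j)) \<le> av (y - of_nat m)" by simp
    then show ?case by (simp add: A_def B_def)
  qed
  define A where "A = (\<Prod>i<k. y - of_nat i)"
  define B where "B = (\<Prod>i<k. of_nat m - of_nat i :: complex)"
  have K: "A \<in> K" "B \<in> K" using assms(1) by (auto simp: A_def B_def intro!: prod_closed diff_closed)
  have "B = fact k * of_nat (m choose k)"
    using gbinomial_mult_fact[of k "of_nat m :: complex"]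
    by (simp add: B_def binomial_gbinomial atLeast0LessThan)
  then have "av B \<le> av (fact k)" using av_of_nat_le[of "m choose k"] fk by (simp add: av_mult mult_left_le)
  moreover have "av (A - B) \<le> av (fact k)" using close[of k] ym by (simp add: A_def B_def e_def)
  ultimately have "av A \<le> av (fact k)" using av_add[of "A - B" B] K by (simp add: diff_closed)
  moreover have "y gchoose k = A / fact k"
    using gbinomial_mult_fact[of k y] by (simp add: A_def atLeast0LessThan field_simps)
  ultimately show ?thesis using K fk by (simp add: av_divide)
qed

text \<open>Consecutive coefficients differ by the factor 1 - (y + 1)/(j + 1) up to sign. As Re (y +
  1) \<ge> 1, its squared norm is at most j/(j + 1) for large j, so the squared norm of the
  coefficient is O(1/k).\<close>

lemma gbinomial_tendsto_0:
  assumes "Re y \<ge> 0"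
  shows "(\<lambda>k. norm (y gchoose k)) \<longlonglongrightarrow> 0"
proof -
  define u where "u = (\<lambda>k. (norm (y gchoose k))\<^sup>2)"
  have step: "u (Suc j) = u j * (norm (1 - (y + 1) / of_nat (Suc j)))\<^sup>2" for j
  proof -
    have "y gchoose Suc j = (y gchoose j) * ((y - of_nat j) / of_nat (Suc j))"
      by (simp add: gbinomial_prod_rev mult.commute)
    also have "(y - of_nat j) / of_nat (Suc j) = ((y + 1) - of_nat (Suc j)) / of_nat (Suc j)" by simp
    also have "\<dots> = - (1 - (y + 1) / of_nat (Suc j))"
      unfolding diff_divide_distrib by (simp del: of_nat_Suc)
    finally show ?thesis by (simp add: u_def norm_mult power_mult_distrib norm_minus_commute)
  qed
  define w where "w = y + 1"
  have w: "Re w \<ge> 1" using assms by (simp add: w_def)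
  obtain J :: nat where J: "real J \<ge> (norm w)\<^sup>2" using real_arch_simple by blast
  \<comment> \<open>With t = j + 1 the left side is t - 2 Re w + |w|^2 / t, at most t - 1 once t is
    at least |w|^2.\<close>
  have bound: "(norm (1 - w / of_nat (Suc j)))\<^sup>2 * real (Suc j) \<le> real j" if "j \<ge> J" for j
  proof -
    define t where "t = real (Suc j)"
    have t: "t > 0" "(norm w)\<^sup>2 \<le> t" using J that by (auto simp: t_def)
    have "(norm (1 - w / of_nat (Suc j)))\<^sup>2 = (1 - Re w / t)\<^sup>2 + (Im w / t)\<^sup>2"
      by (simp add: cmod_power2 t_def)
    also have "\<dots> = 1 - 2 * Re w / t + (norm w)\<^sup>2 / t\<^sup>2"
      by (simp add: cmod_power2 power2_diff power_divide add_divide_distrib)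
    finally have "(norm (1 - w / of_nat (Suc j)))\<^sup>2 * t = (1 - 2 * Re w / t + (norm w)\<^sup>2 / t\<^sup>2) * t"
      by simp
    also have "\<dots> = t - 2 * Re w + (norm w)\<^sup>2 / t"
      using t(1) by (simp add: left_diff_distrib distrib_right power2_eq_square)
    also have "\<dots> \<le> t - 2 * 1 + 1" using t w by (intro add_mono diff_mono mult_left_mono) (auto simp: divide_le_eq_1)
    finally show ?thesis by (simp add: t_def)
  qed
  have dec: "u k * real k \<le> u J * real J" if "k \<ge> J" for k
    using that
  proof (induction k rule: dec_induct)
    case (step k)
    have "u (Suc k) * real (Suc k) = u k * ((norm (1 - w / of_nat (Suc k)))\<^sup>2 * real (Suc k))"
      using \<open>\<And>j. u (Suc j) = _ j\<close>[of k] by (simp add: w_def)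
    also have "\<dots> \<le> u k * real k" using bound[of k] step(1) by (intro mult_left_mono) (auto simp: u_def)
    finally show ?case using step by simp
  qed simp
  have "(\<lambda>k. u J * real J / real k) \<longlonglongrightarrow> 0" by (rule lim_const_over_n)
  moreover have "eventually (\<lambda>k. u k \<le> u J * real J / real k) sequentially"
    using eventually_ge_at_top[of "max 1 J"]
  proof eventually_elim
    case (elim k)
    then show ?case using dec[of k] by (simp add: field_simps u_def)
  qed
  ultimately have "u \<longlonglongrightarrow> 0"
    by (intro tendsto_sandwich[of "\<lambda>_. 0" u _ "\<lambda>k. u J * real J / real k"]) (auto simp: u_def)
  then show ?thesis by (simp add: u_def)
qed

lemma rat_approx_affine:
  assumes "nonarch K av" "rat_approx av y" "y \<in> K" "c \<in> \<rat>" "d \<in> \<rat>"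
  shows "rat_approx av (c * y + d)"
  unfolding rat_approx_def
proof (intro allI impI)
  interpret nonarch K av by fact
  fix e :: real assume e: "e > 0"
  show "\<exists>q\<in>\<rat>. av (c * y + d - q) < e"
  proof (cases "c = 0")
    case True
    then show ?thesis using e assms by (intro bexI[of _ d]) auto
  next
    case False
    then have c: "av c > 0" using assms by (intro av_pos) auto
    then obtain q where q: "q \<in> \<rat>" "av (y - q) < e / av c"
      using assms(2) e unfolding rat_approx_def by (meson divide_pos_pos)
    have "c * y + d - (c * q + d) = c * (y - q)" by (simp add: algebra_simps)
    then have "av (c * y + d - (c * q + d)) = av c * av (y - q)"
      using assms q by (simp add: av_mult diff_closed)
    also have "\<dots> < e" using q c by (simp add: field_simps)
    finally show ?thesis using q assms by (intro bexI[of _ "c * q + d"]) auto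
  qed
qed

text \<open>The leading coefficient times a root is an algebraic integer. If |y| > 1, isolate the
  top term of the equation and cancel |y|^d.\<close>

lemma (in nonarch) av_lead_coeff_mult_le:
  assumes "\<And>i. coeff f i \<in> \<int>" "f \<noteq> 0" "y \<in> K" "poly f y = 0"
  shows "av (lead_coeff f * y) \<le> 1"
proof (cases "av y \<le> 1")
  have c: "coeff f i \<in> K" "av (coeff f i) \<le> 1" for i
    using assms(1)[of i] av_of_int_le by (auto elim!: Ints_cases)
  {
    case True
    then show ?thesis using c assms(3) by (simp add: av_mult mult_le_one)
  next
    case False
    have "degree f \<noteq> 0"
    proof
      assume "degree f = 0"
      then obtain c where "f = [:c:]" by (metis degree_eq_zeroE)
      then show False using assms by auto
    qed
    then obtain d where d: "degree f = Suc d" by (cases "degree f") auto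
    have "0 = (\<Sum>i\<le>Suc d. coeff f i * y ^ i)" using assms(4) by (simp add: poly_altdef d)
    then have "lead_coeff f * y ^ Suc d = - (\<Sum>i\<le>d. coeff f i * y ^ i)"
      by (simp add: d eq_neg_iff_add_eq_0 add.commute)
    moreover have "av (\<Sum>i\<le>d. coeff f i * y ^ i) \<le> av y ^ d"
    proof (rule av_sum_le)
      fix i assume i: "i \<in> {..d}"
      show "coeff f i * y ^ i \<in> K" using c assms(3) by auto
      have "av (coeff f i * y ^ i) = av (coeff f i) * av y ^ i"
        using c assms(3) by (simp add: av_mult av_power power_closed)
      also have "\<dots> \<le> 1 * av y ^ d" using c False i assms(3)
        by (intro mult_mono power_increasing) auto
      finally show "av (coeff f i * y ^ i) \<le> av y ^ d" by simp
    qed (use assms(3) in auto)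
    moreover have "(\<Sum>i\<le>d. coeff f i * y ^ i) \<in> K" using c assms(3) by auto
    ultimately have "av (lead_coeff f * y ^ Suc d) \<le> av y ^ d" by simp
    then have "av (lead_coeff f * y) * av y ^ d \<le> 1 * av y ^ d"
      using c assms(3) by (simp add: av_mult av_power power_closed mult_closed mult.assoc)
    moreover have "av y ^ d > 0" using False by simp
    ultimately show ?thesis by (simp only: mult_le_cancel_right_pos)
  }
qed

text \<open>All conjugates of a are required to be p-adic at one and the same absolute value, so
  that each factor of the product over the conjugates is integral there. The product is rational,
  hence one absolute value for each p controls it.\<close>

lemma (in abelian_number_field) Rats_if_everywhere_padic:
  assumes "a \<in> K"
    and "\<And>p. prime p \<Longrightarrow> \<exists>av. padic_abs K av p \<and> (\<forall>y\<in>orb a. rat_approx av y)"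
  shows "a \<in> \<rat>"
proof -
  from algebraic_elems[OF assms(1)] obtain f where f: "\<And>i. coeff f i \<in> \<int>" "f \<noteq> 0" "poly f a = 0"
    by (auto simp: algebraic_def)
  define l where "l = lead_coeff f"
  have l: "l \<in> \<int>" "l \<noteq> 0" using f by (auto simp: l_def)
  have lQ: "l \<in> \<rat>" using l(1) Ints_subset_Rats by auto
  have fQ: "f \<in> polys_over \<rat>" using f(1) Ints_subset_Rats by (auto simp: polys_over_def)
  have fin: "finite (orb a)" using assms(1) by (rule finite_orb)
  obtain M :: nat where M: "\<And>y. y \<in> orb a \<Longrightarrow> - Re (l * y) \<le> real M"
  proof -
    obtain M :: nat where "Max ((\<lambda>y. - Re (l * y)) ` orb a) \<le> real M" using real_arch_simple by blast
    moreover have "- Re (l * y) \<le> Max ((\<lambda>y. - Re (l * y)) ` orb a)" if "y \<in> orb a" for y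
      using that fin by (intro Max_ge) auto
    ultimately show thesis using that[of M] order_trans by blast
  qed
  \<comment> \<open>The factor l makes all l * y integral, and adding M makes the real parts
    nonnegative, as the decay of binomial coefficients needs.\<close>
  define t where "t = (\<lambda>y. l * y + of_nat M)"
  have orbK: "y \<in> K" if "y \<in> orb a" for y using that orb_subset[OF assms(1)] by auto
  have tK: "t y \<in> K" if "y \<in> orb a" for y using orbK[OF that] lQ unfolding t_def by (intro add_closed mult_closed) auto
  have st: "s (t y) = t (s y)" if "s \<in> auts K" "y \<in> orb a" for s y
    using orbK[OF that(2)] that(1) lQ unfolding t_def
    by (simp add: aut_add aut_mult aut_Rats mult_closed)
  define R where "R = (\<lambda>k. \<Prod>y\<in>orb a. t y gchoose k)"
  have gK: "t y gchoose k \<in> K" if "y \<in> orb a" for y k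
  proof -
    have "t y gchoose k = (\<Prod>i<k. t y - of_nat i) / fact k"
      using gbinomial_mult_fact[of k "t y"] by (simp add: atLeast0LessThan field_simps)
    then show ?thesis using tK[OF that] by (auto intro!: divide_closed prod_closed diff_closed)
  qed
  have RQ: "R k \<in> \<rat>" for k
  proof (rule fixed_Rats)
    show "R k \<in> K" unfolding R_def using gK by auto
    fix s assume s: "s \<in> auts K"
    interpret S: number_field_hom K s by (rule aut_hom) fact
    have "s (R k) = (\<Prod>y\<in>orb a. s (t y gchoose k))" unfolding R_def using gK by (intro S.hom_prod) auto
    also have "\<dots> = (\<Prod>y\<in>orb a. t (s y) gchoose k)"
    proof (rule prod.cong[OF refl])
      fix y assume y: "y \<in> orb a"
      have e: "z gchoose k = (\<Prod>i<k. z - of_nat i) / fact k" for z :: complex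
        using gbinomial_mult_fact[of k z] by (simp add: atLeast0LessThan field_simps)
      have "s (t y gchoose k) = s (\<Prod>i<k. t y - of_nat i) / s (fact k)"
        unfolding e using tK[OF y] by (intro S.hom_divide) (auto intro!: prod_closed diff_closed)
      also have "s (\<Prod>i<k. t y - of_nat i) = (\<Prod>i<k. t (s y) - of_nat i)"
        using tK[OF y] st[OF s y] by (subst S.hom_prod) (auto simp: S.hom_diff S.hom_of_nat diff_closed)
      also have "s (fact k) = fact k" by (rule S.hom_Rats) auto
      finally show "s (t y gchoose k) = t (s y) gchoose k" by (simp add: e)
    qed
    also have "\<dots> = (\<Prod>y\<in>s ` orb a. t y gchoose k)"
      using aut_inj_orb[OF s assms(1)] by (simp add: prod.reindex)
    finally show "s (R k) = R k" using aut_image_orb[OF s assms(1)] by (simp add: R_def)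
  qed
  have RZ: "R k \<in> \<int>" for k
  proof (rule Ints_if_all_av_le_1[OF RQ])
    fix p :: nat assume "prime p"
    then obtain av where av: "padic_abs K av p" "\<And>y. y \<in> orb a \<Longrightarrow> rat_approx av y"
      using assms(2) by blast
    interpret padic_abs K av p by fact
    have "av (t y gchoose k) \<le> 1" if y: "y \<in> orb a" for y
    proof (rule av_gbinomial_le[OF tK[OF y]])
      have "poly f y = 0"
      proof -
        obtain s where s: "s \<in> auts K" "y = s a" using y by (auto simp: orb_def)
        then show ?thesis
          using number_field_hom.hom_poly_Rats[OF aut_hom[OF s(1)] fQ assms(1)] f(3) by simp
      qed
      then have "av (l * y) \<le> 1" unfolding l_def using f orbK[OF y] by (intro av_lead_coeff_mult_le) auto
      then show "av (t y) \<le> 1"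
        using av_add[OF mult_closed[OF Rats_in[OF lQ] orbK[OF y]], of "of_nat M"] av_of_nat_le[of M]
        by (auto simp: t_def)
      show "rat_approx av (t y)" unfolding t_def
        by (rule rat_approx_affine[OF nonarch_axioms av(2)[OF y] orbK[OF y] lQ]) auto
    qed
    then have "av (R k) \<le> 1" unfolding R_def using gK
      by (subst av_prod) (auto intro!: prod_le_1)
    then show "\<exists>K av. padic_abs K av p \<and> av (R k) \<le> 1" using av(1) by blast
  qed
  have "(\<lambda>k. norm (R k)) \<longlonglongrightarrow> 0"
  proof -
    have y0: "(\<lambda>k. norm (t y gchoose k)) \<longlonglongrightarrow> 0" if "y \<in> orb a" for y
      using M[OF that] by (intro gbinomial_tendsto_0) (simp add: t_def)
    have "(\<lambda>k. \<Prod>y\<in>orb a. norm (t y gchoose k)) \<longlonglongrightarrow> (\<Prod>y\<in>orb a. 0)"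
      by (intro tendsto_prod y0)
    moreover have "(\<Prod>y\<in>orb a. 0::real) = 0" using fin by (intro prod_zero) auto
    ultimately show ?thesis by (simp add: R_def prod_norm power_0_left)
  qed
  then have "eventually (\<lambda>k. norm (R k) < 1) sequentially" by (intro order_tendstoD(2)) auto
  then obtain k where k: "norm (R k) < 1" unfolding eventually_sequentially by auto
  obtain r where r: "R k = of_int r" using RZ[of k] by (auto elim: Ints_cases)
  then have "r = 0" using k by (simp add: norm_of_int) 
  then obtain y where y: "y \<in> orb a" "t y gchoose k = 0"
    using r fin by (auto simp: R_def)
  \<comment> \<open>A vanishing binomial coefficient means that t y is one of 0, ..., k - 1; so the
    conjugate y is rational and equals a.\<close>
  then obtain i where i: "t y = of_nat i"
    using gbinomial_mult_fact[of k "t y"] by auto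
  have "l * y = of_nat i - of_nat M" using i by (simp add: t_def algebra_simps)
  then have "y = (of_nat i - of_nat M) / l" using l by (simp add: field_simps)
  then have yQ: "y \<in> \<rat>" using lQ by auto
  obtain s where s: "s \<in> auts K" "y = s a" using y(1) by (auto simp: orb_def)
  then have "s y = s a" using aut_Rats[OF s(1) yQ] by simp
  then have "y = a" using inj_onD[OF aut_inj[OF s(1)]] orbK[OF y(1)] assms(1) by auto
  then show ?thesis using yQ by simp
qed

text \<open>The automorphisms h with h^(B!) x = x are closed under composition, the group being
  abelian. Let f have the images of x under them as its simple roots. Its coefficients are fixed by
  all these h, so they are p-adic for all p and thus rational. Hence f has every conjugate of x as a
  root, and s x = h x for some such h.\<close>

lemma (in abelian_number_field) exponent_if_rat_dependent:
  assumes "\<And>p. prime p \<Longrightarrow> \<exists>av. padic_abs K av p \<and> (\<forall>x\<in>K. rat_dependent K av B x)"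
    and "s \<in> auts K" "x \<in> K"
  shows "(s ^^ fact B) x = x"
proof -
  define N where "N = (fact B :: nat)"
  define H where "H = {h \<in> auts K. (h ^^ N) x = x}"
  have funpow_comm: "(h ^^ n) (g y) = g ((h ^^ n) y)" if "h \<in> auts K" "g \<in> auts K" "y \<in> K" for h g y n
    using auts_commute[OF aut_funpow[OF that(1)] that(2,3)] .
  have funpow_comp: "((\<lambda>x. h (g x)) ^^ n) y = (h ^^ n) ((g ^^ n) y)"
    if "h \<in> auts K" "g \<in> auts K" "y \<in> K" for h g y n
  proof (induction n)
    case (Suc n)
    have "h (g ((h ^^ n) ((g ^^ n) y))) = h ((h ^^ n) (g ((g ^^ n) y)))"
      using funpow_comm[OF that(1,2), of "(g ^^ n) y" n] aut_closed[OF aut_funpow[OF that(2)] that(3)] by simp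
    then show ?case using Suc by simp
  qed simp
  define T where "T = (\<lambda>h. h x) ` H"
  have T: "T \<subseteq> orb x" "T \<subseteq> K" "finite T" "x \<in> T"
  proof -
    show "T \<subseteq> orb x" by (auto simp: T_def H_def orb_def)
    then show "T \<subseteq> K" "finite T" using orb_subset[OF assms(3)] finite_orb[OF assms(3)] finite_subset by blast+
    have "((\<lambda>x. x) ^^ N) x = x" by (induction N) auto
    then have "(\<lambda>x. x) \<in> H" by (simp add: H_def)
    then show "x \<in> T" unfolding T_def by (rule rev_image_eqI) simp
  qed
  have imT: "h ` T = T" if h: "h \<in> H" for h
  proof (rule endo_inj_surj[OF T(3)])
    have hA: "h \<in> auts K" "(h ^^ N) x = x" using h by (auto simp: H_def)
    show "h ` T \<subseteq> T"
    proof
      fix y assume "y \<in> h ` T"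
      then obtain g where g: "g \<in> auts K" "(g ^^ N) x = x" "y = h (g x)" by (auto simp: T_def H_def)
      have "(\<lambda>x. h (g x)) \<in> H" using hA g aut_comp[OF hA(1) g(1)] funpow_comp[OF hA(1) g(1) assms(3), of N]
        by (simp add: H_def)
      then show "y \<in> T" unfolding T_def g(3) by (rule rev_image_eqI) simp
    qed
    show "inj_on h T" using inj_on_subset[OF aut_inj[OF hA(1)] T(2)] .
  qed
  define f where "f = (\<Prod>y\<in>T. [:- y, 1:])"
  have fK: "f \<in> polys_over K" unfolding f_def using T(2) linear_factor_over by auto
  have fixH: "h (coeff f i) = coeff f i" if "h \<in> H" for h i
  proof -
    have h: "h \<in> auts K" using that by (simp add: H_def)
    have "map_poly h f = f" unfolding f_def using map_linear_factors[OF h T(2)] imT[OF that] by simp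
    then show ?thesis using h coeff_map_poly[of h f i] by simp
  qed
  \<comment> \<open>Conjugates of the coefficient are fixed by the same h, as automorphisms commute;
    so \<open>rat_approx_if_fixed\<close> applies to each of them.\<close>
  have "coeff f i \<in> \<rat>" for i
  proof (rule Rats_if_everywhere_padic)
    show cK: "coeff f i \<in> K" using fK by (rule coeff_polys_over)
    fix p :: nat assume "prime p"
    then obtain av where av: "padic_abs K av p" "\<And>x. x \<in> K \<Longrightarrow> rat_dependent K av B x" using assms(1) by blast
    have "rat_approx av y" if y: "y \<in> orb (coeff f i)" for y
    proof (rule rat_approx_if_fixed[OF av(1) av(2)[OF assms(3)] assms(3)])
      obtain g where g: "g \<in> auts K" "y = g (coeff f i)" using y by (auto simp: orb_def)
      show "y \<in> K" using g cK by auto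
      fix h assume h: "h \<in> auts K" "(h ^^ fact B) x = x"
      then have "h (coeff f i) = coeff f i" by (intro fixH) (simp add: H_def N_def)
      then show "h y = y" using g auts_commute[OF h(1) g(1) cK] by simp
    qed
    then show "\<exists>av. padic_abs K av p \<and> (\<forall>y\<in>orb (coeff f i). rat_approx av y)" using av(1) by blast
  qed
  then have fQ: "f \<in> polys_over \<rat>" by (simp add: polys_over_def)
  have "poly f x = 0" unfolding f_def poly_prod using T by (intro prod_zero) auto
  then have "poly f (s x) = 0"
    using number_field_hom.hom_poly_Rats[OF aut_hom[OF assms(2)] fQ assms(3)] aut_zero[OF assms(2)] by simp
  then have "s x \<in> T" using T(3) by (auto simp: f_def poly_prod)
  then obtain h where h: "h \<in> auts K" "(h ^^ N) x = x" "s x = h x" by (auto simp: T_def H_def)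
  have "(s ^^ i) x = (h ^^ i) x" for i
  proof (induction i)
    case (Suc i)
    have "s ((h ^^ i) x) = h ((h ^^ i) x)"
      by (rule aut_eq_fixfield[of x "(h ^^ i) x" s h])
         (use assms(2,3) h aut_fixfield[OF aut_funpow[OF h(1)] fixfield_self[OF assms(3)]] in auto)
    then show ?case using Suc by simp
  qed simp
  then show ?thesis using h(2) by (simp add: N_def)
qed

section \<open>A bounded exponent forces bounded local degrees\<close>

subsection \<open>Classes modulo approximate powers\<close>

text \<open>A set of pairwise unrelated elements of largest size meets everything, since otherwise
  it could be enlarged. The bound makes a largest size exist.\<close>

lemma representatives:
  assumes refl: "\<And>x. x \<in> A \<Longrightarrow> R x x"
    and bound: "\<And>S. S \<subseteq> A \<Longrightarrow> finite S \<Longrightarrow> \<forall>x\<in>S. \<forall>y\<in>S. x \<noteq> y \<longrightarrow> \<not> R x y \<Longrightarrow> card S \<le> n"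
    and sym: "\<And>x y. x \<in> A \<Longrightarrow> y \<in> A \<Longrightarrow> R x y \<Longrightarrow> R y x"
  shows "\<exists>S\<subseteq>A. finite S \<and> card S \<le> n \<and> (\<forall>x\<in>S. \<forall>y\<in>S. x \<noteq> y \<longrightarrow> \<not> R x y) \<and> (\<forall>x\<in>A. \<exists>y\<in>S. R x y)"
proof -
  define P where "P = (\<lambda>S. S \<subseteq> A \<and> finite S \<and> (\<forall>x\<in>S. \<forall>y\<in>S. x \<noteq> y \<longrightarrow> \<not> R x y))"
  have "P {}" by (simp add: P_def)
  moreover have "\<forall>S. P S \<longrightarrow> card S \<le> n" using bound by (auto simp: P_def)
  ultimately obtain S where S: "P S" "\<And>S'. P S' \<Longrightarrow> card S' \<le> card S"
    using ex_has_greatest_nat[of P "{}" card "Suc n"] by (auto simp: less_Suc_eq_le)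
  have "\<exists>y\<in>S. R x y" if x: "x \<in> A" for x
  proof (rule ccontr)
    assume n: "\<not> (\<exists>y\<in>S. R x y)"
    then have "x \<notin> S" using refl[OF x] by auto
    moreover have "\<not> R y x" if "y \<in> S" for y
      using n that sym[of y x] S(1) x by (auto simp: P_def)
    then have "P (insert x S)" using S(1) x n by (auto simp: P_def)
    then have "card (insert x S) \<le> card S" by (rule S(2))
    ultimately show False using S(1) by (auto simp: P_def)
  qed
  then show ?thesis using S(1) bound[of S] by (intro exI[of _ S]) (auto simp: P_def)
qed

lemma (in nonarch) av_sum_less:
  assumes "\<And>i. i \<in> I \<Longrightarrow> f i \<in> K" "\<And>i. i \<in> I \<Longrightarrow> av (f i) < C" "C > 0"
  shows "av (sum f I) < C"
  using assms(1,2)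
proof (induction I rule: infinite_finite_induct)
  case (insert i I)
  have "av (f i + sum f I) \<le> max (av (f i)) (av (sum f I))"
    using insert by (intro av_add sum_closed) auto
  also have "\<dots> < C" using insert by auto
  finally show ?case using insert by simp
qed (use assms(3) in auto)

text \<open>The largest term strictly dominates the sum of the others.\<close>

lemma (in nonarch) sum_nonzero_if_distinct_av:
  assumes "finite I" "I \<noteq> {}" "\<And>i. i \<in> I \<Longrightarrow> f i \<in> K - {0}" "inj_on (\<lambda>i. av (f i)) I"
  shows "sum f I \<noteq> 0"
proof -
  have "Max ((\<lambda>i. av (f i)) ` I) \<in> (\<lambda>i. av (f i)) ` I" using assms by (intro Max_in) auto
  then obtain j where j: "j \<in> I" "av (f j) = Max ((\<lambda>i. av (f i)) ` I)" by auto
  have pos: "av (f j) > 0" using assms(3)[OF j(1)] by (auto intro: av_pos)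
  have less: "av (sum f (I - {j})) < av (f j)"
  proof (rule av_sum_less)
    fix i assume i: "i \<in> I - {j}"
    show "f i \<in> K" using assms(3) i by auto
    have "av (f i) \<le> av (f j)" unfolding j(2) using assms(1) i by (intro Max_ge) auto
    moreover have "av (f i) \<noteq> av (f j)" using assms(4) i j(1) by (auto simp: inj_on_def)
    ultimately show "av (f i) < av (f j)" by simp
  qed (rule pos)
  have "sum f I = f j + sum f (I - {j})" using assms(1) j(1) by (rule sum.remove)
  moreover have "sum f (I - {j}) \<in> K" using assms(3) by (intro sum_closed) auto
  moreover have "f j \<in> K" using assms(3) j(1) by auto
  ultimately have "av (sum f I) = av (f j)" using av_add_eq[of "f j" "sum f (I - {j})"] less by simp
  then show ?thesis using pos by auto
qed

context padic_abs begin

lemma av_int_eq: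
  assumes "n \<noteq> 0"
  shows "\<exists>k::nat. av (of_int n) = exp (- real k) \<and> int p ^ k dvd n"
proof -
  have nu: "\<not> is_unit (int p)" using prime_p by (metis prime_nat_int_transfer not_prime_unit)
  obtain m where m: "n = int p ^ multiplicity (int p) n * m" "\<not> int p dvd m"
    using multiplicity_decompose'[OF assms nu] .
  have cop: "coprime m (int p)" using m(2) prime_p
    by (metis coprime_commute prime_imp_coprime prime_nat_int_transfer)
  define k where "k = multiplicity (int p) n"
  have e: "of_int n = of_nat p ^ k * (of_int m :: complex)" by (subst m(1)) (simp add: k_def)
  have "av (of_int n) = exp (-1) ^ k"
    unfolding e using av_coprime[OF cop] by (simp add: av_mult av_power av_p power_closed)
  then have "av (of_int n) = exp (- real k)" by (simp add: exp_of_nat_mult[symmetric])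
  moreover have "int p ^ k dvd n" unfolding k_def by (rule multiplicity_dvd)
  ultimately show ?thesis by blast
qed

lemma av_Rats_eq:
  assumes "q \<in> \<rat>" "q \<noteq> 0"
  shows "\<exists>k::int. av q = exp (of_int k)"
proof -
  obtain a b :: int where ab: "b > 0" "q = of_int a / of_int b" using assms(1) by (elim Rats_cases') auto
  obtain k where k: "av (of_int a) = exp (- real k)" using av_int_eq[of a] assms(2) ab by auto
  obtain l where l: "av (of_int b) = exp (- real l)" using av_int_eq[of b] ab by auto
  have "av q = exp (- real k) / exp (- real l)" unfolding ab(2) using k l by (subst av_divide) auto
  also have "\<dots> = exp (of_int (int l - int k))" by (simp add: exp_diff[symmetric])
  finally show ?thesis by blast
qed

lemma av_p_power: "av (of_nat p ^ n) = exp (- real n)"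
  by (simp add: av_power av_p exp_of_nat_mult[symmetric])

end

text \<open>
  For values the classes modulo \<open>N\<close>-th powers are bounded by \<open>N * N\<close>. For units they are bounded by
  \<open>N\<close> if \<open>p > N\<close>, counting in the residue field, and by the number \<open>(p\<^sup>N)\<^bsup>2N+1\<^esup>\<close> of residues modulo
  \<open>p\<^bsup>2N+1\<^esup>\<close> if \<open>p \<le> N\<close>.
\<close>

definition power_classes :: "nat \<Rightarrow> nat" where
  "power_classes N = N * N * (N + (N ^ N) ^ (2 * N + 1))"

text \<open>
  The locale below is applied to the cyclotomic field generated by \<open>\<zeta>\<close>, whose dimension over the
  rational numbers is at most \<open>N\<close>.
\<close>

locale cyclotomic_padic = padic_abs K av p + primitive_root N \<zeta> for K av p N \<zeta> +
  fixes E :: "complex set"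
  assumes span: "K \<subseteq> rat_space.span E" and finite_E: "finite E" and card_E: "card E \<le> N"
begin

section \<open>Values and residues in the cyclotomic field\<close>

definition W where "W = {x \<in> K. av x \<le> 1}"
definition U where "U = {x \<in> K. av x = 1}"

lemma WI: "x \<in> K \<Longrightarrow> av x \<le> 1 \<Longrightarrow> x \<in> W" and WD: "x \<in> W \<Longrightarrow> x \<in> K" "x \<in> W \<Longrightarrow> av x \<le> 1"
  by (auto simp: W_def)

lemma UI: "x \<in> K \<Longrightarrow> av x = 1 \<Longrightarrow> x \<in> U" and UD: "x \<in> U \<Longrightarrow> x \<in> K" "x \<in> U \<Longrightarrow> av x = 1"
  "x \<in> U \<Longrightarrow> x \<noteq> 0"
  by (auto simp: U_def)

lemma relation:
  fixes S :: "complex set"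
  assumes "S \<subseteq> K" "finite S" "card S > N"
  shows "\<exists>u. (\<forall>x. u x \<in> \<rat>) \<and> (\<exists>x\<in>S. u x \<noteq> 0) \<and> (\<Sum>x\<in>S. u x * x) = 0"
  using rat_space_relation[OF finite_E assms(2), of "\<lambda>x. x"] assms span card_E by auto

text \<open>The bound on ramification by the degree: elements whose values differ modulo the values
  of \<rat> are linearly independent over \<rat>.\<close>

lemma value_classes:
  "\<exists>A\<subseteq>K - {0}. finite A \<and> card A \<le> N \<and> (\<forall>x\<in>K - {0}. \<exists>y\<in>A. \<exists>k::int. av x = av y * exp (of_int k))"
proof -
  define R where "R = (\<lambda>x y. \<exists>k::int. av x = av y * exp (of_int k))"
  have "\<exists>S\<subseteq>K - {0}. finite S \<and> card S \<le> N \<and> (\<forall>x\<in>S. \<forall>y\<in>S. x \<noteq> y \<longrightarrow> \<not> R x y) \<and>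
      (\<forall>x\<in>K - {0}. \<exists>y\<in>S. R x y)"
  proof (rule representatives)
    show "R x x" for x unfolding R_def by (rule exI[of _ 0]) simp
    show "R y x" if "R x y" for x y
    proof -
      obtain k :: int where k: "av x = av y * exp (of_int k)" using \<open>R x y\<close> by (auto simp: R_def)
      then have "av y = av x * exp (of_int (- k))" by (simp add: exp_minus)
      then show ?thesis unfolding R_def by blast
    qed
    fix S assume S: "S \<subseteq> K - {0}" "finite S" "\<forall>x\<in>S. \<forall>y\<in>S. x \<noteq> y \<longrightarrow> \<not> R x y"
    show "card S \<le> N"
    proof (rule ccontr)
      assume "\<not> card S \<le> N"
      then obtain u where u: "\<And>x. u x \<in> \<rat>" "\<exists>x\<in>S. u x \<noteq> 0" "(\<Sum>x\<in>S. u x * x) = 0"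
        using relation[of S] S by (auto simp: not_le)
      define I where "I = {x \<in> S. u x \<noteq> 0}"
      have "(\<Sum>x\<in>I. u x * x) = (\<Sum>x\<in>S. u x * x)"
        by (rule sum.mono_neutral_left) (use S in \<open>auto simp: I_def\<close>)
      moreover have "(\<Sum>x\<in>I. u x * x) \<noteq> 0"
      proof (rule sum_nonzero_if_distinct_av)
        show "finite I" "I \<noteq> {}" using S(2) u(2) by (auto simp: I_def)
        show "u x * x \<in> K - {0}" if "x \<in> I" for x using that S(1) u(1)[of x] by (auto simp: I_def)
        show "inj_on (\<lambda>x. av (u x * x)) I"
        proof (rule inj_onI)
          fix x y assume xy: "x \<in> I" "y \<in> I" "av (u x * x) = av (u y * y)"
          obtain k where k: "av (u x) = exp (of_int k)" using av_Rats_eq[OF u(1)[of x]] xy by (auto simp: I_def)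
          obtain l where l: "av (u y) = exp (of_int l)" using av_Rats_eq[OF u(1)[of y]] xy by (auto simp: I_def)
          have "x \<in> K" "y \<in> K" using xy S(1) by (auto simp: I_def)
          then have "exp (of_int k) * av x = exp (of_int l) * av y"
            using xy(3) u(1) k l by (simp add: av_mult)
          then have "av x = av y * exp (of_int (l - k))" by (simp add: exp_diff field_simps)
          then have "R x y" unfolding R_def by (intro exI[of _ "l - k"])
          then show "x = y" using S(3) xy by (auto simp: I_def)
        qed
      qed
      ultimately show False using u(3) by simp
    qed
  qed
  then show ?thesis unfolding R_def by blast
qed

text \<open>Linear independence of the residues in W / p W over the field with p elements, with
  integers as coefficients; |z| \<le> exp (-1) says that z is in p W.\<close>

definition p_independent :: "complex set \<Rightarrow> bool" where
  "p_independent S \<longleftrightarrow> S \<subseteq> W \<and> finite S \<and>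
     (\<forall>n::complex \<Rightarrow> int. av (\<Sum>x\<in>S. of_int (n x) * x) \<le> exp (-1) \<longrightarrow> (\<forall>x\<in>S. int p dvd n x))"

lemma of_int_W: "of_int n * x \<in> K" if "x \<in> W"
  using that by (auto simp: W_def)

text \<open>More than N elements satisfy a rational relation. Scaled so that its largest coefficient
  is 1, it has p-integral coefficients and can be reduced modulo p, where the coefficient 1
  survives.\<close>

lemma card_p_independent:
  assumes "p_independent S"
  shows "card S \<le> N"
proof (rule ccontr)
  assume "\<not> card S \<le> N"
  have S: "S \<subseteq> K" "finite S" using assms by (auto simp: p_independent_def W_def)
  then obtain u where u: "\<And>x. u x \<in> \<rat>" "\<exists>x\<in>S. u x \<noteq> 0" "(\<Sum>x\<in>S. u x * x) = 0"
    using relation[of S] \<open>\<not> card S \<le> N\<close> by (auto simp: not_le)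
  have "Max ((\<lambda>x. av (u x)) ` S) \<in> (\<lambda>x. av (u x)) ` S" using S u(2) by (intro Max_in) auto
  then obtain j where j: "j \<in> S" "av (u j) = Max ((\<lambda>x. av (u x)) ` S)" by auto
  have max: "av (u x) \<le> av (u j)" if "x \<in> S" for x unfolding j(2) using S that by (intro Max_ge) auto
  have uj: "u j \<noteq> 0"
  proof
    assume "u j = 0"
    then have "av (u x) \<le> 0" if "x \<in> S" for x using max[OF that] by simp
    then have "u x = 0" if "x \<in> S" for x
      using that av_pos[of "u x"] u(1)[of x] by (meson Rats_in linorder_not_le)
    then show False using u(2) by auto
  qed
  then have pos: "av (u j) > 0" using u(1)[of j] by (intro av_pos) auto
  define w where "w = (\<lambda>x. u x / u j)"
  have w: "w x \<in> \<rat>" "x \<in> S \<Longrightarrow> av (w x) \<le> 1" for x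
    using u(1) max[of x] pos by (auto simp: w_def av_divide)
  have "\<exists>m::nat. av (w x - of_nat m) < exp (-1)" if "x \<in> S" for x
    by (rule near_nat) (use w that in auto)
  then obtain m :: "complex \<Rightarrow> nat" where m: "\<And>x. x \<in> S \<Longrightarrow> av (w x - of_nat (m x)) < exp (-1)" by metis
  have "(\<Sum>x\<in>S. w x * x) = (\<Sum>x\<in>S. u x * x) / u j"
    by (simp add: w_def sum_divide_distrib)
  then have "(\<Sum>x\<in>S. of_int (int (m x)) * x) = (\<Sum>x\<in>S. - ((w x - of_nat (m x)) * x))"
    using u(3) by (simp add: algebra_simps sum_subtractf)
  moreover have "av (\<Sum>x\<in>S. - ((w x - of_nat (m x)) * x)) \<le> exp (-1)"
  proof (rule av_sum_le)
    fix x assume x: "x \<in> S"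
    have xK: "x \<in> K" "av x \<le> 1" using x assms by (auto simp: p_independent_def W_def)
    have dK: "w x - of_nat (m x) \<in> K" using w(1)[of x] by (intro diff_closed) auto
    show "- ((w x - of_nat (m x)) * x) \<in> K" using dK xK by auto
    have "av (- ((w x - of_nat (m x)) * x)) = av (w x - of_nat (m x)) * av x"
      using dK xK by (simp add: mult_closed av_mult)
    also have "\<dots> \<le> exp (-1) * 1" using m[OF x] xK dK by (intro mult_mono) auto
    finally show "av (- ((w x - of_nat (m x)) * x)) \<le> exp (-1)" by simp
  qed simp
  ultimately have "av (\<Sum>x\<in>S. of_int (int (m x)) * x) \<le> exp (-1)" by simp
  moreover have "av (\<Sum>x\<in>S. of_int (int (m x)) * x) \<le> exp (-1) \<longrightarrow> (\<forall>x\<in>S. int p dvd int (m x))"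
    using assms unfolding p_independent_def by (elim conjE allE[of _ "\<lambda>x. int (m x)"])
  ultimately have "int p dvd int (m j)" using j(1) by blast
  then have "av (of_int (int (m j))) < 1" by (rule av_int_dvd)
  moreover have "av (1 - of_nat (m j)) < 1"
    using m[OF j(1)] uj by (simp add: w_def) (metis exp_less_one_iff less_trans neg_less_0_iff_less zero_less_one)
  ultimately show False using av_eq_if_close[of 1 "of_nat (m j)"] by simp
qed

text \<open>A largest p-independent set S spans W / p W: adding x to S creates a relation, whose
  coefficient at x is invertible modulo p. Coefficients from 0 to p - 1 then represent all
  residues.\<close>

lemma residues_mod_p:
  "\<exists>P\<subseteq>W. finite P \<and> card P \<le> p ^ N \<and> (\<forall>x\<in>W. \<exists>y\<in>P. av (x - y) \<le> exp (-1))"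
proof -
  have "p_independent {}" by (simp add: p_independent_def)
  moreover have "\<forall>S. p_independent S \<longrightarrow> card S \<le> N" using card_p_independent by auto
  ultimately obtain S where S: "p_independent S" "\<And>S'. p_independent S' \<Longrightarrow> card S' \<le> card S"
    using ex_has_greatest_nat[of p_independent "{}" card "Suc N"] by (auto simp: less_Suc_eq_le)
  have SW: "S \<subseteq> W" "finite S" using S(1) by (auto simp: p_independent_def)
  define sm where "sm = (\<lambda>n::complex \<Rightarrow> int. \<Sum>y\<in>S. of_int (n y) * y)"
  have smK: "sm n \<in> K" for n unfolding sm_def using SW of_int_W by auto
  have avW: "av (of_int n * x) \<le> 1" if "x \<in> W" for n x
    using that av_of_int_le[of n] by (auto simp: W_def av_mult mult_le_one)
  have smW: "sm n \<in> W" for n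
    unfolding W_def using smK SW avW of_int_W by (auto simp: sm_def intro!: av_sum_le)
  have smcong: "av (sm n - sm n') \<le> exp (-1)" if d: "\<And>y. y \<in> S \<Longrightarrow> int p dvd n y - n' y" for n n'
  proof -
    have "sm n - sm n' = (\<Sum>y\<in>S. of_int (n y - n' y) * y)"
      by (simp add: sm_def sum_subtractf algebra_simps)
    also have "av \<dots> \<le> exp (-1)"
    proof (rule av_sum_le)
      fix y assume y: "y \<in> S"
      then show "of_int (n y - n' y) * y \<in> K" using SW of_int_W by blast
      obtain c where "n y - n' y = int p * c" using d[OF y] by auto
      then have e: "of_int (n y - n' y) * y = of_nat p * (of_int c * y)" by simp
      have "y \<in> W" using y SW by auto
      then have "av (of_int (n y - n' y) * y) = exp (-1) * av (of_int c * y)"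
        unfolding e using av_mult[of "of_nat p" "of_int c * y"] of_int_W[of y c] av_p by simp
      also have "\<dots> \<le> exp (-1) * 1" using avW[of y c] SW y by (intro mult_left_mono) auto
      finally show "av (of_int (n y - n' y) * y) \<le> exp (-1)" by simp
    qed simp
    finally show ?thesis .
  qed
  have red: "\<exists>n. av (x - sm n) \<le> exp (-1)" if x: "x \<in> W" for x
  proof (cases "x \<in> S")
    case True
    define n where "n = (\<lambda>y. if y = x then 1 else 0 :: int)"
    have "sm n = (\<Sum>y\<in>S. if y = x then x else 0)" unfolding sm_def n_def by (rule sum.cong) auto
    then have "sm n = x" using True SW(2) by simp
    then show ?thesis by (intro exI[of _ n]) simp
  next
    case False
    have xK: "x \<in> K" using x by (rule WD)
    have "\<not> p_independent (insert x S)"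
    proof
      assume "p_independent (insert x S)"
      then have "card (insert x S) \<le> card S" by (rule S(2))
      then show False using False SW(2) by simp
    qed
    then obtain n z where n: "av (\<Sum>y\<in>insert x S. of_int (n y) * y) \<le> exp (-1)"
      "z \<in> insert x S" "\<not> int p dvd n z"
      unfolding p_independent_def using x SW by auto
    have n1: "av (of_int (n x) * x + sm n) \<le> exp (-1)" using n(1) False SW(2) by (simp add: sm_def)
    have "\<not> int p dvd n x"
    proof
      assume dvd: "int p dvd n x"
      then obtain c where "n x = int p * c" by auto
      then have e: "of_int (n x) * x = of_nat p * (of_int c * x)" by simp
      have "av (of_int (n x) * x) = exp (-1) * av (of_int c * x)"
        unfolding e using av_mult[of "of_nat p" "of_int c * x"] of_int_W[OF x, of c] av_p by simp
      also have "\<dots> \<le> exp (-1) * 1" using avW[OF x, of c] by (intro mult_left_mono) auto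
      finally have "av (of_int (n x) * x) \<le> exp (-1)" by simp
      then have "av (sm n) \<le> exp (-1)"
        using av_diff[of "of_int (n x) * x + sm n" "of_int (n x) * x"] n1 smK[of n] of_int_W[OF x, of "n x"]
        by (auto simp: add_closed)
      then have "\<forall>y\<in>S. int p dvd n y" using S(1) by (auto simp: p_independent_def sm_def)
      then show False using n(2,3) dvd by auto
    qed
    then have "coprime (n x) (int p)" using prime_p
      by (metis coprime_commute prime_imp_coprime prime_nat_int_transfer)
    then obtain s t where st: "s * n x + t * int p = 1"
      using bezout_int[of "n x" "int p"] by (auto simp: coprime_iff_gcd_eq_1)
    \<comment> \<open>s is the inverse of the coefficient n x modulo p, so this solves the relation
      for x.\<close>
    define n' where "n' = (\<lambda>y. - s * n y)"
    have sm': "sm n' = - (of_int s * sm n)" by (simp add: sm_def n'_def sum_distrib_left sum_negf mult.assoc)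
    have one: "of_int s * of_int (n x) + of_int t * of_nat p = (1 :: complex)"
      using arg_cong[OF st, of "of_int :: int \<Rightarrow> complex"] by simp
    have "x - sm n' = (of_int s * of_int (n x) + of_int t * of_nat p) * x + of_int s * sm n"
      unfolding one sm' by simp
    also have "\<dots> = of_int s * (of_int (n x) * x + sm n) + of_nat p * (of_int t * x)"
      by (simp add: algebra_simps)
    finally have e: "x - sm n' = of_int s * (of_int (n x) * x + sm n) + of_nat p * (of_int t * x)" .
    have K: "of_int (n x) * x + sm n \<in> K" "of_int t * x \<in> K"
      using smK of_int_W[OF x] by auto
    have "av (of_int s * (of_int (n x) * x + sm n)) \<le> 1 * exp (-1)"
    proof -
      have "av (of_int s * (of_int (n x) * x + sm n)) = av (of_int s) * av (of_int (n x) * x + sm n)"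
        using K by (intro av_mult) auto
      also have "\<dots> \<le> 1 * exp (-1)" using n1 av_of_int_le[of s] av_nonneg[OF K(1)] by (intro mult_mono) auto
      finally show ?thesis .
    qed
    moreover have "av (of_nat p * (of_int t * x)) \<le> exp (-1) * 1"
      using K avW[OF x, of t] by (subst av_mult) (auto simp: av_p)
    ultimately have "av (x - sm n') \<le> exp (-1)"
      unfolding e using av_add[of "of_int s * (of_int (n x) * x + sm n)" "of_nat p * (of_int t * x)"] K
      by (auto simp: mult_closed)
    then show ?thesis by blast
  qed
  define P where "P = sm ` (PiE S (\<lambda>_. {0..<int p}))"
  have finPi: "finite (PiE S (\<lambda>_. {0..<int p}))" using SW(2) by (intro finite_PiE) auto
  show ?thesis
  proof (intro exI[of _ P] conjI ballI)
    show "P \<subseteq> W" "finite P" using smW finPi by (auto simp: P_def)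
    have "card P \<le> card (PiE S (\<lambda>_. {0..<int p}))" unfolding P_def using finPi by (rule card_image_le)
    also have "\<dots> = p ^ card S" using SW(2) by (simp add: card_PiE)
    also have "\<dots> \<le> p ^ N" using card_p_independent[OF S(1)] p_pos by (intro power_increasing) auto
    finally show "card P \<le> p ^ N" .
    fix x assume x: "x \<in> W"
    obtain n where n: "av (x - sm n) \<le> exp (-1)" using red[OF x] by auto
    define n' where "n' = restrict (\<lambda>y. n y mod int p) S"
    have "sm n' \<in> P" unfolding P_def using p_pos by (intro imageI) (auto simp: n'_def PiE_def extensional_def)
    moreover have "av (sm n - sm n') \<le> exp (-1)"
      by (rule smcong) (auto simp: n'_def minus_mod_eq_mult_div)
    then have "av (x - sm n') \<le> exp (-1)"
      using av_diff_trans[of x "sm n" "sm n'"] n smK WD(1)[OF x] by auto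
    ultimately show "\<exists>y\<in>P. av (x - y) \<le> exp (-1)" by blast
  qed
qed

text \<open>Digit by digit: a residue modulo p^(c+1) is a residue modulo p^c plus p^c times a
  residue modulo p.\<close>

lemma residues_mod_p_power:
  "\<exists>P\<subseteq>W. finite P \<and> card P \<le> (p ^ N) ^ c \<and> (\<forall>x\<in>W. \<exists>y\<in>P. av (x - y) \<le> exp (- real c))"
proof (induction c)
  case 0
  have "0 \<in> W" by (simp add: W_def)
  then show ?case by (intro exI[of _ "{0}"]) (auto simp: W_def)
next
  case (Suc c)
  then obtain P where P: "P \<subseteq> W" "finite P" "card P \<le> (p ^ N) ^ c"
    "\<And>x. x \<in> W \<Longrightarrow> \<exists>y\<in>P. av (x - y) \<le> exp (- real c)" by auto
  obtain T where T: "T \<subseteq> W" "finite T" "card T \<le> p ^ N" "\<And>x. x \<in> W \<Longrightarrow> \<exists>y\<in>T. av (x - y) \<le> exp (-1)"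
    using residues_mod_p by auto
  define f where "f = (\<lambda>(y, z). y + of_nat p ^ c * z :: complex)"
  have pK: "of_nat p ^ c \<in> K" by auto
  show ?case
  proof (intro exI[of _ "f ` (P \<times> T)"] conjI ballI)
    show "f ` (P \<times> T) \<subseteq> W"
    proof
      fix w assume "w \<in> f ` (P \<times> T)"
      then obtain y z where yz: "y \<in> W" "z \<in> W" "w = y + of_nat p ^ c * z" using P(1) T(1) by (auto simp: f_def)
      have "av (of_nat p ^ c * z) = exp (- real c) * av z"
        using yz pK av_p_power[of c] by (simp add: av_mult WD)
      also have "\<dots> \<le> 1 * 1" using yz WD by (intro mult_mono) auto
      finally have le: "av (of_nat p ^ c * z) \<le> 1" by simp
      have zK: "of_nat p ^ c * z \<in> K" using WD(1)[OF yz(2)] pK by (intro mult_closed)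
      show "w \<in> W" unfolding yz(3) using yz(1) le zK av_add[of y "of_nat p ^ c * z"]
        by (intro WI) (auto simp: W_def)
    qed
    show "finite (f ` (P \<times> T))" using P T by auto
    have "card (f ` (P \<times> T)) \<le> card P * card T"
      using P(2) T(2) card_image_le[of "P \<times> T" f] by (simp add: card_cartesian_product)
    also have "\<dots> \<le> (p ^ N) ^ c * p ^ N" using P(3) T(3) by (rule mult_le_mono)
    finally show "card (f ` (P \<times> T)) \<le> (p ^ N) ^ Suc c" by (simp add: mult.commute)
    fix x assume x: "x \<in> W"
    obtain y where y: "y \<in> P" "av (x - y) \<le> exp (- real c)" using P(4)[OF x] by auto
    have K: "x \<in> K" "y \<in> K" "x - y \<in> K" using x y(1) P(1) WD by (auto intro!: diff_closed)
    define z where "z = (x - y) / of_nat p ^ c"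
    have zK: "z \<in> K" unfolding z_def using K pK by auto
    have "av z = av (x - y) / exp (- real c)" unfolding z_def using K pK av_p_power[of c] by (simp add: av_divide)
    then have "z \<in> W" using y(2) zK by (intro WI) (auto simp: divide_le_eq)
    then obtain t where t: "t \<in> T" "av (z - t) \<le> exp (-1)" using T(4) by auto
    have tK: "t \<in> K" using t(1) T(1) WD by auto
    have "x - f (y, t) = of_nat p ^ c * (z - t)" using p_pos by (simp add: f_def z_def field_simps)
    then have "av (x - f (y, t)) = exp (- real c) * av (z - t)"
      using pK zK tK av_p_power[of c] by (simp add: av_mult diff_closed)
    also have "\<dots> \<le> exp (- real c) * exp (-1)" using t(2) by (intro mult_left_mono) auto
    also have "\<dots> = exp (- real (Suc c))" by (simp add: exp_add[symmetric])
    finally show "\<exists>y\<in>f ` (P \<times> T). av (x - y) \<le> exp (- real (Suc c))" using y(1) t(1) by blast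
  qed
qed

text \<open>A polynomial of degree N has at most N roots in the residue field. Lifted: at N + 1
  points with unit differences, interpolation would write the leading coefficient 1 of X^N - a as a
  sum of terms of absolute value less than 1.\<close>

lemma card_approx_roots:
  assumes "F \<subseteq> K" "finite F" "\<And>t t'. t \<in> F \<Longrightarrow> t' \<in> F \<Longrightarrow> t \<noteq> t' \<Longrightarrow> av (t - t') = 1"
    and "a \<in> K" "\<And>t. t \<in> F \<Longrightarrow> av (t ^ N - a) < 1"
  shows "card F \<le> N"
proof (rule ccontr)
  assume "\<not> card F \<le> N"
  then obtain Y where Y: "Y \<subseteq> F" "finite Y" "card Y = Suc N"
    using obtain_subset_with_card_n[of "Suc N" F] assms(2) finite_subset by (metis not_less_eq_eq)
  define q where "q = monom 1 N - [:a:]"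
  have cq: "coeff q N = 1" using N_pos by (simp add: q_def coeff_pCons split: nat.splits)
  have "degree q \<le> N" unfolding q_def by (intro degree_diff_le degree_monom_le) auto
  then have "q = (\<Sum>y\<in>Y. smult (poly q y) (lagrange_basis Y y))"
    using Y by (intro lagrange_interpolation) auto
  from arg_cong[OF this, of "\<lambda>q. coeff q N"]
  have s: "1 = (\<Sum>y\<in>Y. poly q y * coeff (lagrange_basis Y y) N)" unfolding cq by (simp add: coeff_sum)
  have "av (\<Sum>y\<in>Y. poly q y * coeff (lagrange_basis Y y) N) < 1"
  proof (rule av_sum_less)
    fix y assume y: "y \<in> Y"
    have YK: "Y \<subseteq> K" using Y(1) assms(1) by auto
    have lK: "coeff (lagrange_basis Y y) N \<in> K" using lagrange_basis_over[OF YK y] by (rule coeff_polys_over)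
    have pq: "poly q y = y ^ N - a" by (simp add: q_def poly_monom)
    have pK: "poly q y \<in> K" unfolding pq using y YK assms(4) by auto
    show "poly q y * coeff (lagrange_basis Y y) N \<in> K" using pK lK by auto
    have "degree (\<Prod>y'\<in>Y - {y}. [:- y', 1:]) = N"
      using degree_prod_eq_sum_degree[of "Y - {y}" "\<lambda>y'. [:- y', 1:]"] Y y by simp
    moreover have "lead_coeff (\<Prod>y'\<in>Y - {y}. [:- y', 1:]) = 1"
      by (simp add: lead_coeff_prod)
    ultimately have "coeff (\<Prod>y'\<in>Y - {y}. [:- y', 1:]) N = 1" by simp
    then have "coeff (lagrange_basis Y y) N = inverse (\<Prod>y'\<in>Y - {y}. y - y')"
      by (simp add: lagrange_basis_def)
    moreover have "av (\<Prod>y'\<in>Y - {y}. y - y') = 1"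
    proof -
      have "av (\<Prod>y'\<in>Y - {y}. y - y') = (\<Prod>y'\<in>Y - {y}. av (y - y'))"
        using YK y by (intro av_prod diff_closed) auto
      also have "\<dots> = 1" using assms(3) Y(1) y by (intro prod.neutral) auto
      finally show ?thesis .
    qed
    moreover have "(\<Prod>y'\<in>Y - {y}. y - y') \<in> K" using YK y by (intro prod_closed diff_closed) auto
    ultimately have "av (coeff (lagrange_basis Y y) N) = 1" by (simp add: av_inverse)
    then show "av (poly q y * coeff (lagrange_basis Y y) N) < 1"
      using assms(5)[of y] y Y(1) pK lK by (auto simp: av_mult pq)
  qed simp
  then show False using s av_1 by simp
qed

section \<open>Units modulo approximate N-th powers\<close>

lemma U_mult: "u \<in> U \<Longrightarrow> w \<in> U \<Longrightarrow> u * w \<in> U"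
  by (auto simp: U_def av_mult)

lemma U_power: "u \<in> U \<Longrightarrow> u ^ n \<in> U"
  by (auto simp: U_def av_power)

lemma U_divide: "u \<in> U \<Longrightarrow> w \<in> U \<Longrightarrow> u / w \<in> U"
  by (auto simp: U_def av_divide)

lemma av_quotient_minus_1:
  assumes "u \<in> K" "w \<in> U"
  shows "av (u / w - 1) = av (u - w)"
proof -
  have "u / w - 1 = (u - w) / w" using UD(3)[OF assms(2)] by (simp add: field_simps)
  then show ?thesis using assms UD[OF assms(2)] by (simp add: av_divide diff_closed)
qed

text \<open>The count of residues is transferred from W to U, with representatives that are
  themselves units.\<close>

lemma unit_residues:
  "\<exists>T\<subseteq>U. finite T \<and> card T \<le> (p ^ N) ^ c \<and>
     (\<forall>x\<in>T. \<forall>y\<in>T. x \<noteq> y \<longrightarrow> \<not> av (x - y) \<le> exp (- real c)) \<and> (\<forall>x\<in>U. \<exists>y\<in>T. av (x - y) \<le> exp (- real c))"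
proof (rule representatives)
  show "av (x - x) \<le> exp (- real c)" for x by simp
  show "av (y - x) \<le> exp (- real c)" if "x \<in> U" "y \<in> U" "av (x - y) \<le> exp (- real c)" for x y
    using that UD av_diff_commute by metis
  fix S assume S: "S \<subseteq> U" "finite S" "\<forall>x\<in>S. \<forall>y\<in>S. x \<noteq> y \<longrightarrow> \<not> av (x - y) \<le> exp (- real c)"
  obtain P where P: "P \<subseteq> W" "finite P" "card P \<le> (p ^ N) ^ c"
    "\<And>x. x \<in> W \<Longrightarrow> \<exists>y\<in>P. av (x - y) \<le> exp (- real c)" using residues_mod_p_power[of c] by auto
  have "\<exists>y\<in>P. av (x - y) \<le> exp (- real c)" if "x \<in> S" for x
    using that S(1) by (intro P(4)) (auto simp: U_def W_def)
  then obtain f where f: "\<And>x. x \<in> S \<Longrightarrow> f x \<in> P" "\<And>x. x \<in> S \<Longrightarrow> av (x - f x) \<le> exp (- real c)" by metis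
  have "inj_on f S"
  proof (rule inj_onI)
    fix x y assume xy: "x \<in> S" "y \<in> S" "f x = f y"
    have K: "x \<in> K" "y \<in> K" "f x \<in> K" using xy(1,2) S(1) f(1) P(1) UD WD by blast+
    have "av (x - y) \<le> max (av (x - f x)) (av (f x - y))" using K by (intro av_diff_trans)
    also have "\<dots> \<le> exp (- real c)" using f(2)[OF xy(1)] f(2)[OF xy(2)] xy(3) K av_diff_commute[of "f x" y] by auto
    finally show "x = y" using S(3) xy by auto
  qed
  then have "card S \<le> card P" using f(1) P(2) by (intro card_inj_on_le) auto
  then show "card S \<le> (p ^ N) ^ c" using P(3) by simp
qed

text \<open>The bound |N|^2 is the threshold for Newton's method applied to X^N - a at 1, whose
  derivative there is N. Below it, u / w is an N-th power in the completion.\<close>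

definition approx_power :: "complex \<Rightarrow> complex \<Rightarrow> bool" where
  "approx_power u w \<longleftrightarrow> (\<exists>t\<in>U. av (u / (w * t ^ N) - 1) < (av (of_nat N))\<^sup>2)"

lemma one_U: "1 \<in> U"
  by (simp add: U_def)

lemma N_K: "of_nat N \<in> K" "of_nat N \<noteq> (0::complex)" "av (of_nat N) > 0"
  using N_pos by (auto intro: av_pos)

lemma approx_power_iff:
  assumes "u \<in> U" "w \<in> U"
  shows "approx_power u w \<longleftrightarrow> (\<exists>t\<in>U. av (u - w * t ^ N) < (av (of_nat N))\<^sup>2)"
  unfolding approx_power_def
  using av_quotient_minus_1[OF UD(1)[OF assms(1)] U_mult[OF assms(2) U_power]] by auto

lemma av_unit_mult: "t \<in> U \<Longrightarrow> x \<in> K \<Longrightarrow> av (x * t) = av x"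
  by (simp add: av_mult UD)

text \<open>If |N| = exp (-k), then 2^k \<le> p^k \<le> N, so k \<le> N. Precision 2 * N + 1 thus
  exceeds 2 * k, the exponent of |N|^2, and units congruent to that precision are in one
  class.\<close>

lemma approx_power_small_p:
  assumes "p \<le> N"
  shows "\<exists>Y\<subseteq>U. finite Y \<and> card Y \<le> (N ^ N) ^ (2 * N + 1) \<and> (\<forall>u\<in>U. \<exists>w\<in>Y. approx_power u w)"
proof -
  define c where "c = 2 * N + 1"
  obtain T where T: "T \<subseteq> U" "finite T" "card T \<le> (p ^ N) ^ c" "\<And>x. x \<in> U \<Longrightarrow> \<exists>y\<in>T. av (x - y) \<le> exp (- real c)"
    using unit_residues[of c] by auto
  have "(p ^ N) ^ c \<le> (N ^ N) ^ c" using assms by (intro power_mono) auto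
  then have "card T \<le> (N ^ N) ^ (2 * N + 1)" using T(3) by (simp add: c_def)
  moreover have "approx_power u w" if u: "u \<in> U" and w: "w \<in> U" "av (u - w) \<le> exp (- real c)" for u w
  proof -
    obtain k where k: "av (of_int (int N)) = exp (- real k)" "int p ^ k dvd int N"
      using av_int_eq[of "int N"] N_pos by auto
    have "p ^ k dvd N" using k(2) by (metis of_nat_dvd_iff of_nat_power)
    then have "p ^ k \<le> N" using N_pos by (auto dest: dvd_imp_le)
    moreover have "k < 2 ^ k" by (rule less_exp)
    moreover have "2 ^ k \<le> p ^ k" using prime_ge_2_nat[OF prime_p] by (intro power_mono) auto
    ultimately have "k \<le> N" by linarith
    have "exp (- real c) < exp (- real k) ^ 2"
      using \<open>k \<le> N\<close> by (simp add: exp_of_nat_mult[symmetric] c_def power2_eq_square exp_add[symmetric])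
    then have "av (u - w * 1 ^ N) < (av (of_nat N))\<^sup>2" using w(2) k(1) by simp
    then show ?thesis unfolding approx_power_iff[OF u w(1)] using one_U by blast
  qed
  ultimately show ?thesis using T by (intro exI[of _ T]) (auto simp: subset_iff, blast)
qed

text \<open>Here |N| = 1, and classes are visible in the residue field. Taking N-th powers of unit
  residues has fibres of size at most N, so each class holds at least the fraction 1/N of them;
  disjoint classes number at most N.\<close>

lemma approx_power_large_p:
  assumes "p > N"
  shows "\<exists>Y\<subseteq>U. finite Y \<and> card Y \<le> N \<and> (\<forall>u\<in>U. \<exists>w\<in>Y. approx_power u w)"
proof -
  have "\<not> int p dvd int N" using assms N_pos by (auto dest: dvd_imp_le)
  then have "coprime (int N) (int p)" using prime_p
    by (metis coprime_commute prime_imp_coprime prime_nat_int_transfer)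
  then have aN: "av (of_nat N) = 1" using av_coprime[of "int N"] by simp
  have apw: "approx_power u w \<longleftrightarrow> (\<exists>t\<in>U. av (u - w * t ^ N) < 1)" if "u \<in> U" "w \<in> U" for u w
    using approx_power_iff[OF that] aN by simp
  have tr: "av (x - z) < 1" if "x \<in> K" "y \<in> K" "z \<in> K" "av (x - y) < 1" "av (y - z) < 1" for x y z
    using av_diff_trans[OF that(1-3)] that(4,5) by auto
  have "\<exists>Y\<subseteq>U. finite Y \<and> card Y \<le> (p ^ N) ^ 1 \<and> (\<forall>x\<in>Y. \<forall>y\<in>Y. x \<noteq> y \<longrightarrow> \<not> av (x - y) < 1) \<and>
      (\<forall>x\<in>U. \<exists>y\<in>Y. av (x - y) < 1)"
  proof (rule representatives)
    show "av (x - x) < 1" for x by simp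
    show "av (y - x) < 1" if "x \<in> U" "y \<in> U" "av (x - y) < 1" for x y
      using that UD av_diff_commute by metis
    fix S assume S: "S \<subseteq> U" "finite S" "\<forall>x\<in>S. \<forall>y\<in>S. x \<noteq> y \<longrightarrow> \<not> av (x - y) < 1"
    obtain P where P: "P \<subseteq> U" "finite P" "card P \<le> (p ^ N) ^ 1" "\<And>x. x \<in> U \<Longrightarrow> \<exists>y\<in>P. av (x - y) \<le> exp (- real 1)"
      using unit_residues[of 1] by auto
    have "\<exists>y\<in>P. av (x - y) \<le> exp (- real 1)" if "x \<in> S" for x using that S(1) P(4) by auto
    then obtain f where f: "\<And>x. x \<in> S \<Longrightarrow> f x \<in> P" "\<And>x. x \<in> S \<Longrightarrow> av (x - f x) \<le> exp (- real 1)" by metis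
    have lt: "exp (- real 1) < (1::real)" by simp
    have "inj_on f S"
    proof (rule inj_onI)
      fix x y assume xy: "x \<in> S" "y \<in> S" "f x = f y"
      have K: "x \<in> K" "y \<in> K" "f x \<in> K" using xy(1,2) S(1) f(1) P(1) UD by blast+
      have "av (x - f x) < 1" "av (y - f y) < 1"
        using f(2)[OF xy(1)] f(2)[OF xy(2)] lt by (blast intro: le_less_trans)+
      then have "av (x - f x) < 1" "av (f x - y) < 1"
        using xy(3) K av_diff_commute[of "f x" y] by auto
      then have "av (x - y) < 1" using tr K by blast
      then show "x = y" using S(3) xy by auto
    qed
    then have "card S \<le> card P" using f(1) P(2) by (intro card_inj_on_le) auto
    then show "card S \<le> (p ^ N) ^ 1" using P(3) by simp
  qed
  then obtain T where T: "T \<subseteq> U" "finite T" "\<And>x y. x \<in> T \<Longrightarrow> y \<in> T \<Longrightarrow> x \<noteq> y \<Longrightarrow> \<not> av (x - y) < 1"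
    "\<And>x. x \<in> U \<Longrightarrow> \<exists>y\<in>T. av (x - y) < 1"
    by auto
  have TK: "T \<subseteq> K" using T(1) UD by auto
  have diff1: "av (x - y) = 1" if "x \<in> T" "y \<in> T" "x \<noteq> y" for x y
  proof -
    have "x \<in> K" "y \<in> K" "av x = 1" "av y = 1" using that T(1) UD by auto
    then have "av (x - y) \<le> 1" using av_diff[of x y] by simp
    then show ?thesis using T(3)[OF that] by simp
  qed
  obtain z where "z \<in> T" using T(4)[OF one_U] by auto
  then have cT: "card T > 0" using T(2) card_gt_0_iff by blast
  have "\<exists>Y\<subseteq>U. finite Y \<and> card Y \<le> N \<and> (\<forall>x\<in>Y. \<forall>y\<in>Y. x \<noteq> y \<longrightarrow> \<not> approx_power x y) \<and> (\<forall>x\<in>U. \<exists>y\<in>Y. approx_power x y)"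
  proof (rule representatives)
    show "approx_power x x" if "x \<in> U" for x
      unfolding apw[OF that that] using one_U by (intro bexI[of _ 1]) auto
    show "approx_power y x" if xy: "x \<in> U" "y \<in> U" "approx_power x y" for x y
    proof -
      obtain t where t: "t \<in> U" "av (x - y * t ^ N) < 1" using xy apw by auto
      have K: "x \<in> K" "y \<in> K" "t ^ N \<in> K" using xy t(1) UD by auto
      have tU: "inverse (t ^ N) \<in> U" using U_divide[OF one_U U_power[OF t(1)], of N] by (simp add: inverse_eq_divide)
      have "y - x * inverse t ^ N = (y * t ^ N - x) * inverse (t ^ N)"
        using UD(3)[OF t(1)] by (simp add: field_simps)
      then have "av (y - x * inverse t ^ N) = av (y * t ^ N - x)"
        using av_unit_mult[OF tU, of "y * t ^ N - x"] K by (simp add: diff_closed mult_closed)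
      also have "\<dots> < 1" using t(2) av_diff_commute[of x "y * t ^ N"] K by (simp add: mult_closed)
      finally show ?thesis unfolding apw[OF xy(2,1)] using U_divide[OF one_U t(1)]
        by (intro bexI[of _ "inverse t"]) (auto simp: inverse_eq_divide)
    qed
    fix S assume S: "S \<subseteq> U" "finite S" "\<forall>x\<in>S. \<forall>y\<in>S. x \<noteq> y \<longrightarrow> \<not> approx_power x y"
    \<comment> \<open>P b is the set of unit residues in the class of b, expressed by the
      representatives T.\<close>
    define P where "P = (\<lambda>b. {y \<in> T. \<exists>t\<in>T. av (y - b * t ^ N) < 1})"
    have finP: "finite (P b)" for b using T(2) by (simp add: P_def)
    have big: "card T \<le> N * card (P b)" if b: "b \<in> S" for b
    proof -
      have bU: "b \<in> U" using b S by auto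
      have "\<exists>y\<in>T. av (b * t ^ N - y) < 1" if "t \<in> T" for t
        using that T(1) U_mult[OF bU U_power] by (intro T(4)) auto
      then obtain r where r: "\<And>t. t \<in> T \<Longrightarrow> r t \<in> T" "\<And>t. t \<in> T \<Longrightarrow> av (b * t ^ N - r t) < 1" by metis
      have r': "av (r t - b * t ^ N) < 1" if "t \<in> T" for t
      proof -
        have "b * t ^ N \<in> K" "r t \<in> K" using bU that TK r(1)[OF that] UD by auto
        then show ?thesis using r(2)[OF that] av_diff_commute by metis
      qed
      have "r ` T \<subseteq> P b" using r(1) r' by (auto simp: P_def)
      have "card T \<le> (\<Sum>y\<in>P b. card {t \<in> T. r t = y})"
      proof -
        have "T = (\<Union>y\<in>P b. {t \<in> T. r t = y})" using \<open>r ` T \<subseteq> P b\<close> by auto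
        then have "card T = card (\<Union>y\<in>P b. {t \<in> T. r t = y})" by simp
        also have "\<dots> \<le> (\<Sum>y\<in>P b. card {t \<in> T. r t = y})" using finP by (rule card_UN_le)
        finally show ?thesis .
      qed
      also have "\<dots> \<le> (\<Sum>y\<in>P b. N)"
      proof (rule sum_mono)
        fix y assume y: "y \<in> P b"
        show "card {t \<in> T. r t = y} \<le> N"
        proof (rule card_approx_roots[where a = "y / b"])
          have yU: "y \<in> U" using y T(1) by (auto simp: P_def)
          show "y / b \<in> K" using yU bU UD by auto
          fix t assume "t \<in> {t \<in> T. r t = y}"
          then have t: "t \<in> T" "av (b * t ^ N - y) < 1" using r(2) by auto
          have K: "t \<in> K" "b * t ^ N - y \<in> K" using t TK bU yU UD by auto
          have "t ^ N - y / b = (b * t ^ N - y) / b" using UD(3)[OF bU] by (simp add: field_simps)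
          then show "av (t ^ N - y / b) < 1" using t(2) K UD[OF bU] by (simp add: av_divide)
        qed (use T(2) TK diff1 in auto)
      qed
      finally show ?thesis by (simp add: mult.commute)
    qed
    \<comment> \<open>A common residue of b t^N and b' t'^N makes b / b' the N-th power of t' / t up
      to a small error.\<close>
    have disj: "P b \<inter> P b' = {}" if bb: "b \<in> S" "b' \<in> S" "b \<noteq> b'" for b b'
    proof (rule ccontr)
      assume "P b \<inter> P b' \<noteq> {}"
      then obtain y t t' where y: "y \<in> T" "t \<in> T" "t' \<in> T" "av (y - b * t ^ N) < 1" "av (y - b' * t' ^ N) < 1"
        by (auto simp: P_def)
      have U: "b \<in> U" "b' \<in> U" "t \<in> U" "t' \<in> U" using bb S(1) y T(1) by auto
      have K: "b * t ^ N \<in> K" "b' * t' ^ N \<in> K" "y \<in> K" using U y TK UD by auto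
      have "av (b * t ^ N - y) < 1" using y(4) K av_diff_commute by metis
      then have 1: "av (b * t ^ N - b' * t' ^ N) < 1" using tr[OF K(1,3,2)] y(5) by simp
      have tU: "inverse (t ^ N) \<in> U" using U_divide[OF one_U U_power[OF U(3)], of N] by (simp add: inverse_eq_divide)
      have "b - b' * (t' / t) ^ N = (b * t ^ N - b' * t' ^ N) * inverse (t ^ N)"
        using UD(3)[OF U(3)] by (simp add: field_simps)
      then have "av (b - b' * (t' / t) ^ N) = av (b * t ^ N - b' * t' ^ N)"
        using av_unit_mult[OF tU, of "b * t ^ N - b' * t' ^ N"] K by (simp add: diff_closed)
      then have "av (b - b' * (t' / t) ^ N) < 1" using 1 by simp
      then have "approx_power b b'" unfolding apw[OF U(1,2)] using U_divide[OF U(4,3)] by blast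
      then show False using S(3) bb by auto
    qed
    have "card S * card T = (\<Sum>b\<in>S. card T)" by simp
    also have "\<dots> \<le> (\<Sum>b\<in>S. N * card (P b))" using big by (intro sum_mono)
    also have "\<dots> = N * (\<Sum>b\<in>S. card (P b))" by (simp add: sum_distrib_left)
    also have "(\<Sum>b\<in>S. card (P b)) = card (\<Union>b\<in>S. P b)"
      using S(2) finP disj by (intro card_UN_disjoint[symmetric]) auto
    also have "\<dots> \<le> card T" using T(2) by (intro card_mono) (auto simp: P_def)
    finally show "card S \<le> N" using cT by simp
  qed
  then show ?thesis by blast
qed

lemma approx_power_units:
  "\<exists>Y\<subseteq>U. finite Y \<and> card Y \<le> N + (N ^ N) ^ (2 * N + 1) \<and> (\<forall>u\<in>U. \<exists>w\<in>Y. approx_power u w)"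
proof (cases "p \<le> N")
  case True
  then show ?thesis using approx_power_small_p by (meson trans_le_add2)
next
  case False
  then show ?thesis using approx_power_large_p by (meson not_le trans_le_add1)
qed

text \<open>Write a as a representative of its value class times a power of p times a unit. The
  power of p counts modulo N, which explains the three factors of
  \<open>power_classes\<close>.\<close>

lemma approx_power_classes:
  "\<exists>B\<subseteq>K - {0}. finite B \<and> card B \<le> power_classes N \<and>
    (\<forall>a\<in>K - {0}. \<exists>b\<in>B. \<exists>t\<in>K - {0}. av (a / (b * t ^ N) - 1) < (av (of_nat N))\<^sup>2)"
proof -
  obtain A where A: "A \<subseteq> K - {0}" "finite A" "card A \<le> N"
    "\<And>x. x \<in> K - {0} \<Longrightarrow> \<exists>y\<in>A. \<exists>k::int. av x = av y * exp (of_int k)" using value_classes by auto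
  obtain Y where Y: "Y \<subseteq> U" "finite Y" "card Y \<le> N + (N ^ N) ^ (2 * N + 1)"
    "\<And>u. u \<in> U \<Longrightarrow> \<exists>w\<in>Y. approx_power u w" using approx_power_units by auto
  define f where "f = (\<lambda>((y, k), w). y * of_nat p ^ k * w :: complex)"
  define B where "B = f ` ((A \<times> {..<N}) \<times> Y)"
  have p0: "of_nat p \<noteq> (0::complex)" using p_pos by simp
  show ?thesis
  proof (intro exI[of _ B] conjI ballI)
    show "finite B" using A(2) Y(2) by (auto simp: B_def)
    show "B \<subseteq> K - {0}"
    proof
      fix b assume "b \<in> B"
      then obtain y k w where b: "y \<in> A" "w \<in> Y" "b = y * of_nat p ^ k * w" by (auto simp: B_def f_def)
      then have "y \<in> K" "y \<noteq> 0" "w \<in> U" using A(1) Y(1) by auto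
      then have "y \<in> K" "y \<noteq> 0" "w \<in> K" "w \<noteq> 0" using UD by auto
      then show "b \<in> K - {0}" using b(3) p0 by (auto intro!: mult_closed power_closed)
    qed
    have "card B \<le> card ((A \<times> {..<N}) \<times> Y)" unfolding B_def using A(2) Y(2) by (intro card_image_le) auto
    also have "\<dots> = card A * N * card Y" by (simp add: card_cartesian_product)
    also have "\<dots> \<le> N * N * (N + (N ^ N) ^ (2 * N + 1))" using A(3) Y(3) by (intro mult_le_mono) auto
    finally show "card B \<le> power_classes N" by (simp add: power_classes_def)
    fix a assume a: "a \<in> K - {0}"
    then obtain y j where y: "y \<in> A" "av a = av y * exp (of_int j)" using A(4) by blast
    have yK: "y \<in> K" "y \<noteq> 0" "av y > 0" using y(1) A(1) by (auto intro: av_pos)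
    \<comment> \<open>Division with remainder gives -j = k + N * i: the factor p^k goes into b,
      while p^i goes into the base of the N-th power.\<close>
    define k where "k = nat ((- j) mod int N)"
    define i where "i = (- j) div int N"
    have k: "k < N" "int k + int N * i = - j" using N_pos by (auto simp: k_def i_def nat_less_iff)
    have pw: "of_nat p powi n \<in> K" "av (of_nat p powi n) = exp (- of_int n)" for n
      by (auto simp: power_int_def av_power av_inverse av_p exp_of_nat_mult[symmetric] exp_minus
          power_inverse intro!: power_closed inverse_closed)
    define u where "u = a / (y * of_nat p powi (- j))"
    have uK: "u \<in> K" unfolding u_def using a yK pw by auto
    have "av u = av a / (av y * exp (of_int j))" unfolding u_def using a yK pw
      by (simp add: av_divide av_mult mult_closed)
    then have "u \<in> U" using y(2) yK uK by (intro UI) auto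
    then obtain w t where w: "w \<in> Y" "t \<in> U" "av (u / (w * t ^ N) - 1) < (av (of_nat N))\<^sup>2"
      using Y(4)[OF \<open>u \<in> U\<close>] unfolding approx_power_def by blast
    define b where "b = y * of_nat p ^ k * w"
    define t' where "t' = of_nat p powi i * t"
    have "t' \<in> K - {0}" unfolding t'_def using pw UD[OF w(2)] p0 by auto
    moreover have "b \<in> B" unfolding B_def b_def using y(1) w(1) k(1)
      by (intro image_eqI[of _ _ "((y, k), w)"]) (auto simp: f_def)
    moreover have "a / (b * t' ^ N) = u / (w * t ^ N)"
    proof -
      have "of_nat p ^ k * (of_nat p powi i) ^ N = (of_nat p powi (int k + int N * i) :: complex)"
        using p0 by (simp add: power_int_add power_int_power' mult.commute)
      then have "b * t' ^ N = y * of_nat p powi (- j) * (w * t ^ N)"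
        unfolding b_def t'_def k(2) power_mult_distrib by (simp add: ac_simps)
      then show ?thesis by (simp add: u_def)
    qed
    ultimately show "\<exists>b\<in>B. \<exists>t\<in>K - {0}. av (a / (b * t ^ N) - 1) < (av (of_nat N))\<^sup>2"
      using w(3) by (intro bexI[of _ b] bexI[of _ t']) auto
  qed
qed

subsection \<open>Newton iteration for roots\<close>

lemma power_expansion:
  assumes "s \<in> W" "h \<in> W"
  shows "\<exists>q\<in>W. (s + h) ^ Suc n = s ^ Suc n + of_nat (Suc n) * s ^ n * h + h\<^sup>2 * q"
proof (induction n)
  case 0
  have "0 \<in> W" by (simp add: W_def)
  then show ?case by (intro bexI[of _ 0]) auto
next
  case (Suc n)
  then obtain q where q: "q \<in> W" "(s + h) ^ Suc n = s ^ Suc n + of_nat (Suc n) * s ^ n * h + h\<^sup>2 * q" by auto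
  have mW: "x * y \<in> W" if "x \<in> W" "y \<in> W" for x y using that by (auto simp: W_def av_mult mult_le_one)
  have aW: "x + y \<in> W" if "x \<in> W" "y \<in> W" for x y using that av_add[of x y] by (auto simp: W_def)
  have nW: "of_nat m \<in> W" for m using av_of_nat_le by (simp add: W_def)
  have pW: "s ^ m \<in> W" for m by (induction m) (use assms mW nW[of 1] in auto)
  have "(s + h) ^ Suc (Suc n) = (s + h) * (s ^ Suc n + of_nat (Suc n) * s ^ n * h + h\<^sup>2 * q)"
    using q(2) by simp
  also have "\<dots> = s ^ Suc (Suc n) + of_nat (Suc (Suc n)) * s ^ Suc n * h +
      h\<^sup>2 * (s * q + of_nat (Suc n) * s ^ n + h * q)"
    by (simp add: algebra_simps power2_eq_square)
  finally have "(s + h) ^ Suc (Suc n) = s ^ Suc (Suc n) + of_nat (Suc (Suc n)) * s ^ Suc n * h +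
      h\<^sup>2 * (s * q + of_nat (Suc n) * s ^ n + h * q)" .
  moreover have "s * q + of_nat (Suc n) * s ^ n + h * q \<in> W"
    by (intro aW mW nW pW assms q(1))
  ultimately show ?case by blast
qed

text \<open>Newton's step s - (s^N - a) / (N s^(N-1)), started at 1. The field is not complete, so
  instead of a root it yields arbitrarily good approximate roots.\<close>

lemma newton_root:
  assumes "a \<in> K" "av (a - 1) < (av (of_nat N))\<^sup>2" "e > 0"
  shows "\<exists>s\<in>U. av (s ^ N - a) < e"
proof -
  define v where "v = av (of_nat N)"
  have v: "v > 0" "v \<le> 1" using N_K(3) av_of_nat_le by (auto simp: v_def)
  define d where "d = av (a - 1)"
  have d: "d < v\<^sup>2" "0 \<le> d" using assms by (auto simp: d_def v_def diff_closed)
  \<comment> \<open>The quadratic error term is |g|^2 / v^2, and |g| \<le> d throughout; so each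
    step contracts the error by at least this factor.\<close>
  define r where "r = d / v\<^sup>2"
  have r: "0 \<le> r" "r < 1" using d v by (auto simp: r_def divide_less_eq)
  have step: "\<exists>s\<in>U. av (s ^ N - a) \<le> d * r ^ n" for n
  proof (induction n)
    case 0
    have "av (1 ^ N - a) = d" unfolding d_def using assms(1) av_diff_commute[of 1 a] by simp
    then show ?case using one_U by (intro bexI[of _ 1]) auto
  next
    case (Suc n)
    then obtain s where s: "s \<in> U" "av (s ^ N - a) \<le> d * r ^ n" by auto
    define g where "g = s ^ N - a"
    have sK: "s \<in> K" "av s = 1" "s \<noteq> 0" using s(1) UD by auto
    have gK: "g \<in> K" unfolding g_def using sK assms(1) by auto
    obtain M where M: "N = Suc M" using N_pos by (cases N) auto
    define c where "c = of_nat N * s ^ M"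
    have c: "c \<in> K" "c \<noteq> 0" "av c = v" using sK N_K by (auto simp: c_def av_mult av_power power_closed v_def)
    define h where "h = - (g / c)"
    have hK: "h \<in> K" unfolding h_def using gK c by auto
    have avh: "av h = av g / v" unfolding h_def using gK c by (simp add: divide_closed av_divide)
    have "d * r ^ n \<le> d * 1" using d r by (intro mult_left_mono power_le_one) auto
    then have gd: "av g \<le> d" using s(2) by (simp add: g_def)
    then have "av h \<le> d / v" unfolding avh using v by (intro divide_right_mono) auto
    also have "d / v < v" using d(1) v(1) by (simp add: divide_less_eq power2_eq_square)
    finally have h1: "av h < 1" using v(2) by simp
    have "s \<in> W" "h \<in> W" using sK hK h1 by (auto simp: W_def)
    then obtain q where q: "q \<in> W" "(s + h) ^ N = s ^ N + of_nat N * s ^ M * h + h\<^sup>2 * q"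
      using power_expansion[of s h M] M by auto
    have "of_nat N * s ^ M * h = - g" using c(2) by (simp add: h_def c_def)
    then have "(s + h) ^ N - a = h\<^sup>2 * q" using q(2) by (simp add: g_def)
    then have "av ((s + h) ^ N - a) = (av h)\<^sup>2 * av q"
      using hK WD[OF q(1)] by (simp add: av_mult av_power power_closed)
    also have "\<dots> \<le> (av h)\<^sup>2 * 1" using WD[OF q(1)] by (intro mult_left_mono) auto
    also have "\<dots> = av g * (av g / v\<^sup>2)" by (simp add: avh power2_eq_square)
    also have "\<dots> \<le> (d * r ^ n) * r"
      using s(2) gd gK v d r unfolding r_def
      by (intro mult_mono divide_right_mono) (auto simp: g_def r_def[symmetric])
    finally have "av ((s + h) ^ N - a) \<le> d * r ^ Suc n" by (simp add: ac_simps)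
    moreover have "s + h \<in> U" using av_add_eq[of s h] sK hK h1 by (intro UI) auto
    ultimately show ?case by blast
  qed
  have "(\<lambda>n. d * r ^ n) \<longlonglongrightarrow> d * 0" using r by (intro tendsto_mult_left LIMSEQ_power_zero) auto
  then have "eventually (\<lambda>n. d * r ^ n < e) sequentially" using assms(3) by (intro order_tendstoD(2)) auto
  then obtain n where "d * r ^ n < e" unfolding eventually_sequentially by auto
  then show ?thesis using step[of n] by (meson le_less_trans)
qed

end

subsection \<open>Kummer theory\<close>

lemma (in primitive_root) powers_inj: "inj_on (\<lambda>j. \<zeta> ^ j) {..<N}"
proof (rule inj_onI)
  have *: False if "i < j" "j < N" "\<zeta> ^ i = \<zeta> ^ j" for i j
  proof -
    have "\<zeta> ^ j = \<zeta> ^ i * \<zeta> ^ (j - i)" using that(1) by (simp flip: power_add)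
    then have "\<zeta> ^ i * \<zeta> ^ (j - i) = \<zeta> ^ i * 1" using that(3) by simp
    then have "\<zeta> ^ (j - i) = 1" by simp
    then show False using primitive[of "j - i"] that by simp
  qed
  fix i j assume "i \<in> {..<N}" "j \<in> {..<N}" "\<zeta> ^ i = \<zeta> ^ j"
  then show "i = j" using *[of i j] *[of j i] by (metis lessThan_iff linorder_neqE_nat)
qed

text \<open>Both sides are monic of degree N in u and agree at the N points \<zeta>^j * s.\<close>

lemma (in primitive_root) prod_minus_roots: "(\<Prod>j<N. u - \<zeta> ^ j * s) = u ^ N - s ^ N"
proof (cases "s = 0")
  case True
  then show ?thesis using N_pos by (simp add: power_0_left)
next
  case False
  define f where "f = (\<Prod>j<N. [:- (\<zeta> ^ j * s), 1:])"
  have df: "degree f = N" unfolding f_def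
    using degree_prod_eq_sum_degree[of "{..<N}" "\<lambda>j. [:- (\<zeta> ^ j * s), 1:]"] by simp
  have "lead_coeff f = 1" unfolding f_def by (simp add: lead_coeff_prod)
  then have cf: "coeff f N = 1" using df by simp
  define g where "g = monom 1 N - [:s ^ N:]"
  have "f = g"
  proof (rule poly_eqI_degree_lead_coeff[where A = "(\<lambda>j. \<zeta> ^ j * s) ` {..<N}" and n = N])
    show "degree g \<le> N" unfolding g_def by (intro degree_diff_le degree_monom_le) auto
    show "coeff f N = coeff g N" using N_pos by (simp add: cf g_def coeff_pCons split: nat.splits)
    show "degree f \<le> N" using df by simp
    have "inj_on (\<lambda>j. \<zeta> ^ j * s) {..<N}" using powers_inj False by (simp add: inj_on_def)
    then show "card ((\<lambda>j. \<zeta> ^ j * s) ` {..<N}) \<ge> N" by (simp add: card_image)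
    fix x assume "x \<in> (\<lambda>j. \<zeta> ^ j * s) ` {..<N}"
    then obtain j where j: "j < N" "x = \<zeta> ^ j * s" by auto
    have "poly f x = 0" unfolding f_def poly_prod using j by (intro prod_zero) auto
    moreover have "(\<zeta> ^ j) ^ N = 1" by (metis mult.commute power_mult power_one root_one)
    then have "poly g x = 0" by (simp add: g_def poly_monom j power_mult_distrib)
    ultimately show "poly f x = poly g x" by simp
  qed
  then have "poly f u = poly g u" by simp
  then show ?thesis by (simp add: f_def g_def poly_prod poly_monom)
qed

text \<open>The k-th power in the group ring, by repeated convolution on Z/N.\<close>

primrec conv_pow :: "nat \<Rightarrow> (int \<Rightarrow> complex) \<Rightarrow> nat \<Rightarrow> int \<Rightarrow> complex" where
  "conv_pow N c 0 m = (if int N dvd m then 1 else 0)"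
| "conv_pow N c (Suc k) m = (\<Sum>i\<in>{0..<int N}. conv_pow N c k (m - i) * c i)"

lemma periodic_conv_pow:
  assumes "periodic N c"
  shows "periodic N (conv_pow N c k)"
proof (induction k)
  case 0
  show ?case by (simp add: periodic_def)
next
  case (Suc k)
  have "conv_pow N c k (m + int N - i) = conv_pow N c k (m - i)" for m i
  proof -
    have "conv_pow N c k ((m - i) + int N) = conv_pow N c k (m - i)"
      using Suc unfolding periodic_def by blast
    then show ?thesis by (simp add: algebra_simps)
  qed
  then show ?case by (simp add: periodic_def)
qed

context abelian_exponent begin

lemma graded_conv_pow:
  assumes "graded x c"
  shows "graded x (conv_pow N c k)"
proof -
  interpret F: number_subfield "fixfield x" by (rule number_subfield_fixfield)
  have "conv_pow N c k m \<in> fixfield x" for m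
    by (induction k arbitrary: m) (use assms in \<open>auto simp: graded_def intro!: F.sum_closed F.mult_closed\<close>)
  then show ?thesis using assms periodic_conv_pow by (simp add: graded_def)
qed

text \<open>The k-th power of an eigenvector has the k-th power of the eigenvalue; for k = N the
  eigenvalue becomes 1.\<close>

lemma aut_conv_pow:
  assumes "graded x c" "s \<in> auts K" "\<And>m. s (c m) = c (m - j)"
  shows "s (conv_pow N c k m) = conv_pow N c k (m - int k * j)"
proof (induction k arbitrary: m)
  case 0
  show ?case using assms(2) aut_Rats[OF assms(2), of 1] by simp
next
  case (Suc k)
  let ?C = "conv_pow N c k"
  have C: "periodic N ?C" "periodic N c" "graded x ?C"
    using assms(1) graded_conv_pow by (auto simp: graded_def)
  have "s (conv_pow N c (Suc k) m) = (\<Sum>i\<in>{0..<int N}. s (?C (m - i) * c i))"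
    using graded_in_K[OF assms(1)] graded_in_K[OF C(3)]
    by (simp, intro aut_sum[OF assms(2)] mult_closed)
  also have "\<dots> = (\<Sum>i\<in>{0..<int N}. ?C (m - i - int k * j) * c (i - j))"
    using graded_in_K[OF assms(1)] graded_in_K[OF C(3)] Suc assms(3)
    by (intro sum.cong refl) (simp add: aut_mult[OF assms(2)])
  also have "\<dots> = (\<Sum>i\<in>{0..<int N}. ?C (m - int (Suc k) * j - i) * c i)"
  proof -
    define h where "h = (\<lambda>i. ?C (m - int (Suc k) * j - i) * c i)"
    have "periodic N h"
      unfolding periodic_def h_def
    proof
      fix i
      have "?C (m - int (Suc k) * j - (i + int N)) = ?C (m - int (Suc k) * j - i)"
        using periodic_mult[OF C(1), of "m - int (Suc k) * j - i" "-1"] by (simp add: algebra_simps)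
      then show "?C (m - int (Suc k) * j - (i + int N)) * c (i + int N) = ?C (m - int (Suc k) * j - i) * c i"
        using C(2) by (simp add: periodic_def)
    qed
    from sum_periodic_shift[OF this N_pos, of "- j"] show ?thesis
      by (simp add: h_def algebra_simps)
  qed
  finally show ?case by simp
qed

text \<open>Evaluation of the group ring at \<zeta> is multiplicative because \<zeta>^N = 1.\<close>

lemma twisted_sum_conv_pow:
  assumes "graded x c"
  shows "twisted_sum N \<zeta> (\<lambda>z. z) (conv_pow N c k) = twisted_sum N \<zeta> (\<lambda>z. z) c ^ k"
proof (induction k)
  case 0
  have "(\<Sum>m\<in>{0..<int N}. \<zeta> powi m * conv_pow N c 0 m) = (\<Sum>m\<in>{0}. \<zeta> powi m * conv_pow N c 0 m)"
    by (rule sum.mono_neutral_right) (use N_pos in \<open>auto dest: zdvd_imp_le\<close>)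
  then show ?case by (simp add: twisted_sum_def)
next
  case (Suc k)
  let ?C = "conv_pow N c k" and ?M = "{0..<int N}"
  have C: "periodic N ?C" using assms periodic_conv_pow by (auto simp: graded_def)
  have "twisted_sum N \<zeta> (\<lambda>z. z) (conv_pow N c (Suc k)) =
      (\<Sum>m\<in>?M. \<Sum>i\<in>?M. \<zeta> powi m * ?C (m - i) * c i)"
    by (simp add: twisted_sum_def sum_distrib_left mult.assoc)
  also have "\<dots> = (\<Sum>i\<in>?M. \<Sum>m\<in>?M. \<zeta> powi m * ?C (m - i) * c i)" by (rule sum.swap)
  also have "\<dots> = (\<Sum>i\<in>?M. (\<zeta> powi i * c i) * (\<Sum>m\<in>?M. \<zeta> powi m * ?C m))"
  proof (rule sum.cong[OF refl])
    fix i assume "i \<in> ?M"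
    have "periodic N (\<lambda>m. \<zeta> powi m * ?C m)"
      using C powi_periodic by (simp add: periodic_def)
    from sum_periodic_shift[OF this N_pos, of "- i"]
    have e: "(\<Sum>m\<in>?M. \<zeta> powi (m - i) * ?C (m - i)) = (\<Sum>m\<in>?M. \<zeta> powi m * ?C m)" by simp
    have "\<zeta> powi m * ?C (m - i) * c i = (\<zeta> powi i * c i) * (\<zeta> powi (m - i) * ?C (m - i))" for m
      by (simp add: power_int_diff)
    then have "(\<Sum>m\<in>?M. \<zeta> powi m * ?C (m - i) * c i) =
        (\<Sum>m\<in>?M. (\<zeta> powi i * c i) * (\<zeta> powi (m - i) * ?C (m - i)))"
      by (intro sum.cong refl)
    then show "(\<Sum>m\<in>?M. \<zeta> powi m * ?C (m - i) * c i) = (\<zeta> powi i * c i) * (\<Sum>m\<in>?M. \<zeta> powi m * ?C m)"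
      unfolding sum_distrib_left[symmetric] e .
  qed
  also have "\<dots> = twisted_sum N \<zeta> (\<lambda>z. z) c * twisted_sum N \<zeta> (\<lambda>z. z) ?C"
    by (simp add: twisted_sum_def sum_distrib_right)
  finally show ?case using Suc by (simp del: conv_pow.simps)
qed

text \<open>The Kummer property: the N-th power of a common eigenvector is fixed by all
  automorphisms, so its coefficients are rational and its evaluation lies in
  \<rat>(\<zeta>).\<close>

lemma twisted_sum_power_cyclotomic:
  assumes "graded x c" "\<And>s. s \<in> auts K \<Longrightarrow> shifts s c"
  shows "\<exists>q\<in>polys_over \<rat>. twisted_sum N \<zeta> (\<lambda>z. z) c ^ N = poly q \<zeta>"
proof -
  have rat: "conv_pow N c N m \<in> \<rat>" for m
  proof (rule fixed_Rats)
    show "conv_pow N c N m \<in> K" using graded_in_K[OF graded_conv_pow[OF assms(1)]] .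
    fix s assume s: "s \<in> auts K"
    then obtain j where j: "\<And>m. s (c m) = c (m - j)" using assms(2) by (auto simp: shifts_def)
    have "periodic N (conv_pow N c N)" using assms(1) periodic_conv_pow by (auto simp: graded_def)
    from periodic_mult[OF this, of m "- j"]
    show "s (conv_pow N c N m) = conv_pow N c N m"
      using aut_conv_pow[OF assms(1) s j, of N m] by (simp add: mult.commute)
  qed
  define q where "q = (\<Sum>m<N. monom (conv_pow N c N (int m)) m)"
  have "twisted_sum N \<zeta> (\<lambda>z. z) (conv_pow N c N) = (\<Sum>m<N. \<zeta> powi int m * conv_pow N c N (int m))"
    unfolding twisted_sum_def
    by (rule sum.reindex_bij_witness[of _ int nat]) auto
  also have "\<dots> = poly q \<zeta>" by (simp add: q_def poly_sum poly_monom mult.commute)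
  finally have "twisted_sum N \<zeta> (\<lambda>z. z) c ^ N = poly q \<zeta>" using twisted_sum_conv_pow[OF assms(1), of N] by simp
  moreover have "q \<in> polys_over \<rat>"
  proof -
    interpret Q: number_subfield \<rat> by (rule number_subfield_Rats)
    show ?thesis unfolding q_def using rat by (intro Q.polys_over_sum Q.polys_over_monom)
  qed
  ultimately show ?thesis by blast
qed

end

section \<open>A uniform local spanning set for \<open>K\<close>\<close>

lemma padic_abs_subfield:
  assumes "padic_abs L av p" "number_subfield k" "k \<subseteq> L"
  shows "padic_abs k av p"
proof -
  interpret padic_abs L av p by fact
  interpret k: number_subfield k by fact
  show ?thesis
  proof
    fix x y assume "x \<in> k" "y \<in> k"
    then have "x \<in> L" "y \<in> L" using assms(3) by auto
    then show "0 \<le> av x" "av x = 0 \<longleftrightarrow> x = 0" "av (x * y) = av x * av y"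
      "av (x + y) \<le> max (av x) (av y)" by (simp_all add: av_mult av_add)
  next
    show "prime p" "av (of_nat p) = exp (- 1)" by (fact prime_p, fact av_p)
  qed
qed

text \<open>Membership in the closure of the rational span of E; for finite E this amounts to
  membership in the p-adic span in the completion.\<close>

definition span_approx :: "(complex \<Rightarrow> real) \<Rightarrow> complex set \<Rightarrow> complex \<Rightarrow> bool" where
  "span_approx av E x \<longleftrightarrow> (\<forall>e>0. \<exists>t\<in>rat_space.span E. av (x - t) < e)"

lemma span_subset_number_subfield:
  assumes "number_subfield k" "E \<subseteq> k"
  shows "rat_space.span E \<subseteq> k"
proof (rule rat_space.span_minimal[OF assms(2)])
  interpret number_subfield k by fact
  show "rat_space.subspace k" by (rule rat_space.subspaceI) (auto intro!: mult_closed)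
qed

lemma (in nonarch) span_approx_add:
  assumes "x \<in> K" "y \<in> K" "E \<subseteq> K" "span_approx av E x" "span_approx av E y"
  shows "span_approx av E (x + y)"
  unfolding span_approx_def
proof (intro allI impI)
  fix e :: real assume "e > 0"
  obtain t where t: "t \<in> rat_space.span E" "av (x - t) < e" using assms(4) \<open>e > 0\<close> by (auto simp: span_approx_def)
  obtain u where u: "u \<in> rat_space.span E" "av (y - u) < e" using assms(5) \<open>e > 0\<close> by (auto simp: span_approx_def)
  have "t \<in> K" "u \<in> K" using t(1) u(1) span_subset_number_subfield[OF number_subfield_axioms assms(3)] by auto
  then have "av ((x - t) + (y - u)) < e" using av_add[of "x - t" "y - u"] assms(1,2) t(2) u(2) by (auto simp: diff_closed)
  moreover have "(x - t) + (y - u) = x + y - (t + u)" by simp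
  ultimately have "av (x + y - (t + u)) < e" by simp
  then show "\<exists>t\<in>rat_space.span E. av (x + y - t) < e"
    using rat_space.span_add[OF t(1) u(1)] by blast
qed

text \<open>Each x is a sum of radicals y with y^N in L = \<rat>(\<zeta>). If y^N is in the class of
  b, then y is a limit of elements of L times a fixed N-th root of b. There are at most
  \<open>power_classes N\<close> classes, and L has dimension at most N.\<close>

lemma (in abelian_exponent) local_span:
  assumes "padic_abs {x. algebraic x} av p"
  shows "\<exists>E. finite E \<and> E \<subseteq> {x. algebraic x} \<and> card E \<le> power_classes N * N \<and> (\<forall>x\<in>K. span_approx av E x)"
proof -
  interpret A: padic_abs "{x. algebraic x}" av p by fact
  have Qb: "number_subfield {x. algebraic x}" by (rule number_subfield_algebraic)
  have "[:-1:] + monom 1 N \<in> polys_over \<rat>"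
    by (auto simp: polys_over_def coeff_pCons split: nat.splits)
  moreover have "[:-1:] + monom (1::complex) N \<noteq> 0"
  proof -
    have "coeff ([:-1:] + monom (1::complex) N) N = 1" using N_pos by (simp add: coeff_pCons split: nat.splits)
    then show ?thesis by (metis coeff_0 zero_neq_one)
  qed
  moreover have "degree ([:-1:] + monom (1::complex) N) \<le> N"
    by (intro degree_add_le degree_monom_le) auto
  moreover have "poly ([:-1:] + monom 1 N) \<zeta> = 0" by (simp add: poly_monom root_one)
  ultimately obtain g where g: "g \<in> polys_over \<rat>" "g \<noteq> 0" "degree g \<le> N" "poly g \<zeta> = 0" by blast
  have alg: "algebraic \<zeta>" using g unfolding algebraic_altdef polys_over_def by auto
  define L where "L = (\<lambda>q. poly q \<zeta>) ` polys_over \<rat>"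
  have L: "number_subfield L" unfolding L_def by (rule number_subfield_adjoin_poly[OF number_subfield_Rats alg])
  interpret L: number_subfield L by (rule L)
  have LQ: "L \<subseteq> {x. algebraic x}" using L.algebraic_elems by auto
  have zL: "\<zeta> \<in> L" unfolding L_def
    by (intro image_eqI[of _ _ "[:0, 1:]"]) (auto simp: polys_over_def coeff_pCons split: nat.splits)
  define Z where "Z = (\<lambda>i. \<zeta> ^ i) ` {..<degree g}"
  have LZ: "L \<subseteq> rat_space.span Z" unfolding L_def Z_def using poly_at_in_span[OF g(1,2,4)] by auto
  have Z: "finite Z" "card Z \<le> N" "Z \<subseteq> L"
    using card_image_le[of "{..<degree g}" "\<lambda>i. \<zeta> ^ i"] g(3) zL by (auto simp: Z_def)
  interpret C: cyclotomic_padic L av p N \<zeta> Z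
    by (intro cyclotomic_padic.intro padic_abs_subfield[OF assms L LQ] primitive_root_axioms
        cyclotomic_padic_axioms.intro LZ Z)
  obtain B where B: "B \<subseteq> L - {0}" "finite B" "card B \<le> power_classes N"
    "\<And>a. a \<in> L - {0} \<Longrightarrow> \<exists>b\<in>B. \<exists>t\<in>L - {0}. av (a / (b * t ^ N) - 1) < (av (of_nat N))\<^sup>2"
    using C.approx_power_classes by auto
  have "\<exists>z. z ^ N = b" for b :: complex
  proof -
    have "degree (monom 1 N - [:b:]) \<noteq> 0"
    proof -
      have "coeff (monom 1 N - [:b:]) N \<noteq> 0" using N_pos by (simp add: coeff_pCons split: nat.splits)
      then show ?thesis using le_degree[of "monom 1 N - [:b:]" N] N_pos by linarith
    qed
    then obtain z where "poly (monom 1 N - [:b:]) z = 0"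
      using fundamental_theorem_of_algebra[of "monom 1 N - [:b:]"] by (auto simp: constant_degree)
    then show ?thesis by (intro exI[of _ z]) (simp add: poly_monom)
  qed
  then obtain \<beta> where \<beta>: "\<And>b::complex. \<beta> b ^ N = b" by metis
  have alg_root: "algebraic z" if zN: "algebraic (z ^ N)" for z :: complex
  proof -
    obtain q where q: "q \<in> polys_over \<rat>" "q \<noteq> 0" "poly q (z ^ N) = 0"
      using zN unfolding algebraic_altdef polys_over_def by auto
    have m: "(monom 1 N :: complex poly) \<in> polys_over \<rat>" by (auto simp: polys_over_def)
    have "pcompose q (monom 1 N) \<noteq> 0"
      using q(2) N_pos by (simp add: pcompose_eq_0_iff degree_monom_eq)
    moreover have "pcompose q (monom 1 N) \<in> polys_over \<rat>"
    proof -
      interpret Q: number_subfield \<rat> by (rule number_subfield_Rats)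
      show ?thesis using q(1)
      proof (induction q)
        case (pCons a q)
        then have "a \<in> \<rat>" "q \<in> polys_over \<rat>" using polys_over_pConsD by blast+
        then show ?case using pCons.IH m
          by (auto simp: pcompose_pCons intro!: Q.polys_over_add Q.polys_over_mult)
      qed simp
    qed
    moreover have "poly (pcompose q (monom 1 N)) z = 0" using q(3) by (simp add: poly_pcompose poly_monom)
    ultimately show ?thesis unfolding algebraic_altdef polys_over_def by auto
  qed
  define E where "E = (\<lambda>(b, z). \<beta> b * z) ` (B \<times> Z)"
  have \<beta>alg: "algebraic (\<beta> b)" "\<beta> b \<noteq> 0" if "b \<in> B" for b
  proof -
    have "b \<in> L" "b \<noteq> 0" using that B(1) by auto
    then show "algebraic (\<beta> b)" using alg_root[of "\<beta> b"] LQ \<beta>[of b] by auto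
    show "\<beta> b \<noteq> 0" using \<open>b \<noteq> 0\<close> \<beta>[of b] N_pos by (auto simp: power_0_left)
  qed
  have E: "finite E" "E \<subseteq> {x. algebraic x}"
    using B(2) Z \<beta>alg LQ by (auto simp: E_def intro!: algebraic_mult)
  have "card E \<le> card (B \<times> Z)" unfolding E_def using B(2) Z(1) by (intro card_image_le) auto
  also have "\<dots> \<le> power_classes N * N" using B(3) Z(2) by (simp add: card_cartesian_product mult_le_mono)
  finally have cardE: "card E \<le> power_classes N * N" .
  have \<beta>span: "\<beta> b * z \<in> rat_space.span E" if b: "b \<in> B" and z: "z \<in> L" for b z
  proof -
    have "z \<in> rat_space.span Z" using z LZ by auto
    then show ?thesis
    proof (induction rule: rat_space.span_induct_alt)
      case base
      then show ?case using rat_space.span_zero by simp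
    next
      case (step c x y)
      have "\<beta> b * x \<in> E" using step(1) b by (auto simp: E_def)
      then have "of_rat c * (\<beta> b * x) + \<beta> b * y \<in> rat_space.span E"
        using step by (simp add: rat_space.span_add rat_space.span_scale rat_space.span_base)
      then show ?case by (simp add: algebra_simps)
    qed
  qed
  have root: "span_approx av E y" if y: "algebraic y" "y ^ N \<in> L" for y
    unfolding span_approx_def
  proof (intro allI impI)
    fix e :: real assume e: "e > 0"
    show "\<exists>t\<in>rat_space.span E. av (y - t) < e"
    proof (cases "y = 0")
      case True
      then show ?thesis using e rat_space.span_zero[of E] by (intro bexI[of _ 0]) auto
    next
      case False
      then have "y ^ N \<in> L - {0}" using y(2) by simp
      then obtain b t where bt: "b \<in> B" "t \<in> L - {0}" "av (y ^ N / (b * t ^ N) - 1) < (av (of_nat N))\<^sup>2"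
        using B(4) by blast
      have bL: "b \<in> L" "b \<noteq> 0" using bt(1) B(1) by auto
      define \<tau> where "\<tau> = y ^ N / (b * t ^ N)"
      have \<tau>: "\<tau> \<in> L" unfolding \<tau>_def using y(2) bL bt(2) by (auto intro!: L.divide_closed L.mult_closed)
      define w where "w = \<beta> b * t"
      have w: "algebraic w" "w \<noteq> 0" using \<beta>alg[OF bt(1)] bt(2) LQ by (auto simp: w_def intro!: algebraic_mult)
      define u where "u = y / w"
      have u: "algebraic u" unfolding u_def using y(1) w(1) A.divide_closed[of y w] by auto
      have uN: "u ^ N = \<tau>" by (simp add: u_def \<tau>_def w_def power_divide power_mult_distrib \<beta>)
      have avw: "av w > 0" using w by (intro A.av_pos) auto
      define e' where "e' = e / av w"
      have e': "e' > 0" using e avw by (simp add: e'_def)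
      obtain s where s: "s \<in> C.U" "av (s ^ N - \<tau>) < e' ^ N"
        using C.newton_root[OF \<tau>, of "e' ^ N"] bt(3) e' by (auto simp: \<tau>_def)
      have sL: "s \<in> L" using C.UD(1)[OF s(1)] .
      have factor: "algebraic (u - \<zeta> ^ j * s)" for j
      proof -
        have "\<zeta> ^ j * s \<in> L" using zL sL by auto
        then show ?thesis using A.diff_closed[of u "\<zeta> ^ j * s"] u LQ by auto
      qed
      \<comment> \<open>The product of these N factors is u^N - s^N, smaller than e'^N; so one of
        them is smaller than e'.\<close>
      have "\<exists>j. av (u - \<zeta> ^ j * s) < e'"
      proof (rule ccontr)
        assume "\<not> (\<exists>j. av (u - \<zeta> ^ j * s) < e')"
        then have ge: "e' \<le> av (u - \<zeta> ^ j * s)" for j by (simp add: not_less)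
        have "e' ^ N = (\<Prod>j<N. e')" by simp
        also have "\<dots> \<le> (\<Prod>j<N. av (u - \<zeta> ^ j * s))" using ge e' by (intro prod_mono) auto
        also have "\<dots> = av (u ^ N - s ^ N)"
          using factor by (subst prod_minus_roots[symmetric], subst A.av_prod) auto
        also have "\<dots> = av (s ^ N - \<tau>)" unfolding uN
          using A.av_diff_commute[of \<tau> "s ^ N"] \<tau> sL LQ by auto
        finally show False using s(2) by simp
      qed
      then obtain j where j: "av (u - \<zeta> ^ j * s) < e'" by auto
      have "t * (\<zeta> ^ j * s) \<in> L" using bt(2) zL sL by auto
      then have "\<beta> b * (t * (\<zeta> ^ j * s)) \<in> rat_space.span E" by (rule \<beta>span[OF bt(1)])
      moreover have "y - \<beta> b * (t * (\<zeta> ^ j * s)) = w * (u - \<zeta> ^ j * s)"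
        using w(2) by (simp add: u_def w_def algebra_simps)
      then have "av (y - \<beta> b * (t * (\<zeta> ^ j * s))) = av w * av (u - \<zeta> ^ j * s)"
        using w(1) factor by (simp add: A.av_mult)
      then have "av (y - \<beta> b * (t * (\<zeta> ^ j * s))) < e" using j avw by (simp add: e'_def field_simps)
      ultimately show ?thesis by blast
    qed
  qed
  have "span_approx av E x" if x: "x \<in> K" for x
  proof -
    obtain cs where "\<forall>c\<in>set cs. graded x c \<and> (\<forall>s\<in>auts K. shifts s c)"
      "\<forall>l. (\<forall>u v. l (u + v) = l u + l v) \<longrightarrow> sum_list (map (twisted_sum N \<zeta> l) cs) = l 1 * x"
      using spectral_decomposition[OF x] by auto
    then have cs: "\<And>c. c \<in> set cs \<Longrightarrow> graded x c" "\<And>c s. c \<in> set cs \<Longrightarrow> s \<in> auts K \<Longrightarrow> shifts s c"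
      "sum_list (map (twisted_sum N \<zeta> (\<lambda>z. z)) cs) = x"
      by simp_all
    have alg': "algebraic (twisted_sum N \<zeta> (\<lambda>z. z) c)" if "c \<in> set cs" for c
    proof -
      have "\<zeta> powi m \<in> {x. algebraic x}" for m
        using alg A.power_closed A.inverse_closed by (auto simp: power_int_def)
      moreover have "c m \<in> {x. algebraic x}" for m
        using graded_in_K[OF cs(1)[OF that]] algebraic_elems by auto
      ultimately have "twisted_sum N \<zeta> (\<lambda>z. z) c \<in> {x. algebraic x}"
        unfolding twisted_sum_def by (intro A.sum_closed A.mult_closed)
      then show ?thesis by simp
    qed
    have ap: "span_approx av E (twisted_sum N \<zeta> (\<lambda>z. z) c)" if "c \<in> set cs" for c
    proof (rule root[OF alg'[OF that]])
      show "twisted_sum N \<zeta> (\<lambda>z. z) c ^ N \<in> L"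
        using twisted_sum_power_cyclotomic[OF cs(1,2)[OF that]] by (auto simp: L_def)
    qed
    have "algebraic (sum_list (map (twisted_sum N \<zeta> (\<lambda>z. z)) ds)) \<and>
        span_approx av E (sum_list (map (twisted_sum N \<zeta> (\<lambda>z. z)) ds))" if "set ds \<subseteq> set cs" for ds
      using that
    proof (induction ds)
      case Nil
      show ?case using rat_space.span_zero[of E] by (auto simp: span_approx_def intro!: bexI[of _ 0])
    next
      case (Cons d ds)
      then show ?case using alg'[of d] ap[of d] A.span_approx_add[OF _ _ E(2)] by (auto intro: algebraic_add)
    qed
    from this[of cs] show ?thesis using cs(3) by simp
  qed
  then show ?thesis using E cardE by blast
qed

section \<open>Completions\<close>

subsection \<open>Cauchy sequences and null sequences\<close>

context nonarch begin

definition cseq :: "(nat \<Rightarrow> complex) \<Rightarrow> bool" where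
  "cseq s \<longleftrightarrow> (\<forall>n. s n \<in> K) \<and> (\<forall>e>0. \<exists>M. \<forall>m\<ge>M. \<forall>n\<ge>M. av (s m - s n) < e)"

definition nseq :: "(nat \<Rightarrow> complex) \<Rightarrow> bool" where
  "nseq s \<longleftrightarrow> (\<forall>n. s n \<in> K) \<and> (\<lambda>n. av (s n)) \<longlonglongrightarrow> 0"

lemma nseq_iff: "nseq s \<longleftrightarrow> (\<forall>n. s n \<in> K) \<and> (\<forall>e>0. \<exists>M. \<forall>n\<ge>M. av (s n) < e)"
proof (cases "\<forall>n. s n \<in> K")
  case True
  then have "\<bar>av (s n)\<bar> = av (s n)" for n by simp
  then show ?thesis using True by (simp add: nseq_def lim_sequentially dist_real_def)
qed (auto simp: nseq_def)

lemma cseqD: "cseq s \<Longrightarrow> s n \<in> K" and nseqD: "nseq s \<Longrightarrow> s n \<in> K"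
  by (auto simp: cseq_def nseq_def)

lemma cseq_obtain:
  assumes "cseq s" "e > 0"
  obtains M where "\<And>m n. m \<ge> M \<Longrightarrow> n \<ge> M \<Longrightarrow> av (s m - s n) < e"
  using assms unfolding cseq_def by blast

lemma nseq_obtain:
  assumes "nseq s" "e > 0"
  obtains M where "\<And>n. n \<ge> M \<Longrightarrow> av (s n) < e"
  using assms unfolding nseq_iff by blast

lemma cseq_const [intro]: "c \<in> K \<Longrightarrow> cseq (\<lambda>_. c)"
  by (simp add: cseq_def)

lemma nseq_0 [intro, simp]: "nseq (\<lambda>_. 0)"
  by (simp add: nseq_def)

lemma cseq_add:
  assumes "cseq s" "cseq t"
  shows "cseq (\<lambda>n. s n + t n)"
  unfolding cseq_def
proof (intro conjI allI impI)
  show "s n + t n \<in> K" for n using assms cseqD by blast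
  fix e :: real assume e: "e > 0"
  obtain M where M: "\<And>m n. m \<ge> M \<Longrightarrow> n \<ge> M \<Longrightarrow> av (s m - s n) < e" using cseq_obtain[OF assms(1) e] by blast
  obtain M' where M': "\<And>m n. m \<ge> M' \<Longrightarrow> n \<ge> M' \<Longrightarrow> av (t m - t n) < e" using cseq_obtain[OF assms(2) e] by blast
  show "\<exists>M. \<forall>m\<ge>M. \<forall>n\<ge>M. av (s m + t m - (s n + t n)) < e"
  proof (intro exI[of _ "max M M'"] allI impI)
    fix m n assume mn: "m \<ge> max M M'" "n \<ge> max M M'"
    have "av ((s m - s n) + (t m - t n)) \<le> max (av (s m - s n)) (av (t m - t n))"
      using cseqD[OF assms(1)] cseqD[OF assms(2)] by (intro av_add diff_closed)
    also have "\<dots> < e" using M M' mn by auto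
    finally show "av (s m + t m - (s n + t n)) < e" by (simp add: algebra_simps)
  qed
qed

lemma cseq_uminus: "cseq s \<Longrightarrow> cseq (\<lambda>n. - s n)"
proof -
  assume s: "cseq s"
  have "av (- s m - - s n) = av (s m - s n)" for m n
    using av_diff_commute[of "s n" "s m"] cseqD[OF s] by simp
  then show ?thesis using s by (auto simp: cseq_def)
qed

lemma cseq_bounded:
  assumes "cseq s"
  shows "\<exists>C>0. \<forall>n. av (s n) \<le> C"
proof -
  obtain M where M: "\<And>m n. m \<ge> M \<Longrightarrow> n \<ge> M \<Longrightarrow> av (s m - s n) < 1"
    using cseq_obtain[OF assms, of 1] by auto
  have nn: "av (s n) \<ge> 0" for n using cseqD[OF assms] by simp
  define C where "C = 1 + av (s M) + (\<Sum>n<M. av (s n))"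
  have sum0: "(\<Sum>n<M. av (s n)) \<ge> 0" using nn by (intro sum_nonneg)
  have "av (s n) \<le> C" for n
  proof (cases "n < M")
    case True
    then have "av (s n) \<le> (\<Sum>n<M. av (s n))" using nn by (intro member_le_sum) auto
    then show ?thesis using nn[of M] by (simp add: C_def)
  next
    case False
    have "av ((s n - s M) + s M) \<le> max (av (s n - s M)) (av (s M))"
      using cseqD[OF assms] by (intro av_add diff_closed)
    also have "\<dots> \<le> 1 + av (s M)" using M[of n M] False nn[of M] by auto
    finally show ?thesis using sum0 by (simp add: C_def)
  qed
  moreover have "C > 0" using nn[of M] sum0 by (simp add: C_def add_pos_nonneg)
  ultimately show ?thesis by blast
qed

lemma cseq_mult:
  assumes "cseq s" "cseq t"
  shows "cseq (\<lambda>n. s n * t n)"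
  unfolding cseq_def
proof (intro conjI allI impI)
  show "s n * t n \<in> K" for n using assms cseqD by blast
  fix e :: real assume e: "e > 0"
  obtain C where C: "C > 0" "\<And>n. av (s n) \<le> C" using cseq_bounded[OF assms(1)] by blast
  obtain D where D: "D > 0" "\<And>n. av (t n) \<le> D" using cseq_bounded[OF assms(2)] by blast
  obtain M where M: "\<And>m n. m \<ge> M \<Longrightarrow> n \<ge> M \<Longrightarrow> av (s m - s n) < e / D"
    using cseq_obtain[OF assms(1), of "e / D"] e D by auto
  obtain M' where M': "\<And>m n. m \<ge> M' \<Longrightarrow> n \<ge> M' \<Longrightarrow> av (t m - t n) < e / C"
    using cseq_obtain[OF assms(2), of "e / C"] e C by auto
  show "\<exists>M. \<forall>m\<ge>M. \<forall>n\<ge>M. av (s m * t m - s n * t n) < e"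
  proof (intro exI[of _ "max M M'"] allI impI)
    fix m n assume mn: "m \<ge> max M M'" "n \<ge> max M M'"
    have K: "s i \<in> K" "t i \<in> K" "s i - s j \<in> K" "t i - t j \<in> K" for i j
      using cseqD[OF assms(1)] cseqD[OF assms(2)] by (auto intro: diff_closed)
    have "s m * t m - s n * t n = s m * (t m - t n) + (s m - s n) * t n" by (simp add: algebra_simps)
    then have "av (s m * t m - s n * t n) \<le> max (av (s m) * av (t m - t n)) (av (s m - s n) * av (t n))"
      using av_add[of "s m * (t m - t n)" "(s m - s n) * t n"] K by (simp add: av_mult mult_closed)
    moreover have "av (s m) * av (t m - t n) \<le> C * av (t m - t n)"
      using C(2) K by (intro mult_right_mono) auto
    moreover have "C * av (t m - t n) < e" using M'[of m n] mn C by (simp add: field_simps)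
    moreover have "av (s m - s n) * av (t n) \<le> av (s m - s n) * D"
      using D(2) K by (intro mult_left_mono) auto
    moreover have "av (s m - s n) * D < e" using M[of m n] mn D by (simp add: field_simps)
    ultimately show "av (s m * t m - s n * t n) < e" by auto
  qed
qed

lemma nseq_cseq:
  assumes "nseq s"
  shows "cseq s"
  unfolding cseq_def
proof (intro conjI allI impI)
  show "s n \<in> K" for n using assms nseqD by blast
  fix e :: real assume e: "e > 0"
  obtain M where M: "\<And>n. n \<ge> M \<Longrightarrow> av (s n) < e" using nseq_obtain[OF assms e] by blast
  have "av (s m - s n) < e" if "m \<ge> M" "n \<ge> M" for m n
    using av_diff[OF nseqD[OF assms, of m] nseqD[OF assms, of n]] M[OF that(1)] M[OF that(2)] by auto
  then show "\<exists>M. \<forall>m\<ge>M. \<forall>n\<ge>M. av (s m - s n) < e" by blast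
qed

lemma nseq_add:
  assumes "nseq s" "nseq t"
  shows "nseq (\<lambda>n. s n + t n)"
  unfolding nseq_iff
proof (intro conjI allI impI)
  show "s n + t n \<in> K" for n using assms nseqD by blast
  fix e :: real assume e: "e > 0"
  obtain M where M: "\<And>n. n \<ge> M \<Longrightarrow> av (s n) < e" using nseq_obtain[OF assms(1) e] by blast
  obtain M' where M': "\<And>n. n \<ge> M' \<Longrightarrow> av (t n) < e" using nseq_obtain[OF assms(2) e] by blast
  have "av (s n + t n) < e" if "n \<ge> max M M'" for n
    using av_add[OF nseqD[OF assms(1), of n] nseqD[OF assms(2), of n]] M[of n] M'[of n] that by auto
  then show "\<exists>M. \<forall>n\<ge>M. av (s n + t n) < e" by blast
qed

lemma nseq_mult:
  assumes "nseq s" "cseq t"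
  shows "nseq (\<lambda>n. s n * t n)"
  unfolding nseq_iff
proof (intro conjI allI impI)
  show "s n * t n \<in> K" for n using assms nseqD cseqD by blast
  fix e :: real assume e: "e > 0"
  obtain D where D: "D > 0" "\<And>n. av (t n) \<le> D" using cseq_bounded[OF assms(2)] by blast
  obtain M where M: "\<And>n. n \<ge> M \<Longrightarrow> av (s n) < e / D" using nseq_obtain[OF assms(1), of "e / D"] e D by auto
  have "av (s n * t n) < e" if "n \<ge> M" for n
  proof -
    have "av (s n * t n) = av (s n) * av (t n)" using nseqD[OF assms(1)] cseqD[OF assms(2)] by (rule av_mult)
    also have "\<dots> \<le> av (s n) * D" using D(2) nseqD[OF assms(1)] by (intro mult_left_mono) auto
    also have "\<dots> < e" using M[OF that] D by (simp add: field_simps)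
    finally show ?thesis .
  qed
  then show "\<exists>M. \<forall>n\<ge>M. av (s n * t n) < e" by blast
qed

lemma nseq_uminus: "nseq s \<Longrightarrow> nseq (\<lambda>n. - s n)"
  using nseq_mult[of s "\<lambda>_. -1"] by auto

text \<open>A Cauchy sequence that is not null has eventually constant nonzero absolute value. At
  the finitely many possible zeros the convention inverse 0 = 0 applies.\<close>

lemma cseq_inverse:
  assumes "cseq s" "\<not> nseq s"
  shows "cseq (\<lambda>n. inverse (s n))" "nseq (\<lambda>n. s n * inverse (s n) - 1)"
proof -
  have sK: "s n \<in> K" for n using cseqD[OF assms(1)] .
  obtain d where d: "d > 0" "\<And>M. \<exists>n\<ge>M. \<not> av (s n) < d"
    using assms(2) sK unfolding nseq_iff by blast
  obtain M where M: "\<And>m n. m \<ge> M \<Longrightarrow> n \<ge> M \<Longrightarrow> av (s m - s n) < d" using cseq_obtain[OF assms(1) d(1)] by blast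
  obtain k where k: "k \<ge> M" "d \<le> av (s k)" using d(2)[of M] by (auto simp: not_less)
  define a where "a = av (s k)"
  have a: "a > 0" using k d by (simp add: a_def)
  have eq: "av (s n) = a" if "n \<ge> M" for n
    unfolding a_def using M[OF k(1) that] k(2) by (intro av_eq_if_close sK) auto
  have nz: "s n \<noteq> 0" if "n \<ge> M" for n using eq[OF that] a by auto
  show "cseq (\<lambda>n. inverse (s n))"
    unfolding cseq_def
  proof (intro conjI allI impI)
    show "inverse (s n) \<in> K" for n using sK by auto
    fix e :: real assume e: "e > 0"
    obtain M' where M': "\<And>m n. m \<ge> M' \<Longrightarrow> n \<ge> M' \<Longrightarrow> av (s m - s n) < e * a\<^sup>2"
      using cseq_obtain[OF assms(1), of "e * a\<^sup>2"] e a by auto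
    show "\<exists>M. \<forall>m\<ge>M. \<forall>n\<ge>M. av (inverse (s m) - inverse (s n)) < e"
    proof (intro exI[of _ "max M M'"] allI impI)
      fix m n assume mn: "m \<ge> max M M'" "n \<ge> max M M'"
      have "inverse (s m) - inverse (s n) = (s n - s m) / (s m * s n)"
        using nz[of m] nz[of n] mn by (simp add: field_simps)
      then have "av (inverse (s m) - inverse (s n)) = av (s n - s m) / a\<^sup>2"
        using sK eq[of m] eq[of n] mn by (simp add: av_divide diff_closed mult_closed av_mult power2_eq_square)
      also have "\<dots> < e" using M'[of n m] mn a by (simp add: divide_less_eq)
      finally show "av (inverse (s m) - inverse (s n)) < e" .
    qed
  qed
  show "nseq (\<lambda>n. s n * inverse (s n) - 1)"
    unfolding nseq_iff
  proof (intro conjI allI impI)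
    show "s n * inverse (s n) - 1 \<in> K" for n using sK by (intro diff_closed mult_closed inverse_closed) auto
    fix e :: real assume "e > 0"
    then show "\<exists>M. \<forall>n\<ge>M. av (s n * inverse (s n) - 1) < e"
      by (intro exI[of _ M]) (auto simp: nz)
  qed
qed

fun seqcomb :: "(nat \<Rightarrow> complex) list \<Rightarrow> (nat \<Rightarrow> complex) list \<Rightarrow> nat \<Rightarrow> complex" where
  "seqcomb (l # ls) (s # ss) = (\<lambda>n. l n * s n + seqcomb ls ss n)"
| "seqcomb _ _ = (\<lambda>_. 0)"

lemma seqcomb_sum:
  "length ls = length ss \<Longrightarrow> seqcomb ls ss n = (\<Sum>i<length ss. (ls ! i) n * (ss ! i) n)"
  by (induction ls ss rule: list_induct2) (simp_all add: sum.lessThan_Suc_shift del: sum.lessThan_Suc)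

lemma cseq_seqcomb:
  "(\<And>l. l \<in> set ls \<Longrightarrow> cseq l) \<Longrightarrow> (\<And>s. s \<in> set ss \<Longrightarrow> cseq s) \<Longrightarrow> cseq (seqcomb ls ss)"
  by (induction ls ss rule: seqcomb.induct) (simp_all add: cseq_add cseq_mult cseq_const)

text \<open>
  A finite-dimensional subspace over the rational numbers: its Cauchy sequences have Cauchy
  coordinates, up to a null sequence. If the vector \<open>e\<close> is not in the closure of the span of the
  others, its coordinate is controlled by its distance to this span; otherwise it is superfluous.
\<close>

lemma span_cseq:
  assumes "set E \<subseteq> K" "cseq s" "\<And>n. s n \<in> rat_space.span (set E)"
  shows "\<exists>cs. length cs = length E \<and> (\<forall>c\<in>set cs. cseq c \<and> range c \<subseteq> \<rat>) \<and>
    nseq (\<lambda>n. s n - seqcomb cs (map (\<lambda>e _. e) E) n)"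
  using assms
proof (induction E arbitrary: s)
  case Nil
  then have "s n = 0" for n by simp
  then show ?case by (intro exI[of _ "[]"]) simp
next
  case (Cons e E)
  have EK: "set E \<subseteq> K" "e \<in> K" using Cons.prems(1) by auto
  have spanK: "rat_space.span (set E) \<subseteq> K"
    using span_subset_number_subfield[OF number_subfield_axioms EK(1)] .
  have "\<exists>q\<in>\<rat>. s n - q * e \<in> rat_space.span (set E)" for n
    using Cons.prems(3)[of n] unfolding list.set rat_space.span_insert by auto
  then obtain q where q: "\<And>n. q n \<in> \<rat>" "\<And>n. s n - q n * e \<in> rat_space.span (set E)" by metis
  define t where "t = (\<lambda>n. s n - q n * e)"
  have tK: "t n \<in> K" for n using q(2)[of n] spanK by (auto simp: t_def)
  have qK: "q n \<in> K" for n using q(1)[of n] by auto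
  show ?case
  proof (cases "\<forall>d>0. \<exists>r\<in>rat_space.span (set E). av (e - r) < d")
    case True
    \<comment> \<open>The coefficients q n may be unbounded here, so the precision of r n is adapted
      to the size of q n.\<close>
    have "\<exists>r\<in>rat_space.span (set E). av (e - r) < 1 / ((real n + 1) * (av (q n) + 1))" for n
    proof -
      have "(real n + 1) * (av (q n) + 1) > 0" using qK[of n] by (intro mult_pos_pos add_nonneg_pos) auto
      then show ?thesis using True by simp
    qed
    then obtain r where r: "\<And>n. r n \<in> rat_space.span (set E)"
      "\<And>n. av (e - r n) < 1 / ((real n + 1) * (av (q n) + 1))" by metis
    have rK: "r n \<in> K" for n using r(1)[of n] spanK by auto
    define s' where "s' = (\<lambda>n. q n * r n + t n)"
    have s's: "s' n \<in> rat_space.span (set E)" for n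
      unfolding s'_def using q r by (intro rat_space.span_add rat_space_scale_Rats) (auto simp: t_def)
    have diff: "s n - s' n = q n * (e - r n)" for n by (simp add: s'_def t_def algebra_simps)
    have "av (s n - s' n) \<le> inverse (real (Suc n))" for n
    proof -
      have "av (s n - s' n) = av (q n) * av (e - r n)" unfolding diff using qK rK EK by (simp add: av_mult diff_closed)
      also have "\<dots> \<le> (av (q n) + 1) * (1 / ((real n + 1) * (av (q n) + 1)))"
        using r(2)[of n] qK[of n] rK[of n] EK by (intro mult_mono) (auto intro!: av_nonneg diff_closed)
      also have "\<dots> = inverse (real (Suc n))"
      proof -
        have "u * (1 / ((real n + 1) * u)) = inverse (real (Suc n))" if "u \<noteq> 0" for u :: real
          using that by (simp add: inverse_eq_divide add.commute)
        moreover have "av (q n) + 1 \<noteq> 0" using av_nonneg[OF qK[of n]] by linarith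
        ultimately show ?thesis by blast
      qed
      finally show ?thesis .
    qed
    moreover have dK: "s n - s' n \<in> K" for n
      unfolding diff using qK rK EK by (intro mult_closed diff_closed)
    ultimately have n0: "nseq (\<lambda>n. s n - s' n)"
      unfolding nseq_def
      by (intro conjI allI dK tendsto_sandwich[OF _ _ tendsto_const LIMSEQ_inverse_real_of_nat]) simp_all
    have "cseq (\<lambda>n. s n + - (s n - s' n))"
      using Cons.prems(2) nseq_cseq[OF nseq_uminus[OF n0]] by (rule cseq_add)
    then have "cseq s'" by simp
    obtain cs where cs: "length cs = length E" "\<forall>c\<in>set cs. cseq c \<and> range c \<subseteq> \<rat>"
      "nseq (\<lambda>n. s' n - seqcomb cs (map (\<lambda>e _. e) E) n)"
      using Cons.IH[OF EK(1) \<open>cseq s'\<close> s's] by blast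
    have "nseq (\<lambda>n. (s n - s' n) + (s' n - seqcomb cs (map (\<lambda>e _. e) E) n))"
      using n0 cs(3) by (rule nseq_add)
    then have "nseq (\<lambda>n. s n - seqcomb ((\<lambda>_. 0) # cs) (map (\<lambda>e _. e) (e # E)) n)" by simp
    then show ?thesis using cs(1,2) by (intro exI[of _ "(\<lambda>_. 0) # cs"]) auto
  next
    case False
    then obtain d where d: "d > 0" "\<And>r. r \<in> rat_space.span (set E) \<Longrightarrow> d \<le> av (e - r)" by (auto simp: not_less)
    have ge: "av c * d \<le> av (c * e + u)" if c: "c \<in> \<rat>" "u \<in> rat_space.span (set E)" for c u
    proof (cases "c = 0")
      case True
      then show ?thesis using c spanK by auto
    next
      case False
      have "(- inverse c) * u \<in> rat_space.span (set E)" using c by (intro rat_space_scale_Rats) auto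
      then have "d \<le> av (e - (- inverse c) * u)" by (rule d(2))
      moreover have "c * (e - (- inverse c) * u) = c * e + u" using False by (simp add: algebra_simps)
      moreover have "(- inverse c) * u \<in> K" using \<open>(- inverse c) * u \<in> _\<close> spanK by auto
      then have "av (c * (e - (- inverse c) * u)) = av c * av (e - (- inverse c) * u)"
        using c EK by (intro av_mult diff_closed) auto
      ultimately show ?thesis using c by (simp add: mult_left_mono)
    qed
    have "cseq q"
      unfolding cseq_def
    proof (intro conjI allI impI qK)
      fix \<epsilon> :: real assume \<epsilon>: "\<epsilon> > 0"
      obtain M where M: "\<And>m n. m \<ge> M \<Longrightarrow> n \<ge> M \<Longrightarrow> av (s m - s n) < \<epsilon> * d"
        using cseq_obtain[OF Cons.prems(2), of "\<epsilon> * d"] \<epsilon> d by auto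
      have "av (q m - q n) < \<epsilon>" if mn: "m \<ge> M" "n \<ge> M" for m n
      proof -
        have "av (q m - q n) * d \<le> av ((q m - q n) * e + (t m - t n))"
          using q by (intro ge) (auto simp: t_def intro: rat_space.span_diff)
        also have "(q m - q n) * e + (t m - t n) = s m - s n" by (simp add: t_def algebra_simps)
        finally show ?thesis using M[OF mn] d by (meson le_less_trans mult_less_cancel_right_pos)
      qed
      then show "\<exists>M. \<forall>m\<ge>M. \<forall>n\<ge>M. av (q m - q n) < \<epsilon>" by blast
    qed
    then have "cseq (\<lambda>n. s n + - (q n * e))"
      using Cons.prems(2) EK by (intro cseq_add cseq_uminus cseq_mult cseq_const)
    then have "cseq t" by (simp add: t_def)
    then obtain cs where cs: "length cs = length E" "\<forall>c\<in>set cs. cseq c \<and> range c \<subseteq> \<rat>"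
      "nseq (\<lambda>n. t n - seqcomb cs (map (\<lambda>e _. e) E) n)"
      using Cons.IH[OF EK(1), of t] q(2) by (auto simp: t_def)
    have "nseq (\<lambda>n. s n - seqcomb (q # cs) (map (\<lambda>e _. e) (e # E)) n)"
      using cs(3) by (simp add: t_def algebra_simps)
    then show ?thesis using cs(1,2) \<open>cseq q\<close> q(1) by (intro exI[of _ "q # cs"]) auto
  qed
qed

end

subsection \<open>The completion as a ring\<close>

text \<open>The additive \<open>v\<close> and the multiplicative \<open>av\<close> are tied on K
  only; this is what the Cauchy and null conditions of the completion look at.\<close>

locale completed = padic_abs K av p for K av p +
  fixes v :: "complex \<Rightarrow> ereal"
  assumes v_eq: "x \<in> K \<Longrightarrow> v x = (if x = 0 then \<infinity> else ereal (- ln (av x)))"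
begin

abbreviation "C \<equiv> cauchy_ring K v"
abbreviation "I \<equiv> null_sequences K v"
abbreviation "Q \<equiv> completion K v"

lemma v_greater: 
  assumes "x \<in> K"
  shows "v x > ereal c \<longleftrightarrow> av x < exp (- c)"
proof (cases "x = 0")
  case True
  then show ?thesis using v_eq[of 0] by simp
next
  case False
  then have "av x > 0" using assms by (intro av_pos)
  then have "av x < exp (- c) \<longleftrightarrow> ln (av x) < ln (exp (- c))"
    by (simp only: ln_less_cancel_iff exp_gt_zero)
  then have "- ln (av x) > c \<longleftrightarrow> av x < exp (- c)" by auto
  then show ?thesis using v_eq[OF assms] False by simp
qed

lemma cauchy_condition:
  assumes "\<And>n. s n \<in> K"
  shows "(\<forall>c::real. \<exists>N. \<forall>m\<ge>N. \<forall>n\<ge>N. v (s m - s n) > ereal c) \<longleftrightarrow>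
    (\<forall>e>0. \<exists>N. \<forall>m\<ge>N. \<forall>n\<ge>N. av (s m - s n) < e)" (is "?A \<longleftrightarrow> ?B")
proof -
  have vg: "v (s m - s n) > ereal c \<longleftrightarrow> av (s m - s n) < exp (- c)" for m n c
    using assms by (intro v_greater diff_closed)
  show ?thesis
  proof
    assume A: ?A
    show ?B
    proof (intro allI impI)
      fix e :: real assume "e > 0"
      then have "exp (- (- ln e)) = e" by simp
      then show "\<exists>N. \<forall>m\<ge>N. \<forall>n\<ge>N. av (s m - s n) < e" using A[rule_format, of "- ln e"] unfolding vg by simp
    qed
  next
    assume B: ?B
    show ?A unfolding vg using B by simp
  qed
qed

lemma carrier_C: "carrier C = {s. cseq s}"
proof (intro Set.set_eqI)
  fix s :: "nat \<Rightarrow> complex"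
  have "range s \<subseteq> K \<longleftrightarrow> (\<forall>n. s n \<in> K)" by auto
  then show "s \<in> carrier C \<longleftrightarrow> s \<in> {s. cseq s}"
    using cauchy_condition[of s] by (auto simp only: cauchy_ring_def cseq_def partial_object.simps mem_Collect_eq)
qed

lemma carrier_C_Rats: "carrier (cauchy_ring \<rat> v) = {s. cseq s \<and> range s \<subseteq> \<rat>}"
proof (intro Set.set_eqI)
  fix s :: "nat \<Rightarrow> complex"
  have "range s \<subseteq> \<rat> \<Longrightarrow> \<forall>n. s n \<in> K" by (auto simp: image_subset_iff)
  then show "s \<in> carrier (cauchy_ring \<rat> v) \<longleftrightarrow> s \<in> {s. cseq s \<and> range s \<subseteq> \<rat>}"
    using cauchy_condition[of s] by (auto simp only: cauchy_ring_def cseq_def partial_object.simps mem_Collect_eq)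
qed

lemma I_eq: "I = {s. nseq s}"
proof -
  have "(\<lambda>n. v (s n)) \<longlonglongrightarrow> \<infinity> \<longleftrightarrow> (\<forall>e>0. \<exists>N. \<forall>n\<ge>N. av (s n) < e)" if s: "\<And>n. s n \<in> K" for s
  proof -
    have "(\<lambda>n. v (s n)) \<longlonglongrightarrow> \<infinity> \<longleftrightarrow> (\<forall>c::real. \<exists>N. \<forall>n\<ge>N. av (s n) < exp (- c))"
      using v_greater[OF s] by (simp add: tendsto_PInfty eventually_sequentially)
    also have "\<dots> \<longleftrightarrow> (\<forall>e>0. \<exists>N. \<forall>n\<ge>N. av (s n) < e)"
    proof
      assume A: "\<forall>c::real. \<exists>N. \<forall>n\<ge>N. av (s n) < exp (- c)"
      show "\<forall>e>0. \<exists>N. \<forall>n\<ge>N. av (s n) < e"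
      proof (intro allI impI)
        fix e :: real assume "e > 0"
        then show "\<exists>N. \<forall>n\<ge>N. av (s n) < e" using A[rule_format, of "- ln e"] by simp
      qed
    qed simp
    finally show ?thesis .
  qed
  then show ?thesis by (auto simp: null_sequences_def nseq_iff image_subset_iff)
qed

lemma C_sel [simp]: "s \<otimes>\<^bsub>C\<^esub> t = (\<lambda>n. s n * t n)" "s \<oplus>\<^bsub>C\<^esub> t = (\<lambda>n. s n + t n)"
  "\<one>\<^bsub>C\<^esub> = (\<lambda>_. 1)" "\<zero>\<^bsub>C\<^esub> = (\<lambda>_. 0)"
  by (simp_all add: cauchy_ring_def)

lemma cring_C: "cring C"
proof (rule cringI)
  show "abelian_group C"
  proof (rule abelian_groupI)
    fix x assume "x \<in> carrier C"
    then have "cseq (\<lambda>n. - x n)" by (simp add: carrier_C cseq_uminus)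
    then show "\<exists>y\<in>carrier C. y \<oplus>\<^bsub>C\<^esub> x = \<zero>\<^bsub>C\<^esub>" by (intro bexI[of _ "\<lambda>n. - x n"]) (auto simp: carrier_C)
  qed (auto simp: carrier_C cseq_add fun_eq_iff)
  show "Group.comm_monoid C"
    by (rule comm_monoidI) (auto simp: carrier_C cseq_mult)
qed (auto simp: carrier_C algebra_simps)

lemma ideal_I: "ideal I C"
proof (rule idealI)
  interpret cring C by (rule cring_C)
  show "ring C" by (rule ring_axioms)
  show "subgroup I (add_monoid C)"
  proof (rule add.subgroupI)
    show "I \<subseteq> carrier C" by (auto simp: I_eq carrier_C nseq_cseq)
    show "I \<noteq> {}" unfolding I_eq using nseq_0 by blast
    fix a assume a: "a \<in> I"
    then have "nseq (\<lambda>n. - a n)" by (simp add: I_eq nseq_uminus)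
    moreover have "\<ominus>\<^bsub>C\<^esub> a = (\<lambda>n. - a n)"
      using a by (intro minus_equality) (auto simp: I_eq carrier_C nseq_cseq cseq_uminus)
    ultimately show "\<ominus>\<^bsub>C\<^esub> a \<in> I" by (simp add: I_eq)
    fix b assume "b \<in> I"
    then show "a \<oplus>\<^bsub>C\<^esub> b \<in> I" using a by (simp add: I_eq nseq_add)
  qed
  fix a x assume "a \<in> I" "x \<in> carrier C"
  then have "nseq (\<lambda>n. a n * x n)" by (simp add: I_eq carrier_C nseq_mult)
  then show "x \<otimes>\<^bsub>C\<^esub> a \<in> I" "a \<otimes>\<^bsub>C\<^esub> x \<in> I" by (simp_all add: I_eq mult.commute)
qed

definition cls :: "(nat \<Rightarrow> complex) \<Rightarrow> (nat \<Rightarrow> complex) set" where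
  "cls s = I +>\<^bsub>C\<^esub> s"

sublocale Q: cring Q
  unfolding completion_def by (rule ideal.quotient_is_cring[OF ideal_I cring_C])

lemma carrier_Q: "carrier Q = cls ` {s. cseq s}"
  by (auto simp: completion_def FactRing_def A_RCOSETS_defs a_r_coset_def cls_def carrier_C)

lemma cls_mult: "cseq s \<Longrightarrow> cseq t \<Longrightarrow> cls s \<otimes>\<^bsub>Q\<^esub> cls t = cls (\<lambda>n. s n * t n)"
  using ideal.rcoset_mult_add[OF ideal_I, of s t] by (simp add: completion_def FactRing_def cls_def carrier_C)

lemma cls_add: "cseq s \<Longrightarrow> cseq t \<Longrightarrow> cls s \<oplus>\<^bsub>Q\<^esub> cls t = cls (\<lambda>n. s n + t n)"
proof -
  assume st: "cseq s" "cseq t"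
  interpret ideal I C by (rule ideal_I)
  show ?thesis using a_rcos_sum[of s t] st by (simp add: completion_def FactRing_def cls_def carrier_C)
qed

lemma cls_one: "\<one>\<^bsub>Q\<^esub> = cls (\<lambda>_. 1)"
  by (simp add: completion_def FactRing_def cls_def)

lemma cls_eq_zero: 
  assumes "cseq s"
  shows "cls s = \<zero>\<^bsub>Q\<^esub> \<longleftrightarrow> nseq s"
proof -
  interpret ideal I C by (rule ideal_I)
  have "cls s = I \<longleftrightarrow> s \<in> I"
    using a_rcos_const[of s] a_rcos_self[of s] assms by (auto simp: cls_def carrier_C)
  then show ?thesis by (simp add: completion_def FactRing_def I_eq)
qed

lemma cls_zero: "\<zero>\<^bsub>Q\<^esub> = cls (\<lambda>_. 0)"
  using cls_eq_zero[of "\<lambda>_. 0"] by auto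

lemma cls_in: "cseq s \<Longrightarrow> cls s \<in> carrier Q"
  by (auto simp: carrier_Q)

lemma cls_uminus: "cseq s \<Longrightarrow> \<ominus>\<^bsub>Q\<^esub> cls s = cls (\<lambda>n. - s n)"
  by (rule Q.minus_equality) (auto simp: cls_add cseq_uminus cls_in cls_zero[symmetric])

lemma cls_eqI:
  assumes "cseq s" "cseq t" "nseq (\<lambda>n. s n - t n)"
  shows "cls s = cls t"
proof -
  have "cls (\<lambda>n. s n - t n) = \<zero>\<^bsub>Q\<^esub>" using cls_eq_zero[OF nseq_cseq[OF assms(3)]] assms(3) by simp
  moreover have "cls (\<lambda>n. (s n - t n) + t n) = cls (\<lambda>n. s n - t n) \<oplus>\<^bsub>Q\<^esub> cls t"
    using cls_add[OF nseq_cseq[OF assms(3)] assms(2)] by simp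
  ultimately show ?thesis using cls_in[OF assms(2)] by simp
qed

definition base :: "(nat \<Rightarrow> complex) set set" where
  "base = cls ` {s. cseq s \<and> range s \<subseteq> \<rat>}"

lemma completion_rat_eq: "completion_rat K v = base"
  by (simp add: completion_rat_def base_def cls_def carrier_C_Rats)

lemma base_subset: "base \<subseteq> carrier Q"
  by (auto simp: base_def cls_in)

lemma subfield_base: "subfield base Q"
proof (rule Q.subfieldI)
  have sr: "subring base Q"
  proof (rule Q.subringI)
    show "base \<subseteq> carrier Q" by (rule base_subset)
    show "\<one>\<^bsub>Q\<^esub> \<in> base" unfolding cls_one base_def by (intro imageI) auto
    fix x assume "x \<in> base"
    then obtain s where s: "x = cls s" "cseq s" "range s \<subseteq> \<rat>" by (auto simp: base_def)
    have "cls (\<lambda>n. - s n) \<in> base" unfolding base_def using s by (intro imageI) (auto simp: cseq_uminus)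
    then show "\<ominus>\<^bsub>Q\<^esub> x \<in> base" using s by (simp add: cls_uminus)
    fix y assume "y \<in> base"
    then obtain t where t: "y = cls t" "cseq t" "range t \<subseteq> \<rat>" by (auto simp: base_def)
    have r: "s n \<in> \<rat>" "t n \<in> \<rat>" for n using s t by auto
    have "cls (\<lambda>n. s n * t n) \<in> base" "cls (\<lambda>n. s n + t n) \<in> base"
      unfolding base_def using s t r by (intro imageI; auto simp: cseq_mult cseq_add)+
    then show "x \<otimes>\<^bsub>Q\<^esub> y \<in> base" "x \<oplus>\<^bsub>Q\<^esub> y \<in> base" using s t by (simp_all add: cls_mult cls_add)
  qed
  then show "subcring base Q" by (rule Q.subcringI')
  have one0: "\<one>\<^bsub>Q\<^esub> \<noteq> \<zero>\<^bsub>Q\<^esub>"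
    unfolding cls_one using cls_eq_zero[of "\<lambda>_. 1"] by (auto simp: nseq_def LIMSEQ_const_iff)
  show "Units (Q\<lparr>carrier := base\<rparr>) = base - {\<zero>\<^bsub>Q\<^esub>}"
  proof
    show "Units (Q\<lparr>carrier := base\<rparr>) \<subseteq> base - {\<zero>\<^bsub>Q\<^esub>}"
    proof
      fix u assume "u \<in> Units (Q\<lparr>carrier := base\<rparr>)"
      then obtain w where "u \<in> base" "w \<in> base" "w \<otimes>\<^bsub>Q\<^esub> u = \<one>\<^bsub>Q\<^esub>" by (auto simp: Units_def)
      then show "u \<in> base - {\<zero>\<^bsub>Q\<^esub>}" using one0 base_subset by auto
    qed
    show "base - {\<zero>\<^bsub>Q\<^esub>} \<subseteq> Units (Q\<lparr>carrier := base\<rparr>)"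
    proof
      fix u assume u: "u \<in> base - {\<zero>\<^bsub>Q\<^esub>}"
      then obtain s where s: "u = cls s" "cseq s" "range s \<subseteq> \<rat>" by (auto simp: base_def)
      then have n: "\<not> nseq s" using cls_eq_zero u by auto
      note i = cseq_inverse[OF s(2) n]
      have "inverse (s m) \<in> \<rat>" for m using s(3) by auto
      then have b: "cls (\<lambda>n. inverse (s n)) \<in> base" unfolding base_def using i(1) by (intro imageI) auto
      have e: "u \<otimes>\<^bsub>Q\<^esub> cls (\<lambda>n. inverse (s n)) = \<one>\<^bsub>Q\<^esub>"
        unfolding s(1) cls_mult[OF s(2) i(1)] cls_one
        using i cseq_mult[OF s(2) i(1)] by (intro cls_eqI) auto
      moreover have "cls (\<lambda>n. inverse (s n)) \<otimes>\<^bsub>Q\<^esub> u = \<one>\<^bsub>Q\<^esub>"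
        using e Q.m_comm[of u "cls (\<lambda>n. inverse (s n))"] u b base_subset by auto
      ultimately show "u \<in> Units (Q\<lparr>carrier := base\<rparr>)" using u b by (auto simp: Units_def)
    qed
  qed
qed

lemma combine_cls:
  assumes "\<And>l. l \<in> set ls \<Longrightarrow> cseq l" "\<And>s. s \<in> set ss \<Longrightarrow> cseq s"
  shows "Q.combine (map cls ls) (map cls ss) = cls (seqcomb ls ss)"
  using assms
proof (induction ls ss rule: seqcomb.induct)
  case (1 l ls s ss)
  have "cseq (seqcomb ls ss)" "cseq l" "cseq s" using 1 by (auto intro: cseq_seqcomb)
  then show ?case using 1 by (simp add: cls_mult cls_add cseq_mult)
qed (simp_all add: cls_zero)

lemma base_list:
  assumes "set Ks \<subseteq> base"
  shows "\<exists>ls. Ks = map cls ls \<and> (\<forall>l\<in>set ls. cseq l \<and> range l \<subseteq> \<rat>)"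
  using assms
proof (induction Ks)
  case (Cons k Ks)
  then obtain ls where ls: "Ks = map cls ls" "\<forall>l\<in>set ls. cseq l \<and> range l \<subseteq> \<rat>" by auto
  obtain l where "k = cls l" "cseq l" "range l \<subseteq> \<rat>" using Cons.prems by (auto simp: base_def)
  then show ?case using ls by (intro exI[of _ "l # ls"]) auto
qed simp

lemma carrier_list:
  assumes "set Us \<subseteq> carrier Q"
  shows "\<exists>ss. Us = map cls ss \<and> (\<forall>s\<in>set ss. cseq s)"
  using assms
proof (induction Us)
  case (Cons u Us)
  then obtain ss where ss: "Us = map cls ss" "\<forall>s\<in>set ss. cseq s" by auto
  obtain s where "u = cls s" "cseq s" using Cons.prems by (auto simp: carrier_Q)
  then show ?case using ss by (intro exI[of _ "s # ss"]) auto
qed simp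

text \<open>The B classes of 1, x, ..., x^(B-1) outnumber the dimension. Representing the
  coefficients of a relation by rational Cauchy sequences gives the polynomials q n term by
  term.\<close>

lemma rat_dependent_if_local_degree_less:
  assumes "local_degree_less K v B" "x \<in> K"
  shows "rat_dependent K av B x"
proof -
  obtain d where d: "Q.dimension d base (carrier Q)" "d < B"
  proof -
    have "Q.finite_dimension base (carrier Q)" "Q.dim base (carrier Q) < B"
      using assms(1) by (simp_all add: local_degree_less_def completion_rat_eq)
    moreover obtain n where "Q.dimension n base (carrier Q)"
      using Q.finite_dimensionE[OF subfield_base] \<open>Q.finite_dimension base (carrier Q)\<close> by (auto simp: over_def)
    ultimately show thesis using that Q.dimI[OF subfield_base] by (auto simp: over_def)
  qed
  define ss where "ss = map (\<lambda>i. (\<lambda>_::nat. x ^ i)) [0..<B]"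
  have ss: "cseq s" if "s \<in> set ss" for s using that assms(2) by (auto simp: ss_def)
  define Us where "Us = map cls ss"
  have Us: "set Us \<subseteq> carrier Q" "length Us = B" using ss by (auto simp: Us_def cls_in) (simp add: ss_def)
  have "Q.dependent base Us"
  proof
    assume "Q.independent base Us"
    from Q.independent_length_le_dimension[OF subfield_base d(1) this Us(1)] show False using Us(2) d(2) by simp
  qed
  then obtain Ks where Ks: "length Ks = length Us" "Q.combine Ks Us = \<zero>\<^bsub>Q\<^esub>" "set Ks \<subseteq> base" "set Ks \<noteq> {\<zero>\<^bsub>Q\<^esub>}"
    using Q.dependent_imp_non_trivial_combine[OF subfield_base Us(1)] by blast
  obtain ls where ls: "Ks = map cls ls" "\<And>l. l \<in> set ls \<Longrightarrow> cseq l" "\<And>l. l \<in> set ls \<Longrightarrow> range l \<subseteq> \<rat>"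
    using base_list[OF Ks(3)] by blast
  have len: "length ls = B" "length ss = B" using Ks(1) Us(2) ls(1) by (auto simp: Us_def)
  have "cls (seqcomb ls ss) = \<zero>\<^bsub>Q\<^esub>" using Ks(2) combine_cls[OF ls(2) ss] by (simp add: ls(1) Us_def)
  then have "nseq (seqcomb ls ss)" using cls_eq_zero cseq_seqcomb[OF ls(2) ss] by simp
  define q where "q = (\<lambda>n. \<Sum>i<B. monom ((ls ! i) n) i)"
  have rat: "(ls ! i) n \<in> \<rat>" if "i < B" for i n using ls(3)[of "ls ! i"] that len by auto
  have cq: "coeff (q n) i = (if i < B then (ls ! i) n else 0)" for n i
    by (simp add: q_def coeff_sum coeff_monom if_distrib cong: if_cong)
  have B: "B > 0" using d(2) by simp
  have "poly (q n) x = seqcomb ls ss n" for n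
    using len by (simp add: seqcomb_sum q_def poly_sum poly_monom ss_def)
  then have "(\<lambda>n. av (poly (q n) x)) \<longlonglongrightarrow> 0" using \<open>nseq _\<close> by (simp add: nseq_def)
  moreover have "q n \<in> polys_over \<rat>" for n using rat cq by (simp add: polys_over_def)
  moreover have "degree (q n) < B" for n
  proof -
    have "degree (q n) \<le> B - 1" by (rule degree_le) (use cq in auto)
    then show ?thesis using B by linarith
  qed
  moreover have "\<not> (\<forall>i. (\<lambda>n. av (coeff (q n) i)) \<longlonglongrightarrow> 0)"
  proof
    assume z: "\<forall>i. (\<lambda>n. av (coeff (q n) i)) \<longlonglongrightarrow> 0"
    have "k = \<zero>\<^bsub>Q\<^esub>" if k: "k \<in> set Ks" for k
    proof -
      obtain i where i: "i < B" "k = cls (ls ! i)" using k ls(1) len by (auto simp: in_set_conv_nth)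
      have "nseq (ls ! i)" unfolding nseq_def using z[rule_format, of i] cq i rat[OF i(1)] by auto
      then show ?thesis using i(2) cls_eq_zero[OF nseq_cseq] by simp
    qed
    moreover have "Ks \<noteq> []" using len ls(1) B by auto
    ultimately have "set Ks = {\<zero>\<^bsub>Q\<^esub>}" by (cases Ks) auto
    then show False using Ks(4) by simp
  qed
  ultimately show ?thesis unfolding rat_dependent_def by blast
qed

end

section \<open>Dimension of the completion\<close>

lemma (in ring) Span_dimension_le:
  assumes "subfield k R" "set Us \<subseteq> carrier R"
  shows "\<exists>n\<le>length Us. dimension n k (Span k Us)"
  using assms(2)
proof (induction Us)
  case Nil
  have "dimension 0 k (Span k [])" by simp
  then show ?case by blast
next
  case (Cons u Us)
  then obtain n where n: "n \<le> length Us" "dimension n k (Span k Us)" by auto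
  have u: "u \<in> carrier R" "set Us \<subseteq> carrier R" using Cons.prems by auto
  have e: "Span k (u # Us) = line_extension k u (Span k Us)" by simp
  show ?case
  proof (cases "u \<in> Span k Us")
    case True
    have "Span k (u # Us) \<subseteq> Span k Us"
      unfolding e
    proof
      fix w assume "w \<in> line_extension k u (Span k Us)"
      then obtain c x where w: "c \<in> k" "x \<in> Span k Us" "w = c \<otimes> u \<oplus> x"
        unfolding line_extension_mem_iff by blast
      show "w \<in> Span k Us" unfolding w(3)
        by (rule Span_subgroup_props(3)[OF assms(1) u(2) Span_smult_closed[OF assms(1) u(2) w(1) True] w(2)])
    qed
    moreover have "Span k Us \<subseteq> Span k (u # Us)" using mono_Span[OF assms(1) u(2,1)] .
    ultimately have "Span k (u # Us) = Span k Us" by (rule subset_antisym)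
    then show ?thesis using n by (intro exI[of _ n]) simp
  next
    case False
    then have "dimension (Suc n) k (Span k (u # Us))" unfolding e using u n by (intro Suc_dim)
    then show ?thesis using n by (intro exI[of _ "Suc n"]) simp
  qed
qed

text \<open>A longest independent list spans. This form is used where no explicit spanning set
  inside the ring is at hand.\<close>

lemma (in ring) finite_dimension_if_dependent:
  assumes "subfield k R" "\<And>Us. set Us \<subseteq> carrier R \<Longrightarrow> length Us > m \<Longrightarrow> dependent k Us"
  shows "\<exists>n\<le>m. dimension n k (carrier R)"
proof -
  have "independent k []" by simp
  moreover have "\<forall>Us. independent k Us \<longrightarrow> length Us < Suc m"
    using assms(2) independent_in_carrier by (metis less_Suc_eq_le not_le)
  ultimately obtain Us where Us: "independent k Us" "\<And>Vs. independent k Vs \<Longrightarrow> length Vs \<le> length Us"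
    using ex_has_greatest_nat[of "independent k" "[]" length "Suc m"] by auto
  have c: "set Us \<subseteq> carrier R" using independent_in_carrier[OF Us(1)] .
  have "Span k Us = carrier R"
  proof
    show "Span k Us \<subseteq> carrier R" using Span_in_carrier[OF subfieldE(3)[OF assms(1)] c] .
    show "carrier R \<subseteq> Span k Us"
    proof
      fix u assume u: "u \<in> carrier R"
      show "u \<in> Span k Us"
      proof (rule ccontr)
        assume "u \<notin> Span k Us"
        then have "independent k (u # Us)" using u Us(1) by (intro li_Cons)
        from Us(2)[OF this] show False by simp
      qed
    qed
  qed
  moreover have "length Us \<le> m" using assms(2)[OF c] Us(1) by (meson not_le)
  ultimately show ?thesis using dimension_independent[OF Us(1)] by (intro exI[of _ "length Us"]) simp
qed

text \<open>The set E lies in the larger field L, so it need not give a spanning set of the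
  completion of K. Instead, too many classes over K become dependent in the span of E over L. The
  coefficients are rational sequences, hence belong to K, and the relation holds in the completion
  of K because \<open>aw\<close> extends \<open>av\<close>.\<close>

lemma local_degree_less_if_span_approx:
  assumes "completed K av p v" "completed L aw p w" "K \<subseteq> L" "\<And>x. x \<in> K \<Longrightarrow> aw x = av x"
    and "set E \<subseteq> L" "\<And>x. x \<in> K \<Longrightarrow> span_approx aw (set E) x"
  shows "local_degree_less K v (length E + 1)"
proof -
  interpret A: completed K av p v by fact
  interpret B: completed L aw p w by fact
  have AB: "B.cseq s" if "A.cseq s" for s
  proof -
    have "aw (s m - s n) = av (s m - s n)" for m n
      using A.cseqD[OF that] by (intro assms(4) A.diff_closed)
    then show ?thesis using that assms(3) by (auto simp: A.cseq_def B.cseq_def)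
  qed
  have BA: "A.cseq s" if "B.cseq s" "\<And>n. s n \<in> K" for s
  proof -
    have "aw (s m - s n) = av (s m - s n)" for m n
      using that(2) by (intro assms(4) A.diff_closed)
    then show ?thesis using that by (auto simp: A.cseq_def B.cseq_def)
  qed
  have nBA: "A.nseq s \<longleftrightarrow> B.nseq s" if "\<And>n. s n \<in> K" for s
    using that assms(3,4) by (auto simp: A.nseq_def B.nseq_def)
  define es where "es = map (\<lambda>e. (\<lambda>_::nat. e)) E"
  have es: "B.cseq e" if "e \<in> set es" for e using that assms(5) by (auto simp: es_def)
  define Sp where "Sp = B.Q.Span B.base (map B.cls es)"
  have esQ: "set (map B.cls es) \<subseteq> carrier B.Q" using es B.cls_in by auto
  \<comment> \<open>A Cauchy sequence in K is changed by a null sequence into one in the rational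
    span of E; \<open>span_cseq\<close> supplies its p-adic coordinates.\<close>
  have inSp: "B.cls s \<in> Sp" if s: "A.cseq s" for s
  proof -
    have sK: "s n \<in> K" for n using A.cseqD[OF s] .
    have "\<exists>t\<in>rat_space.span (set E). aw (s n - t) < inverse (real (Suc n))" for n
      using assms(6)[OF sK[of n]] unfolding span_approx_def by simp
    then obtain t where t: "\<And>n. t n \<in> rat_space.span (set E)" "\<And>n. aw (s n - t n) < inverse (real (Suc n))"
      by metis
    have tL: "t n \<in> L" for n
      using t(1) span_subset_number_subfield[OF B.number_subfield_axioms assms(5)] by blast
    have sL: "s n \<in> L" for n using sK assms(3) by auto
    have n0: "B.nseq (\<lambda>n. s n - t n)"
      unfolding B.nseq_def
    proof (intro conjI allI tendsto_sandwich[OF _ _ tendsto_const LIMSEQ_inverse_real_of_nat])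
      show dL: "s n - t n \<in> L" for n using sL tL by auto
      show "\<forall>\<^sub>F n in sequentially. 0 \<le> aw (s n - t n)" using dL by (intro always_eventually) simp
      show "\<forall>\<^sub>F n in sequentially. aw (s n - t n) \<le> inverse (real (Suc n))"
        using t(2) by (intro always_eventually) (simp add: less_imp_le)
    qed
    have "B.cseq (\<lambda>n. s n + - (s n - t n))"
      by (rule B.cseq_add[OF AB[OF s] B.nseq_cseq[OF B.nseq_uminus[OF n0]]])
    then have tc: "B.cseq t" by simp
    obtain cs where cs: "length cs = length E" "\<forall>c\<in>set cs. B.cseq c \<and> range c \<subseteq> \<rat>"
      "B.nseq (\<lambda>n. t n - B.seqcomb cs es n)"
      using B.span_cseq[OF assms(5) tc t(1)] unfolding es_def by blast
    have cc: "B.cseq (B.seqcomb cs es)" using cs(2) es by (intro B.cseq_seqcomb) auto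
    have "B.cls s = B.cls t" using AB[OF s] tc n0 by (rule B.cls_eqI)
    also have "\<dots> = B.cls (B.seqcomb cs es)" using tc cc cs(3) by (rule B.cls_eqI)
    also have "\<dots> = B.Q.combine (map B.cls cs) (map B.cls es)"
      using cs(2) es by (intro B.combine_cls[symmetric]) auto
    also have "\<dots> \<in> Sp"
      unfolding Sp_def B.Q.Span_mem_iff_length_version[OF B.subfield_base esQ]
      using cs by (intro exI[of _ "map B.cls cs"]) (auto simp: es_def B.base_def)
    finally show ?thesis .
  qed
  obtain d where d: "d \<le> length E" "B.Q.dimension d B.base Sp"
    using B.Q.Span_dimension_le[OF B.subfield_base esQ] by (auto simp: Sp_def es_def)
  have dep: "A.Q.dependent A.base Us" if Us: "set Us \<subseteq> carrier A.Q" "length Us > length E" for Us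
  proof -
    obtain ss where ss: "Us = map A.cls ss" "\<And>s. s \<in> set ss \<Longrightarrow> A.cseq s" using A.carrier_list[OF Us(1)] by blast
    define Ws where "Ws = map B.cls ss"
    have W: "set Ws \<subseteq> Sp" "set Ws \<subseteq> carrier B.Q" "length Ws > length E"
      using ss(2) inSp B.cls_in AB Us(2) ss(1) by (auto simp: Ws_def)
    have "B.Q.dependent B.base Ws"
    proof
      assume "B.Q.independent B.base Ws"
      from B.Q.independent_length_le_dimension[OF B.subfield_base d(2) this W(1)] show False using d(1) W(3) by simp
    qed
    then obtain Ks where Ks: "length Ks = length Ws" "B.Q.combine Ks Ws = \<zero>\<^bsub>B.Q\<^esub>" "set Ks \<subseteq> B.base"
        "set Ks \<noteq> {\<zero>\<^bsub>B.Q\<^esub>}"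
      using B.Q.dependent_imp_non_trivial_combine[OF B.subfield_base W(2)] by blast
    obtain ls where ls: "Ks = map B.cls ls" "\<And>l. l \<in> set ls \<Longrightarrow> B.cseq l" "\<And>l. l \<in> set ls \<Longrightarrow> range l \<subseteq> \<rat>"
      using B.base_list[OF Ks(3)] by blast
    have lK: "l n \<in> K" if "l \<in> set ls" for l n using ls(3)[OF that] A.Rats_in by auto
    have lA: "A.cseq l" if "l \<in> set ls" for l using BA ls(2)[OF that] lK[OF that] by blast
    have sB: "B.cseq s" if "s \<in> set ss" for s using AB ss(2)[OF that] .
    have sc: "B.seqcomb ls ss = A.seqcomb ls ss" 
      by (induction ls ss rule: A.seqcomb.induct) auto
    have "B.cls (B.seqcomb ls ss) = \<zero>\<^bsub>B.Q\<^esub>"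
      using Ks(2) B.combine_cls[OF ls(2) sB] by (simp add: ls(1) Ws_def)
    then have "B.nseq (A.seqcomb ls ss)" using B.cls_eq_zero[OF B.cseq_seqcomb[OF ls(2) sB]] sc by simp
    moreover have cA: "A.cseq (A.seqcomb ls ss)" using lA ss(2) by (rule A.cseq_seqcomb)
    ultimately have "A.nseq (A.seqcomb ls ss)" using nBA A.cseqD by blast
    then have z: "A.Q.combine (map A.cls ls) Us = \<zero>\<^bsub>A.Q\<^esub>"
    proof -
      have "A.Q.combine (map A.cls ls) (map A.cls ss) = A.cls (A.seqcomb ls ss)"
        using lA ss(2) by (rule A.combine_cls)
      then show ?thesis using A.cls_eq_zero[OF cA] \<open>A.nseq _\<close> ss(1) by simp
    qed
    show ?thesis
    proof (rule A.Q.non_trivial_combine_imp_dependent[OF A.subfield_base _ z])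
      show "set (map A.cls ls) \<subseteq> A.base" using lA ls(3) by (auto simp: A.base_def)
      have len: "length ls = length Us" using Ks(1) ls(1) ss(1) by (simp add: Ws_def)
      have "Ks \<noteq> []" using Ks(1) W(3) by auto
      then obtain k where k: "k \<in> set Ks" "k \<noteq> \<zero>\<^bsub>B.Q\<^esub>" using Ks(4) by (cases Ks) auto
      then obtain l where l: "l \<in> set ls" "k = B.cls l" using ls(1) by auto
      then have "\<not> B.nseq l" using k B.cls_eq_zero[OF ls(2)[OF l(1)]] by simp
      then have "A.cls l \<noteq> \<zero>\<^bsub>A.Q\<^esub>" using A.cls_eq_zero[OF lA[OF l(1)]] nBA lK[OF l(1)] by blast
      then show "\<not> set (take (length Us) (map A.cls ls)) \<subseteq> {\<zero>\<^bsub>A.Q\<^esub>}" using l(1) len by auto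
    qed
  qed
  obtain n where n: "n \<le> length E" "A.Q.dimension n A.base (carrier A.Q)"
    using A.Q.finite_dimension_if_dependent[OF A.subfield_base dep] by blast
  show ?thesis
    unfolding local_degree_less_def A.completion_rat_eq
    using A.Q.finite_dimensionI[OF n(2)] A.Q.dimI[OF A.subfield_base n(2)] n(1) by (simp add: over_def)
qed

subsection \<open>Valuations and absolute values\<close>

lemma padic_valuation_nat_self: "prime p \<Longrightarrow> padic_valuation p (of_nat p) = 1"
proof -
  assume p: "prime p"
  have q: "quotient_of (of_nat p) = (int p, 1)" using quotient_of_int[of "int p"] by simp
  have "\<not> is_unit (int p)" "int p \<noteq> 0" using p by (metis prime_nat_int_transfer not_prime_unit, simp add: prime_gt_0_nat)
  then have "multiplicity (int p) (int p) = 1" by (rule multiplicity_self[rotated])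
  then show ?thesis using p q by (simp add: padic_valuation_def prime_gt_0_nat one_ereal_def)
qed

definition val_abs :: "(complex \<Rightarrow> ereal) \<Rightarrow> complex \<Rightarrow> real" where
  "val_abs v x = (if v x = \<infinity> then 0 else exp (- real_of_ereal (v x)))"

lemma completed_val_abs:
  assumes "number_subfield K" "prime p" "extends_padic p K v"
  shows "completed K (val_abs v) p v"
proof -
  interpret number_subfield K by fact
  have vr: "\<And>x. x \<in> K \<Longrightarrow> v x \<noteq> -\<infinity>" "\<And>x. x \<in> K \<Longrightarrow> v x = \<infinity> \<longleftrightarrow> x = 0"
    and vm: "\<And>x y. x \<in> K \<Longrightarrow> y \<in> K \<Longrightarrow> v (x * y) = v x + v y"
    and va: "\<And>x y. x \<in> K \<Longrightarrow> y \<in> K \<Longrightarrow> v (x + y) \<ge> min (v x) (v y)"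
    and vq: "\<And>q. v (of_rat q) = padic_valuation p q"
    using assms(3) by (auto simp: extends_padic_def valuation_on_def)
  have fin: "v x = ereal (real_of_ereal (v x))" if "x \<in> K" "x \<noteq> 0" for x
    using vr[OF that(1)] that(2) by (cases "v x") auto
  have abs0: "val_abs v x = (if x = 0 then 0 else exp (- real_of_ereal (v x)))" if "x \<in> K" for x
    using vr(2)[OF that] by (simp add: val_abs_def)
  have "padic_abs K (val_abs v) p"
  proof
    fix x y assume xy: "x \<in> K" "y \<in> K"
    show "0 \<le> val_abs v x" by (simp add: val_abs_def)
    show "val_abs v x = 0 \<longleftrightarrow> x = 0" using abs0[OF xy(1)] by simp
    have K: "x * y \<in> K" "x + y \<in> K" using xy by auto
    show "val_abs v (x * y) = val_abs v x * val_abs v y"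
    proof (cases "x = 0 \<or> y = 0")
      case True
      then show ?thesis using abs0 xy K by auto
    next
      case False
      obtain a b where ab: "v x = ereal a" "v y = ereal b" using fin xy False by metis
      then have "v (x * y) = ereal (a + b)" using vm[OF xy] by simp
      then show ?thesis using ab by (simp add: val_abs_def exp_add[symmetric])
    qed
    show "val_abs v (x + y) \<le> max (val_abs v x) (val_abs v y)"
    proof (cases "x = 0 \<or> y = 0 \<or> x + y = 0")
      case True
      then show ?thesis using abs0 xy K by (auto simp: le_max_iff_disj)
    next
      case False
      obtain a b c where abc: "v x = ereal a" "v y = ereal b" "v (x + y) = ereal c" using fin xy K False by metis
      then have "min a b \<le> c" using va[OF xy] by (simp add: min_def split: if_splits)
      then show ?thesis using abc by (auto simp: val_abs_def min_def max_def split: if_splits)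
    qed
  next
    show "prime p" by fact
    have "v (of_nat p) = 1" using vq[of "of_nat p"] padic_valuation_nat_self[OF assms(2)] by simp
    then show "val_abs v (of_nat p) = exp (- 1)" by (simp add: val_abs_def one_ereal_def)
  qed
  moreover have "v x = (if x = 0 then \<infinity> else ereal (- ln (val_abs v x)))" if "x \<in> K" for x
    using fin[OF that] abs0[OF that] vr(2)[OF that] by auto
  ultimately show ?thesis by (intro completed.intro completed_axioms.intro)
qed

lemma extends_padic_of_abs:
  assumes "padic_abs K av p"
  defines "v \<equiv> \<lambda>x. if x = 0 then \<infinity> else ereal (- ln (av x))"
  shows "extends_padic p K v" "completed K av p v"
proof -
  interpret padic_abs K av p by fact
  show "completed K av p v" by (intro completed.intro assms completed_axioms.intro) (simp add: v_def)
  have "valuation_on K v"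
    unfolding valuation_on_def
  proof (intro conjI ballI)
    fix x y assume xy: "x \<in> K" "y \<in> K"
    show "v x \<noteq> - \<infinity>" "v x = \<infinity> \<longleftrightarrow> x = 0" by (simp_all add: v_def)
    show "v (x * y) = v x + v y"
      using xy av_pos[of x] av_pos[of y] by (simp add: v_def av_mult ln_mult)
    show "v (x + y) \<ge> min (v x) (v y)"
    proof (cases "x = 0 \<or> y = 0 \<or> x + y = 0")
      case True
      then show ?thesis by (auto simp: v_def)
    next
      case False
      have pos: "av x > 0" "av y > 0" "av (x + y) > 0" using xy False by (auto intro!: av_pos)
      have "ln (av (x + y)) \<le> ln (max (av x) (av y))" using av_add[OF xy] pos by simp
      also have "\<dots> = max (ln (av x)) (ln (av y))" using pos by (auto simp: max_def)
      finally show ?thesis using False by (auto simp: v_def min_def max_def split: if_splits)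
    qed
  qed
  moreover have "v (of_rat q) = padic_valuation p q" for q
  proof (cases "q = 0")
    case True
    then show ?thesis by (simp add: v_def padic_valuation_def)
  next
    case False
    obtain a b where ab: "quotient_of q = (a, b)" by (cases "quotient_of q")
    have q: "q = of_int a / of_int b" using quotient_of_div[OF ab] .
    have nz: "a \<noteq> 0" "b \<noteq> 0" using False q by auto
    have int: "av (of_int n) = exp (- real (multiplicity (int p) n))" if "n \<noteq> 0" for n
    proof -
      have nu: "\<not> is_unit (int p)" using prime_p by (metis prime_nat_int_transfer not_prime_unit)
      obtain m where m: "n = int p ^ multiplicity (int p) n * m" "\<not> int p dvd m"
        using multiplicity_decompose'[OF \<open>n \<noteq> 0\<close> nu] .
      have cop: "coprime m (int p)" using m(2) prime_p
        by (metis coprime_commute prime_imp_coprime prime_nat_int_transfer)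
      have e: "of_int n = of_nat p ^ multiplicity (int p) n * (of_int m :: complex)"
        by (subst m(1)) simp
      show ?thesis unfolding e using av_coprime[OF cop] by (simp add: av_mult av_p_power power_closed)
    qed
    have e: "(of_rat q :: complex) = of_int a / of_int b" by (simp add: q of_rat_divide)
    have "av (of_rat q) = exp (real (multiplicity (int p) b) - real (multiplicity (int p) a))"
      unfolding e using int nz by (subst av_divide) (auto simp: exp_diff exp_minus divide_inverse mult.commute)
    then show ?thesis using False ab by (simp add: v_def padic_valuation_def)
  qed
  ultimately show "extends_padic p K v" by (simp add: extends_padic_def)
qed

section \<open>Equivalence of the three conditions\<close>

lemma abelian_number_field_if_abelian_extension:
  assumes "abelian_extension K"
  shows "abelian_number_field K"
proof -
  let ?G = "gal_group K" and ?R = "complex_field\<lparr>carrier := K\<rparr>"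
  have sub: "subfield K complex_field" and alg: "\<And>x. x \<in> K \<Longrightarrow> algebraic x"
    and fix_eq: "{x \<in> K. \<forall>\<sigma>\<in>carrier ?G. \<sigma> x = x} = \<rat>" and "comm_group ?G"
    using assms by (auto simp: abelian_extension_def galois_extension_def)
  interpret G: comm_group ?G by fact
  interpret number_subfield K by (rule subfield_imp_number_subfield[OF sub alg])
  have car: "carrier ?G = {\<sigma> \<in> Bij K. \<sigma> \<in> ring_hom ?R ?R \<and> (\<forall>x\<in>\<rat>. \<sigma> x = x)}"
    by (simp add: gal_group_def)
  \<comment> \<open>Elements of \<open>Bij K\<close> are extensional, so an automorphism has to be
    restricted to count as an element of the Galois group.\<close>
  have restr: "restrict s K \<in> carrier ?G" if s: "s \<in> auts K" for s
  proof -
    interpret number_field_hom K s using s by (simp add: auts_def)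
    have im: "s ` K = K" using s by (simp add: auts_def)
    have "bij_betw (restrict s K) K K"
      using im hom_inj by (auto simp: bij_betw_def inj_on_def)
    then have "restrict s K \<in> Bij K" by (simp add: Bij_def)
    moreover have "restrict s K \<in> ring_hom ?R ?R"
      using im by (auto simp: ring_hom_def ring_of_type_algebra_def hom_add hom_mult hom_one)
    moreover have "\<forall>x\<in>\<rat>. restrict s K x = x" using hom_Rats by simp
    ultimately show ?thesis by (simp add: car)
  qed
  have aut: "\<sigma> \<in> auts K" if "\<sigma> \<in> carrier ?G" for \<sigma>
  proof -
    have s: "\<sigma> \<in> Bij K" "\<sigma> \<in> ring_hom ?R ?R" "\<And>x. x \<in> \<rat> \<Longrightarrow> \<sigma> x = x"
      using that by (auto simp: car)
    then have "number_field_hom K \<sigma>"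
      by unfold_locales (auto simp: ring_hom_def ring_of_type_algebra_def)
    moreover have "\<sigma> ` K = K" using s(1) by (simp add: Bij_def bij_betw_def)
    ultimately show ?thesis by (simp add: auts_def)
  qed
  show ?thesis
  proof
    fix s t x assume st: "s \<in> auts K" "t \<in> auts K" and x: "x \<in> K"
    have cl: "s x \<in> K" "t x \<in> K" using st x by (auto simp: auts_def)
    have "restrict s K \<otimes>\<^bsub>?G\<^esub> restrict t K = restrict t K \<otimes>\<^bsub>?G\<^esub> restrict s K"
      by (rule G.m_comm) (use st restr in auto)
    then have "compose K (restrict s K) (restrict t K) = compose K (restrict t K) (restrict s K)"
      using st restr by (simp add: gal_group_def BijGroup_def)
    from fun_cong[OF this, of x] show "s (t x) = t (s x)" using x cl by (simp add: compose_def)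
  next
    fix x assume "x \<in> K" "\<And>s. s \<in> auts K \<Longrightarrow> s x = x"
    then show "x \<in> \<rat>" using aut fix_eq by blast
  qed
qed

context abelian_number_field
begin

lemma exponent_if_uniformly_bounded:
  assumes "uniformly_bounded_local_degrees K"
  obtains N where "N > 0" "\<And>s x. s \<in> auts K \<Longrightarrow> x \<in> K \<Longrightarrow> (s ^^ N) x = x"
proof -
  obtain B where B: "\<And>p v. prime p \<Longrightarrow> extends_padic p K v \<Longrightarrow> local_degree_less K v B"
    using assms unfolding uniformly_bounded_local_degrees_def by blast
  have "\<exists>av. padic_abs K av p \<and> (\<forall>x\<in>K. rat_dependent K av B x)" if p: "prime p" for p
  proof -
    \<comment> \<open>The integers do not contain 1/p, so a p-adic absolute value on K
      exists.\<close>
    have "complex_subring \<int>" by unfold_locales auto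
    moreover have "\<int> \<subseteq> K" by (auto simp: Ints_def)
    moreover have "1 / of_nat p \<notin> (\<int> :: complex set)"
    proof
      assume "1 / of_nat p \<in> (\<int> :: complex set)"
      then obtain z where "1 / of_nat p = (of_int z :: complex)" by (auto simp: Ints_def)
      then have "of_int (z * int p) = (1 :: complex)" using prime_gt_0_nat[OF p] by (simp add: field_simps)
      then have "z * int p = 1" by (simp only: of_int_eq_1_iff)
      then show False using prime_gt_1_nat[OF p] by (simp add: zmult_eq_1_iff)
    qed
    ultimately obtain av where av: "padic_abs K av p"
      using padic_abs_exists[OF number_subfield_axioms p] by blast
    show ?thesis
      using completed.rat_dependent_if_local_degree_less[OF extends_padic_of_abs(2)[OF av]
          B[OF p extends_padic_of_abs(1)[OF av]]] av
      by blast
  qed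
  then show thesis using that[of "fact B"] exponent_if_rat_dependent[of B] by simp
qed

lemma abelian_exponent_cis:
  assumes "N > 0" "\<And>s x. s \<in> auts K \<Longrightarrow> x \<in> K \<Longrightarrow> (s ^^ N) x = x"
  shows "abelian_exponent K N (cis (2 * pi / real N))"
  by (intro abelian_exponent.intro abelian_number_field_axioms primitive_root_cis
      abelian_exponent_axioms.intro assms)

lemma generated_if_exponent:
  assumes "N > 0" "\<And>s x. s \<in> auts K \<Longrightarrow> x \<in> K \<Longrightarrow> (s ^^ N) x = x"
    and "number_field F" "F \<subseteq> K"
  shows "\<exists>S. (\<forall>x\<in>S. element_degree_le N x) \<and> F = adjoin S"
proof -
  interpret abelian_exponent K N "cis (2 * pi / real N)" by (rule abelian_exponent_cis[OF assms(1,2)])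
  have "element_degree_le N x" if "x \<in> {y \<in> F. card (orb y) \<le> N}" for x
    using that assms(4) by (intro element_degree_le_orb) auto
  then show ?thesis
    using number_field_eq_adjoin[OF number_field_number_subfield[OF assms(3)] assms(4)] by blast
qed

text \<open>The valuation is extended to all algebraic numbers, where \<zeta> and the N-th roots of
  the class representatives live. The bound depends on N alone, since \<open>local_span\<close> is
  uniform in p.\<close>

lemma uniformly_bounded_if_exponent:
  assumes "N > 0" "\<And>s x. s \<in> auts K \<Longrightarrow> x \<in> K \<Longrightarrow> (s ^^ N) x = x"
  shows "uniformly_bounded_local_degrees K"
proof -
  interpret abelian_exponent K N "cis (2 * pi / real N)" by (rule abelian_exponent_cis[OF assms])
  have "local_degree_less K v (power_classes N * N + 1)" if p: "prime p" and v: "extends_padic p K v" for p v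
  proof -
    let ?L = "{x::complex. algebraic x}"
    have KL: "K \<subseteq> ?L" using algebraic_elems by blast
    have cK: "completed K (val_abs v) p v" by (rule completed_val_abs[OF number_subfield_axioms p v])
    then have "padic_abs K (val_abs v) p" by (simp add: completed_def)
    from padic_abs_extend[OF this number_subfield_algebraic KL]
    obtain aw where aw: "padic_abs ?L aw p" and ext: "\<And>x. x \<in> K \<Longrightarrow> aw x = val_abs v x" by blast
    from local_span[OF aw] obtain E where E: "finite E" "E \<subseteq> ?L" "card E \<le> power_classes N * N"
      and sp: "\<And>x. x \<in> K \<Longrightarrow> span_approx aw E x" by auto
    obtain es where es: "set es = E" "distinct es" using finite_distinct_list[OF E(1)] by blast
    have "local_degree_less K v (length es + 1)"
      by (rule local_degree_less_if_span_approx[OF cK extends_padic_of_abs(2)[OF aw] KL ext])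
        (use E(2) sp es in auto)
    moreover have "length es \<le> power_classes N * N" using E(3) es distinct_card by metis
    ultimately show ?thesis by (auto simp: local_degree_less_def)
  qed
  then show ?thesis unfolding uniformly_bounded_local_degrees_def by (intro exI[of _ "power_classes N * N + 1"]) auto
qed

end

theorem theorem1p6:
  fixes K :: "complex set"
  assumes "abelian_extension K"
    and "\<not> finite_degree K"
  shows "(uniformly_bounded_local_degrees K \<longleftrightarrow> (\<exists>d>0. K \<subseteq> compositum_degree_le d)) \<and>
    ((\<exists>d>0. K \<subseteq> compositum_degree_le d) \<longleftrightarrow>
       (\<exists>D. \<forall>F. number_field F \<longrightarrow> F \<subseteq> K \<longrightarrow>
          (\<exists>S. (\<forall>x\<in>S. element_degree_le D x) \<and> F = adjoin S)))"
    (is "(?a \<longleftrightarrow> ?b) \<and> (?b \<longleftrightarrow> ?c)")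
proof -
  interpret abelian_number_field K by (rule abelian_number_field_if_abelian_extension) fact
  define bounded where
    "bounded \<longleftrightarrow> (\<exists>N>0. \<forall>s x. s \<in> auts K \<longrightarrow> x \<in> K \<longrightarrow> (s ^^ N) x = x)"
  have "bounded" if ?a
    using exponent_if_uniformly_bounded[OF that] unfolding bounded_def by metis
  moreover have ?a if bounded
    using that uniformly_bounded_if_exponent unfolding bounded_def by metis
  moreover have bounded if b: ?b
  proof -
    obtain d where "K \<subseteq> compositum_degree_le d" using b by blast
    then show ?thesis unfolding bounded_def
      by (intro exI[of _ "fact d"]) (simp add: auts_exponent_of_compositum)
  qed
  moreover have ?c if bounded
    using that generated_if_exponent unfolding bounded_def by metis
  moreover have ?b if c: ?c
  proof -
    obtain D where "\<And>F. number_field F \<Longrightarrow> F \<subseteq> K \<Longrightarrow>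
        \<exists>S. (\<forall>x\<in>S. element_degree_le D x) \<and> F = adjoin S"
      using c by blast
    from compositum_if_generated[OF number_subfield_axioms this] show ?thesis
      by (intro exI[of _ "max 1 D"]) auto
  qed
  ultimately show ?thesis by argo
qed

end
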